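(* Let $a>0$, $\beta\in(1/2,1]$, and let $n=n_p$, $s=s_p$ satisfy $\log\log n\sim a\log p$ and $s\sim p^{1-\beta}$ as $p\to\infty$. Define $$r_2^*(a,\beta):=\begin{cases}\beta-1/2 & 1/2<\beta\le3/4,\\ (1-\sqrt{1-\beta})^2 & 3/4<\beta<1,\\ 1+a & \beta=1.\end{cases}$$ For $r>0$ put $\rho:=\sqrt{2r\log p}$. (1) (Lower bound) If $r<r_2^*(a,\beta)$, then $\mathcal R_{\mathrm{1-side}}(p,n,\rho,s)\not\to0$ as $p\to\infty$. (2) (Upper bound) If $r>r_2^*(a,\beta)$, then $\mathcal R_{\mathrm{1-side}}(p,n,\rho,s)\to0$ as $p\to\infty$.
   Context: Observation model: $X=\theta+E\in\mathbb R^{p\times n}$, $E$ with i.i.d. $N(0,1)$ entries. $\Theta_0(p,n)$: matrices whose rows are all constant. $\Theta_1^{\mathrm{1-side}}(p,n,\rho,s)$: matrices $\theta$ for which there exist $t^*\in[n-1]$, reals $\mu_{j1},\mu_{j2}$ and $S\subseteq[p]$ with $|S|\ge s$ such that $\theta_{ji}=\mu_{j1}$ for $i\le t^*$, $\theta_{ji}=\mu_{j2}$ for $i>t^*$, and $\sqrt{t^*(n-t^* )/n}(\mu_{j1}-\mu_{j2})\ge\rho$ for all $j\in S$. $\mathcal R_{\mathrm{1-side}}(p,n,\rho,s)=\inf_\psi[\sup_{\Theta_0}\mathbb E_\theta\psi+\sup_{\Theta_1^{\mathrm{1-side}}(p,n,\rho,s)}\mathbb E_\theta(1-\psi)]$ over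 measurable tests $\psi:\mathbb R^{p\times n}\to\{0,1\}$. $a_p\sim b_p$ means $a_p/b_p\to1$. *)

theory Defs
  imports "HOL-Probability.Probability" "HOL-Library.Landau_Symbols"
begin

text \<open>Index set of a p x n matrix: rows 1..p, columns 1..n. Matrices are
  functions on nat x nat; only the values on the index set matter.\<close>
definition idx :: "nat \<Rightarrow> nat \<Rightarrow> (nat \<times> nat) set" where
  "idx p n = {1..p} \<times> {1..n}"

definition sample_space :: "nat \<Rightarrow> nat \<Rightarrow> (nat \<times> nat \<Rightarrow> real) measure" where
  "sample_space p n = PiM (idx p n) (\<lambda>_. borel)"

definition obs :: "nat \<Rightarrow> nat \<Rightarrow> (nat \<times> nat \<Rightarrow> real) \<Rightarrow> (nat \<times> nat \<Rightarrow> real) measure" where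
  "obs p n \<theta> = PiM (idx p n) (\<lambda>k. density lborel (normal_density (\<theta> k) 1))"

text \<open>Measurable tests psi : R^(p x n) -> {0,1} (True = reject = 1).\<close>
definition tests :: "nat \<Rightarrow> nat \<Rightarrow> ((nat \<times> nat \<Rightarrow> real) \<Rightarrow> bool) set" where
  "tests p n = {\<psi>. \<psi> \<in> sample_space p n \<rightarrow>\<^sub>M count_space UNIV}"

definition Theta0 :: "nat \<Rightarrow> nat \<Rightarrow> (nat \<times> nat \<Rightarrow> real) set" where
  "Theta0 p n = {\<theta>. \<exists>\<mu>::nat \<Rightarrow> real. \<forall>j\<in>{1..p}. \<forall>i\<in>{1..n}. \<theta> (j, i) = \<mu> j}"

definition Theta1_1side :: "nat \<Rightarrow> nat \<Rightarrow> real \<Rightarrow> nat \<Rightarrow> (nat \<times> nat \<Rightarrow> real) set" where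
  "Theta1_1side p n \<rho> s = {\<theta>. \<exists>t\<in>{1..n-1}. \<exists>(\<mu>1::nat \<Rightarrow> real) (\<mu>2::nat \<Rightarrow> real) S.
      S \<subseteq> {1..p} \<and> card S \<ge> s \<and>
      (\<forall>j\<in>{1..p}. \<forall>i\<in>{1..n}. \<theta> (j, i) = (if i \<le> t then \<mu>1 j else \<mu>2 j)) \<and>
      (\<forall>j\<in>S. sqrt (real t * (real n - real t) / real n) * (\<mu>1 j - \<mu>2 j) \<ge> \<rho>)}"

definition rej_prob :: "nat \<Rightarrow> nat \<Rightarrow> (nat \<times> nat \<Rightarrow> real) \<Rightarrow> ((nat \<times> nat \<Rightarrow> real) \<Rightarrow> bool) \<Rightarrow> ennreal" where
  "rej_prob p n \<theta> \<psi> = emeasure (obs p n \<theta>) {x \<in> space (obs p n \<theta>). \<psi> x}"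

definition acc_prob :: "nat \<Rightarrow> nat \<Rightarrow> (nat \<times> nat \<Rightarrow> real) \<Rightarrow> ((nat \<times> nat \<Rightarrow> real) \<Rightarrow> bool) \<Rightarrow> ennreal" where
  "acc_prob p n \<theta> \<psi> = emeasure (obs p n \<theta>) {x \<in> space (obs p n \<theta>). \<not> \<psi> x}"

definition risk_1side :: "nat \<Rightarrow> nat \<Rightarrow> real \<Rightarrow> nat \<Rightarrow> ennreal" where
  "risk_1side p n \<rho> s = (INF \<psi>\<in>tests p n.
      (SUP \<theta>\<in>Theta0 p n. rej_prob p n \<theta> \<psi>) + (SUP \<theta>\<in>Theta1_1side p n \<rho> s. acc_prob p n \<theta> \<psi>))"

text \<open>The detection boundary r_2^*(a,beta) (for 1/2 < beta <= 1).\<close>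
definition r2star :: "real \<Rightarrow> real \<Rightarrow> real" where
  "r2star a \<beta> = (if \<beta> \<le> 3/4 then \<beta> - 1/2
                  else if \<beta> < 1 then (1 - sqrt (1 - \<beta>))\<^sup>2
                  else 1 + a)"

end

theory Submission
  imports Defs "HOL-Real_Asymp.Real_Asymp"
begin

text \<open>
  For a candidate change point \<open>t\<close> the standardised difference \<open>z\<^sub>j\<^sub>t\<close> of the two segment means of
  row \<open>j\<close> is a unit Gaussian, centred under the null and of mean at least \<open>\<rho>\<close> times the correlation of
  the contrasts at \<open>t\<close> and at the true change point otherwise. That correlation is the square root of
  the ratio of the odds \<open>t / (n - t)\<close>, so \<open>O(log n)\<close> candidates suffice, and about \<open>log n\<close> of them are
  nearly orthogonal.

  Lower bound: \<open>S\<close> takes one uniform row in each of \<open>s\<close> blocks and \<open>t\<close> is uniform on a geometric grid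
  (one point if \<open>\<beta> < 1\<close>). After truncating to \<open>z\<^sub>j\<^sub>t \<le> y\<close> the likelihood ratio has a bounded second
  moment, which keeps the Bayes risk away from \<open>0\<close>.

  Upper bound, \<open>\<beta> = 1\<close>: reject if some \<open>z\<^sub>j\<^sub>t\<close> exceeds \<open>y\<close>. For \<open>\<beta> < 1\<close> the number of exceedances of
  \<open>y\<close> could be lowered by negative jumps outside \<open>S\<close>; subtracting \<open>exp (- y\<^sup>2 / 2)\<close> times the number of
  positive \<open>z\<^sub>j\<^sub>t\<close> gives a sum whose mean is smallest when all row means vanish. Its exponential
  moments yield error probabilities small enough for a union bound over the grid, because \<open>log n\<close> is
  only polynomial in \<open>p\<close>.\<close>

section \<open>Gaussian product measures\<close>

text \<open>The obstacle in the lower bound is the plain second moment: rare large \<open>z\<close>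
  make every row common to two equal alternatives contribute
  \<open>exp (\<rho>\<^sup>2) = p powr (2 * r)\<close>, which for \<beta> = 1 would reach only r <
  (1 + a) / 2. The indicator of \<open>z \<le> y\<close> is therefore relaxed to the weight
  \<open>exp (\<mu> * (y - z))\<close> with a free \<mu> \<ge> 0. All expectations then remain exact
  Gaussian exponential moments, and the boundary comes out of an optimisation over exponents of
  \<open>p\<close>. The same holds for the upper bound, where the level \<open>y\<close> and the
  Chernoff parameter \<open>h\<close> are free.

  The number of columns acts only through \<open>ln n\<close>, which is \<open>p powr a\<close> up
  to factors \<open>p powr e\<close> with arbitrarily small \<open>e\<close>: it is the effective
  number of change points. For \<beta> = 1 it multiplies the \<open>p\<close> rows in which a single
  signal can hide, whence 1 + a. For \<beta> < 1 the error probabilities of the score test decay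
  faster than every power of \<open>p\<close>, so that \<open>a\<close> disappears from the
  boundary.\<close>

definition gauss_vec :: "'i set \<Rightarrow> ('i \<Rightarrow> real) \<Rightarrow> ('i \<Rightarrow> real) measure" where
  "gauss_vec I \<theta> = PiM I (\<lambda>k. density lborel (normal_density (\<theta> k) 1))"

lemma obs_eq_gauss_vec: "obs p n \<theta> = gauss_vec (idx p n) \<theta>"
  by (simp add: obs_def gauss_vec_def)

lemma sets_gauss_vec [measurable_cong]: "sets (gauss_vec I \<theta>) = sets (PiM I (\<lambda>_. borel))"
  unfolding gauss_vec_def by (intro sets_PiM_cong) auto

lemma space_gauss_vec: "space (gauss_vec I \<theta>) = PiE I (\<lambda>_. UNIV)"
  unfolding gauss_vec_def by (simp add: space_PiM)

lemma prob_space_gauss_vec: "prob_space (gauss_vec I \<theta>)"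
  unfolding gauss_vec_def by (intro prob_space_PiM prob_space_normal_density) auto

lemma normal_density_shift:
  "normal_density \<theta> 1 x = normal_density 0 1 x * exp (\<theta> * x - \<theta>\<^sup>2 / 2)"
proof -
  have "-(x - \<theta>)\<^sup>2 / 2 = -x\<^sup>2 / 2 + (\<theta> * x - \<theta>\<^sup>2 / 2)"
    by (simp add: power2_eq_square field_simps)
  then show ?thesis
    by (simp add: normal_density_def exp_add[symmetric])
qed

text \<open>Finite-dimensional Cameron-Martin formula. Both sides are compared on boxes, which
  determine a product measure; there the density splits over the coordinates, and each factor is
  \<open>normal_density_shift\<close>.\<close>

lemma gauss_vec_density:
  assumes I: "finite I"
  shows "gauss_vec I \<theta> = density (gauss_vec I (\<lambda>_. 0))
    (\<lambda>x. ennreal (exp (\<Sum>k\<in>I. \<theta> k * x k - (\<theta> k)\<^sup>2 / 2)))"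
    (is "_ = density ?N ?L")
proof -
  interpret P: product_sigma_finite "\<lambda>k. density lborel (normal_density (\<theta> k) 1)"
    by (rule product_sigma_finite.intro)
      (simp add: prob_space_normal_density prob_space_imp_sigma_finite)
  interpret P0: product_sigma_finite "\<lambda>k::'a. density lborel (normal_density 0 1)"
    by (rule product_sigma_finite.intro)
      (simp add: prob_space_normal_density prob_space_imp_sigma_finite)
  have meas: "?L \<in> borel_measurable ?N"
    by measurable
  have "density ?N ?L = PiM I (\<lambda>k. density lborel (normal_density (\<theta> k) 1))"
  proof (rule P.PiM_eqI[OF I])
    show "sets (density ?N ?L) = sets (PiM I (\<lambda>k. density lborel (normal_density (\<theta> k) 1)))"
      using sets_gauss_vec[of I "\<lambda>_. 0"] sets_gauss_vec[of I \<theta>] by (simp add: gauss_vec_def)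
  next
    fix A :: "'a \<Rightarrow> real set"
    assume "\<And>i. i \<in> I \<Longrightarrow> A i \<in> sets (density lborel (normal_density (\<theta> i) 1))"
    then have A [measurable]: "\<And>i. i \<in> I \<Longrightarrow> A i \<in> sets borel" by simp
    have AA: "Pi\<^sub>E I A \<in> sets ?N"
      unfolding sets_gauss_vec using A I by (intro sets_PiM_I_finite) auto
    have "emeasure (density ?N ?L) (Pi\<^sub>E I A) = (\<integral>\<^sup>+x. ?L x * indicator (Pi\<^sub>E I A) x \<partial>?N)"
      by (rule emeasure_density[OF meas AA])
    also have "\<dots> = (\<integral>\<^sup>+x. (\<Prod>k\<in>I. ennreal (exp (\<theta> k * x k - (\<theta> k)\<^sup>2 / 2)) * indicator (A k) (x k)) \<partial>?N)"
    proof (rule nn_integral_cong)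
      fix x assume x: "x \<in> space ?N"
      have "indicator (Pi\<^sub>E I A) x = (\<Prod>k\<in>I. indicator (A k) (x k) :: ennreal)"
      proof (cases "x \<in> Pi\<^sub>E I A")
        case True then show ?thesis by (auto simp: PiE_iff intro!: prod.neutral[symmetric])
      next
        case False
        then obtain k where "k \<in> I" "x k \<notin> A k" using x by (auto simp: PiE_iff space_gauss_vec)
        then show ?thesis using False I by (subst prod_zero) (auto intro!: bexI[of _ k])
      qed
      then show "?L x * indicator (Pi\<^sub>E I A) x =
          (\<Prod>k\<in>I. ennreal (exp (\<theta> k * x k - (\<theta> k)\<^sup>2 / 2)) * indicator (A k) (x k))"
        by (simp add: exp_sum[OF I] prod_ennreal[symmetric] prod.distrib)
    qed
    also have "\<dots> = (\<Prod>k\<in>I. \<integral>\<^sup>+y. ennreal (exp (\<theta> k * y - (\<theta> k)\<^sup>2 / 2)) * indicator (A k) y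
        \<partial>density lborel (normal_density 0 1))"
      unfolding gauss_vec_def using I A by (intro P0.product_nn_integral_prod) auto
    also have "\<dots> = (\<Prod>k\<in>I. emeasure (density lborel (normal_density (\<theta> k) 1)) (A k))"
    proof (rule prod.cong[OF refl])
      fix k assume k: "k \<in> I"
      note [measurable] = A[OF k]
      have "(\<integral>\<^sup>+y. ennreal (exp (\<theta> k * y - (\<theta> k)\<^sup>2 / 2)) * indicator (A k) y
          \<partial>density lborel (normal_density 0 1)) =
        (\<integral>\<^sup>+y. ennreal (normal_density 0 1 y) * (ennreal (exp (\<theta> k * y - (\<theta> k)\<^sup>2 / 2)) * indicator (A k) y) \<partial>lborel)"
        by (rule nn_integral_density) auto
      also have "\<dots> = (\<integral>\<^sup>+y. ennreal (normal_density (\<theta> k) 1 y) * indicator (A k) y \<partial>lborel)"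
        by (intro nn_integral_cong)
          (simp add: normal_density_shift[of "\<theta> k"] ennreal_mult mult.assoc)
      also have "\<dots> = emeasure (density lborel (normal_density (\<theta> k) 1)) (A k)"
        by (rule emeasure_density[symmetric]) auto
      finally show "(\<integral>\<^sup>+y. ennreal (exp (\<theta> k * y - (\<theta> k)\<^sup>2 / 2)) * indicator (A k) y
          \<partial>density lborel (normal_density 0 1)) = emeasure (density lborel (normal_density (\<theta> k) 1)) (A k)" .
    qed
    finally show "emeasure (density ?N ?L) (Pi\<^sub>E I A) =
      (\<Prod>k\<in>I. emeasure (density lborel (normal_density (\<theta> k) 1)) (A k))" .
  qed
  then show ?thesis by (simp add: gauss_vec_def)
qed

text \<open>No Gaussian integral is computed: the formula expresses that the law with mean
  \<open>c\<close> in \<open>gauss_vec_density\<close> has total mass one.\<close>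

lemma nn_integral_exp_gauss_vec:
  assumes I: "finite I"
  shows "(\<integral>\<^sup>+x. ennreal (exp (\<Sum>k\<in>I. c k * x k)) \<partial>gauss_vec I (\<lambda>_. 0)) =
    ennreal (exp (\<Sum>k\<in>I. (c k)\<^sup>2 / 2))"
proof -
  let ?N = "gauss_vec I (\<lambda>_. 0) :: ('a \<Rightarrow> real) measure"
  let ?s = "\<Sum>k\<in>I. (c k)\<^sup>2 / 2"
  have "1 = emeasure (gauss_vec I c) (space (gauss_vec I c))"
    using prob_space.emeasure_space_1[OF prob_space_gauss_vec] by metis
  also have "\<dots> = emeasure (density ?N (\<lambda>x. ennreal (exp (\<Sum>k\<in>I. c k * x k - (c k)\<^sup>2 / 2)))) (space ?N)"
    by (subst gauss_vec_density[OF I]) (simp add: space_gauss_vec)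
  also have "\<dots> = (\<integral>\<^sup>+x. ennreal (exp (\<Sum>k\<in>I. c k * x k - (c k)\<^sup>2 / 2)) * indicator (space ?N) x \<partial>?N)"
    by (rule emeasure_density) auto
  also have "\<dots> = (\<integral>\<^sup>+x. ennreal (exp (- ?s)) * ennreal (exp (\<Sum>k\<in>I. c k * x k)) \<partial>?N)"
    by (intro nn_integral_cong) (simp add: sum_subtractf ennreal_mult[symmetric] exp_add[symmetric])
  also have "\<dots> = ennreal (exp (- ?s)) * (\<integral>\<^sup>+x. ennreal (exp (\<Sum>k\<in>I. c k * x k)) \<partial>?N)"
    by (rule nn_integral_cmult) auto
  finally have "ennreal (exp ?s) * 1 = ennreal (exp ?s) * (ennreal (exp (- ?s)) * (\<integral>\<^sup>+x. ennreal (exp (\<Sum>k\<in>I. c k * x k)) \<partial>?N))"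
    by simp
  then show ?thesis
    by (simp add: mult.assoc[symmetric] ennreal_mult[symmetric] exp_add[symmetric])
qed

lemma indep_vars_gauss_vec:
  assumes I: "finite I"
  shows "prob_space.indep_vars (gauss_vec I \<theta>) (\<lambda>_. borel) (\<lambda>k x. x k) I"
proof (cases "I = {}")
  interpret prob_space "gauss_vec I \<theta>" by (rule prob_space_gauss_vec)
  case True
  show ?thesis unfolding indep_vars_def2 indep_sets_def using True by auto
next
  interpret prob_space "gauss_vec I \<theta>" by (rule prob_space_gauss_vec)
  case False
  have comp: "distr (gauss_vec I \<theta>) borel (\<lambda>x. x k) = density lborel (normal_density (\<theta> k) 1)" if "k \<in> I" for k
  proof -
    have "distr (gauss_vec I \<theta>) (density lborel (normal_density (\<theta> k) 1)) (\<lambda>x. x k) = density lborel (normal_density (\<theta> k) 1)"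
      unfolding gauss_vec_def
      by (rule distr_PiM_component[OF _ that]) (simp add: prob_space_normal_density)
    moreover have "distr (gauss_vec I \<theta>) borel (\<lambda>x. x k) =
        distr (gauss_vec I \<theta>) (density lborel (normal_density (\<theta> k) 1)) (\<lambda>x. x k)"
      by (rule distr_cong) auto
    ultimately show ?thesis by simp
  qed
  have "distr (gauss_vec I \<theta>) (PiM I (\<lambda>_. borel)) (\<lambda>x. \<lambda>i\<in>I. x i) = gauss_vec I \<theta>"
  proof -
    have "distr (gauss_vec I \<theta>) (PiM I (\<lambda>_. borel)) (\<lambda>x. \<lambda>i\<in>I. x i) = distr (gauss_vec I \<theta>) (gauss_vec I \<theta>) (\<lambda>x. x)"
      by (rule distr_cong) (auto simp: sets_gauss_vec space_gauss_vec PiE_restrict)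
    then show ?thesis by simp
  qed
  also have "\<dots> = PiM I (\<lambda>k. distr (gauss_vec I \<theta>) borel (\<lambda>x. x k))"
    unfolding gauss_vec_def[of I \<theta>] by (intro PiM_cong refl) (simp add: comp[unfolded gauss_vec_def])
  finally show ?thesis
    by (subst indep_vars_iff_distr_eq_PiM'[OF False]) auto
qed

lemma distributed_gauss_vec_component:
  assumes "k \<in> I"
  shows "distributed (gauss_vec I \<theta>) lborel (\<lambda>x. x k) (normal_density (\<theta> k) 1)"
proof -
  have "distr (gauss_vec I \<theta>) (density lborel (normal_density (\<theta> k) 1)) (\<lambda>x. x k) = density lborel (normal_density (\<theta> k) 1)"
    unfolding gauss_vec_def
    by (rule distr_PiM_component[OF _ assms]) (simp add: prob_space_normal_density)
  moreover have "distr (gauss_vec I \<theta>) lborel (\<lambda>x. x k) =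
      distr (gauss_vec I \<theta>) (density lborel (normal_density (\<theta> k) 1)) (\<lambda>x. x k)"
    by (rule distr_cong) auto
  moreover have "(\<lambda>x. x k) \<in> measurable (gauss_vec I \<theta>) lborel"
    using assms by measurable
  ultimately show ?thesis by (simp add: distributed_def)
qed

text \<open>The coefficients must not vanish because each summand \<open>c k * x k\<close> has to be
  a normal variable with positive deviation \<open>\<bar>c k\<bar>\<close>. In the application
  \<open>K\<close> is a single row of the matrix.\<close>

lemma distributed_gauss_vec_lin:
  assumes I: "finite I" and K: "K \<subseteq> I" "K \<noteq> {}" and c: "\<And>k. k \<in> K \<Longrightarrow> c k \<noteq> 0"
    and unit: "(\<Sum>k\<in>K. (c k)\<^sup>2) = 1"
  shows "distributed (gauss_vec I \<theta>) lborel (\<lambda>x. \<Sum>k\<in>K. c k * x k)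
    (normal_density (\<Sum>k\<in>K. c k * \<theta> k) 1)"
proof -
  interpret prob_space "gauss_vec I \<theta>" by (rule prob_space_gauss_vec)
  have "distributed (gauss_vec I \<theta>) lborel (\<lambda>x. \<Sum>k\<in>K. c k * x k)
    (normal_density (\<Sum>k\<in>K. c k * \<theta> k) (sqrt (\<Sum>k\<in>K. \<bar>c k\<bar>\<^sup>2)))"
  proof (rule sum_indep_normal)
    show "finite K" using I K finite_subset by blast
    show "indep_vars (\<lambda>_. borel) (\<lambda>k x. c k * x k) K"
      using indep_vars_compose2[OF indep_vars_subset[OF indep_vars_gauss_vec[OF I] K(1)],
          of "\<lambda>k y. c k * y" "\<lambda>_. borel"] by simp
    show "distributed (gauss_vec I \<theta>) lborel (\<lambda>x. c k * x k) (normal_density (c k * \<theta> k) \<bar>c k\<bar>)"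
      if "k \<in> K" for k
      using normal_density_affine[OF distributed_gauss_vec_component[of k I \<theta>], of "c k" 0] that K c
      by auto
  qed (use K c in auto)
  then show ?thesis by (simp add: unit)
qed

section \<open>Gaussian tails\<close>

definition gauss_tail :: "real \<Rightarrow> real" where
  "gauss_tail y = measure (density lborel (normal_density 0 1)) {y<..}"

lemma gauss_tail_eq_integral:
  "gauss_tail y = (\<integral>u. normal_density 0 1 u * indicator {y<..} u \<partial>lborel)"
proof -
  have "gauss_tail y = (\<integral>u. indicator {y<..} u \<partial>density lborel (normal_density 0 1))"
    by (simp add: gauss_tail_def)
  also have "\<dots> = (\<integral>u. normal_density 0 1 u * indicator {y<..} u \<partial>lborel)"
    by (subst integral_density) auto
  finally show ?thesis .
qed

text \<open>Measuring the integration variable from \<open>x\<close> makes the tails for all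
  \<open>y\<close> integrals of one function, \<open>\<phi> (x + u)\<close>, which can be compared
  pointwise with \<open>exp (- x\<^sup>2 / 2) * \<phi> u\<close>.\<close>

lemma gauss_tail_translate:
  "gauss_tail (x + y) = (\<integral>u. normal_density 0 1 (x + u) * indicator {y<..} u \<partial>lborel)"
proof -
  have "gauss_tail (x + y) = (\<integral>u. normal_density 0 1 (x + u) * indicator {x + y<..} (x + u) \<partial>lborel)"
    using lborel_integral_real_affine[of 1 "\<lambda>u. normal_density 0 1 u * indicator {x + y<..} u" x]
    by (simp add: gauss_tail_eq_integral)
  also have "\<dots> = (\<integral>u. normal_density 0 1 (x + u) * indicator {y<..} u \<partial>lborel)"
    by (intro Bochner_Integration.integral_cong refl) (auto simp: indicator_def)
  finally show ?thesis .
qed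

lemma integrable_normal_indicator:
  "integrable lborel (\<lambda>u. normal_density 0 1 (x + u) * indicator {y<..} u)"
proof (rule Bochner_Integration.integrable_bound)
  show "integrable lborel (\<lambda>u. normal_density 0 1 (x + 1 * u))"
    using integrable_normal_density[of 1 0] by (intro lborel_integrable_real_affine) auto
qed (auto simp: indicator_def)

lemma gauss_tail_nonneg: "0 \<le> gauss_tail y"
  by (simp add: gauss_tail_def)

lemma gauss_tail_le_1: "gauss_tail y \<le> 1"
proof -
  interpret prob_space "density lborel (normal_density 0 1)"
    by (rule prob_space_normal_density) simp
  show ?thesis by (simp add: gauss_tail_def)
qed

lemma gauss_tail_antimono: "x \<le> y \<Longrightarrow> gauss_tail y \<le> gauss_tail x"
proof -
  interpret prob_space "density lborel (normal_density 0 1)"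
    by (rule prob_space_normal_density) simp
  assume "x \<le> y"
  then show ?thesis by (auto simp: gauss_tail_def intro!: finite_measure_mono)
qed

lemma normal_density_add:
  "normal_density 0 1 (x + u) = normal_density 0 1 u * (exp (- x * u) * exp (- x\<^sup>2 / 2))"
proof -
  have "- (x + u)\<^sup>2 / 2 = - u\<^sup>2 / 2 + (- x * u + - x\<^sup>2 / 2)"
    by (simp add: power2_eq_square field_simps)
  then have "exp (- (x + u)\<^sup>2 / 2) = exp (- u\<^sup>2 / 2) * (exp (- x * u) * exp (- x\<^sup>2 / 2))"
    by (simp only: exp_add)
  then show ?thesis
    by (simp add: normal_density_def)
qed

lemma gauss_tail_le:
  assumes "0 \<le> x" shows "gauss_tail x \<le> exp (- x\<^sup>2 / 2)"
proof -
  have "gauss_tail (x + 0) \<le> (\<integral>u. normal_density 0 1 u * exp (- x\<^sup>2 / 2) \<partial>lborel)"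
    unfolding gauss_tail_translate
  proof (rule integral_mono)
    show "normal_density 0 1 (x + u) * indicator {0<..} u \<le> normal_density 0 1 u * exp (- x\<^sup>2 / 2)" for u
    proof (cases "u > 0")
      case True
      then have "exp (- x * u) \<le> 1" using assms by simp
      then have "normal_density 0 1 u * (exp (- x * u) * exp (- x\<^sup>2 / 2)) \<le>
          normal_density 0 1 u * (1 * exp (- x\<^sup>2 / 2))"
        by (intro mult_left_mono mult_right_mono) auto
      then show ?thesis using True by (simp add: normal_density_add)
    qed auto
  qed (auto intro: integrable_normal_indicator)
  then show ?thesis by simp
qed

text \<open>Only the interval from \<open>y\<close> to \<open>y + 1\<close> is kept. The loss
  against \<open>exp (- y\<^sup>2 / 2)\<close> is of order \<open>exp (- y)\<close>, which is
  subpolynomial in \<open>p\<close> for \<open>y\<close> of order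
  \<open>sqrt (ln p)\<close>.\<close>

lemma gauss_tail_ge:
  assumes "0 \<le> y" shows "exp (- (y + 1)\<^sup>2 / 2) / sqrt (2 * pi) \<le> gauss_tail y"
proof -
  have "exp (- (y + 1)\<^sup>2 / 2) / sqrt (2 * pi) =
      (\<integral>u. (exp (- (y + 1)\<^sup>2 / 2) / sqrt (2 * pi)) * indicator {y<..y+1} u \<partial>lborel)"
    by simp
  also have "\<dots> \<le> (\<integral>u. normal_density 0 1 u * indicator {y<..} u \<partial>lborel)"
  proof (rule integral_mono)
    show "integrable lborel (\<lambda>u. normal_density 0 1 u * indicator {y<..} u)"
      using integrable_normal_indicator[of 0 y] by simp
    show "exp (- (y + 1)\<^sup>2 / 2) / sqrt (2 * pi) * indicator {y<..y+1} u \<le>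
        normal_density 0 1 u * indicator {y<..} u" for u
    proof (cases "u \<in> {y<..y+1}")
      case True
      then have "u\<^sup>2 \<le> (y + 1)\<^sup>2" using assms by (intro power_mono) auto
      then show ?thesis using True by (simp add: normal_density_def divide_right_mono)
    qed auto
  qed auto
  finally show ?thesis by (simp add: gauss_tail_eq_integral)
qed

text \<open>The difference of the two sides integrates
  \<open>\<phi> (x + u) - exp (- x\<^sup>2 / 2) * \<phi> u\<close>, which changes sign only at \<open>u = 0\<close>.\<close>
lemma gauss_tail_tangent:
  assumes "0 \<le> x"
  shows "gauss_tail x - exp (- x\<^sup>2 / 2) * gauss_tail 0 \<le>
    gauss_tail (x - m) - exp (- x\<^sup>2 / 2) * gauss_tail (- m)"
proof -
  let ?l = "exp (- x\<^sup>2 / 2)" and ?\<phi> = "normal_density 0 1"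
  have int: "integrable lborel (\<lambda>u. ?\<phi> (x + u) * indicator {y<..} u)"
       "integrable lborel (\<lambda>u. ?l * (?\<phi> u * indicator {y<..} u))" for y
    using integrable_normal_indicator[of x y] integrable_normal_indicator[of 0 y] by auto
  have eq: "gauss_tail (x + y) - ?l * gauss_tail y =
      (\<integral>u. ?\<phi> (x + u) * indicator {y<..} u - ?l * (?\<phi> u * indicator {y<..} u) \<partial>lborel)" for y
    using gauss_tail_translate[of 0 y]
    by (subst Bochner_Integration.integral_diff[OF int]) (simp add: gauss_tail_translate)
  have "gauss_tail (x + 0) - ?l * gauss_tail 0 \<le> gauss_tail (x + - m) - ?l * gauss_tail (- m)"
    unfolding eq
  proof (rule integral_mono)
    fix u
    have 1: "?\<phi> (x + u) \<le> ?l * ?\<phi> u" if "u \<ge> 0"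
    proof -
      have "?\<phi> u * (exp (- x * u) * ?l) \<le> ?\<phi> u * (1 * ?l)"
        using that assms by (intro mult_left_mono mult_right_mono) auto
      then show ?thesis by (simp add: normal_density_add mult.commute)
    qed
    have 2: "?\<phi> (x + u) \<ge> ?l * ?\<phi> u" if "u \<le> 0"
    proof -
      have "?\<phi> u * (exp (- x * u) * ?l) \<ge> ?\<phi> u * (1 * ?l)"
        using that assms by (intro mult_left_mono mult_right_mono) (auto simp: mult_nonneg_nonpos)
      then show ?thesis by (simp add: normal_density_add mult.commute)
    qed
    show "?\<phi> (x + u) * indicator {0<..} u - ?l * (?\<phi> u * indicator {0<..} u) \<le>
      ?\<phi> (x + u) * indicator {- m<..} u - ?l * (?\<phi> u * indicator {- m<..} u)"
      using 1 2 by (cases "u > 0"; cases "u > -m") auto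
  qed (use int in auto)
  then show ?thesis by simp
qed

lemma (in prob_space) prob_normal_greater:
  assumes "distributed M lborel X (normal_density m 1)"
  shows "prob {\<omega> \<in> space M. X \<omega> > y} = gauss_tail (y - m)"
proof -
  have X: "distributed M lborel (\<lambda>\<omega>. - m + 1 * X \<omega>) (normal_density 0 1)"
    using normal_density_affine[OF assms, of 1 "- m"] by simp
  then have meas: "(\<lambda>\<omega>. - m + 1 * X \<omega>) \<in> measurable M lborel" by (rule distributed_measurable)
  have "prob {\<omega> \<in> space M. X \<omega> > y} = measure (distr M lborel (\<lambda>\<omega>. - m + 1 * X \<omega>)) {y - m<..}"
    by (subst measure_distr[OF meas]) (auto intro!: arg_cong[where f="measure M"])
  also have "\<dots> = gauss_tail (y - m)"
    unfolding gauss_tail_def by (subst distributed_distr_eq_density[OF X]) simp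
  finally show ?thesis .
qed

section \<open>Change-point contrasts\<close>

text \<open>The unit vector that is constant on both segments, orthogonal to the constant vectors
  and positive on the first segment.\<close>

definition contrast :: "nat \<Rightarrow> nat \<Rightarrow> nat \<Rightarrow> real" where
  "contrast n t i = (if i \<le> t then sqrt ((real n - real t) / (real n * real t))
    else - sqrt (real t / (real n * (real n - real t))))"

definition zstat :: "nat \<Rightarrow> nat \<Rightarrow> nat \<Rightarrow> (nat \<times> nat \<Rightarrow> real) \<Rightarrow> real" where
  "zstat n t j x = (\<Sum>i\<in>{1..n}. contrast n t i * x (j, i))"

text \<open>As the noise is white and the contrasts are unit vectors, this is the correlation of
  \<open>zstat n t j\<close> and \<open>zstat n u j\<close>.\<close>

definition contrast_corr :: "nat \<Rightarrow> nat \<Rightarrow> nat \<Rightarrow> real" where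
  "contrast_corr n t u = (\<Sum>i\<in>{1..n}. contrast n t i * contrast n u i)"

lemma sum_two_steps:
  fixes A B A' B' :: real
  assumes "t \<le> u" "u \<le> n"
  shows "(\<Sum>i\<in>{1..n}. (if i \<le> t then A else B) * (if i \<le> u then A' else B')) =
    real t * (A * A') + (real u - real t) * (B * A') + (real n - real u) * (B * B')"
proof -
  have "{1..n} = {1..t} \<union> ({t+1..u} \<union> {u+1..n})" using assms by auto
  then have "(\<Sum>i\<in>{1..n}. (if i \<le> t then A else B) * (if i \<le> u then A' else B')) =
    (\<Sum>i\<in>{1..t}. (if i \<le> t then A else B) * (if i \<le> u then A' else B')) +
    ((\<Sum>i\<in>{t+1..u}. (if i \<le> t then A else B) * (if i \<le> u then A' else B')) +
    (\<Sum>i\<in>{u+1..n}. (if i \<le> t then A else B) * (if i \<le> u then A' else B')))"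
    using assms by (simp only:) (subst sum.union_disjoint, auto simp: sum.union_disjoint)
  also have "(\<Sum>i\<in>{1..t}. (if i \<le> t then A else B) * (if i \<le> u then A' else B')) = (\<Sum>i\<in>{1..t}. A * A')"
    using assms by (intro sum.cong) auto
  also have "(\<Sum>i\<in>{t+1..u}. (if i \<le> t then A else B) * (if i \<le> u then A' else B')) = (\<Sum>i\<in>{t+1..u}. B * A')"
    using assms by (intro sum.cong) auto
  also have "(\<Sum>i\<in>{u+1..n}. (if i \<le> t then A else B) * (if i \<le> u then A' else B')) = (\<Sum>i\<in>{u+1..n}. B * B')"
    using assms by (intro sum.cong) auto
  finally show ?thesis using assms by (simp add: of_nat_diff)
qed

text \<open>The first identity is orthogonality to the constants. The second says that the drop of
  the contrast at \<open>t\<close> is the reciprocal of the factor scaling the jumps in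
  \<open>Theta1_1side\<close>.\<close>

lemma contrast_step:
  assumes "1 \<le> t" "t < n"
  defines "A \<equiv> sqrt ((real n - real t) / (real n * real t))"
    and "B \<equiv> sqrt (real t / (real n * (real n - real t)))"
  shows "real t * A = (real n - real t) * B"
    and "A + B = 1 / sqrt (real t * (real n - real t) / real n)"
    and "A > 0" and "B > 0"
proof -
  have pos: "real t > 0" "real n - real t > 0" "real n > 0" using assms(1,2) by auto
  show "A > 0" "B > 0" using pos by (auto simp: A_def B_def)
  have "(real t * A)\<^sup>2 = ((real n - real t) * B)\<^sup>2"
    using pos by (simp add: A_def B_def power_mult_distrib) (simp add: power2_eq_square divide_simps)
  then show tA: "real t * A = (real n - real t) * B"
    by (rule power2_eq_imp_eq) (use pos \<open>A > 0\<close> \<open>B > 0\<close> in auto)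
  let ?g = "sqrt (real t * (real n - real t) / real n)"
  have "(real t * A)\<^sup>2 = ?g\<^sup>2"
    using pos by (simp add: A_def power_mult_distrib) (simp add: power2_eq_square divide_simps)
  then have 1: "real t * A = ?g"
    by (rule power2_eq_imp_eq) (use pos \<open>A > 0\<close> in auto)
  have g2: "?g * ?g = real t * (real n - real t) / real n" using pos by auto
  have A: "A = ?g / real t" and B: "B = ?g / (real n - real t)"
    using 1 tA pos by (auto simp: field_simps)
  have "(A + B) * ?g = 1"
    unfolding A B distrib_right times_divide_eq_left g2 using pos by (simp add: field_simps)
  moreover have "?g > 0" using pos by simp
  ultimately show "A + B = 1 / ?g" by (simp only: eq_divide_eq) auto
qed

lemma contrast_nonzero: "1 \<le> t \<Longrightarrow> t < n \<Longrightarrow> contrast n t i \<noteq> 0"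
  using contrast_step(3,4)[of t n] by (auto simp: contrast_def)

text \<open>On the log-odds scale \<open>x = ln (t / (n - t))\<close> the correlation is
  \<open>exp (- \<bar>x - x'\<bar> / 2)\<close>, the covariance of a stationary Ornstein-Uhlenbeck
  process. Nearby log odds are interchangeable (upper bound), distant ones almost independent (lower
  bound).\<close>

lemma contrast_corr_eq:
  assumes "1 \<le> t" "t \<le> u" "u < n"
  shows "contrast_corr n t u = sqrt ((real t / (real n - real t)) / (real u / (real n - real u)))"
proof -
  define A where "A = (\<lambda>t. sqrt ((real n - real t) / (real n * real t)))"
  define B where "B = (\<lambda>t. sqrt (real t / (real n * (real n - real t))))"
  have pos: "real t > 0" "real n - real t > 0" "real n > 0" "real u > 0" "real n - real u > 0"
    using assms by auto
  note t = contrast_step[of t n, folded A_def B_def]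
  have 1: "real t * A t = (real n - real t) * B t" "real u * A u = (real n - real u) * B u"
    using contrast_step(1)[of t n] contrast_step(1)[of u n] assms by (auto simp: A_def B_def)
  have "contrast_corr n t u = (\<Sum>i\<in>{1..n}. (if i \<le> t then A t else - B t) * (if i \<le> u then A u else - B u))"
    unfolding contrast_corr_def contrast_def A_def B_def ..
  also have "\<dots> = real t * (A t * A u) + (real u - real t) * (- B t * A u) + (real n - real u) * (- B t * - B u)"
    using assms by (intro sum_two_steps) auto
  also have "\<dots> = (real t * A t) * A u - (real u - real t) * (B t * A u) + ((real n - real u) * B u) * B t"
    by (simp add: algebra_simps)
  \<comment> \<open>Orthogonality rewrites all three terms as multiples of \<open>B t * A u\<close>,
    with coefficients \<open>n - t\<close>, \<open>- (u - t)\<close> and \<open>u\<close>, whose sum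
    is \<open>n\<close>.\<close>
  also have "\<dots> = real n * (B t * A u)"
    unfolding 1[symmetric] unfolding 1(1) by (simp add: algebra_simps)
  also have "\<dots> = sqrt ((real t / (real n - real t)) / (real u / (real n - real u)))"
  proof (rule power2_eq_imp_eq)
    show "(real n * (B t * A u))\<^sup>2 = (sqrt ((real t / (real n - real t)) / (real u / (real n - real u))))\<^sup>2"
      using pos by (simp add: A_def B_def power_mult_distrib) (simp add: power2_eq_square divide_simps)
  qed (use pos in \<open>auto simp: A_def B_def\<close>)
  finally show ?thesis .
qed

lemma contrast_corr_commute: "contrast_corr n t u = contrast_corr n u t"
  by (simp add: contrast_corr_def mult.commute)

lemma contrast_corr_self: "1 \<le> t \<Longrightarrow> t < n \<Longrightarrow> contrast_corr n t t = 1"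
  by (subst contrast_corr_eq) auto

lemma sum_contrast: 
  assumes "1 \<le> t" "t < n" shows "(\<Sum>i\<in>{1..n}. contrast n t i) = 0"
  \<comment> \<open>With \<open>u = n\<close> and both values \<open>1\<close> the second step
    function is the constant 1.\<close>
  using sum_two_steps[of t n n "sqrt ((real n - real t) / (real n * real t))"
      "- sqrt (real t / (real n * (real n - real t)))" 1 1] contrast_step(1)[OF assms] assms
  by (simp add: contrast_def cong: if_cong)

text \<open>\<open>J\<close> is exactly the scaled jump that \<open>Theta1_1side\<close> bounds
  below. The constant part is read off on the second segment and is later annihilated by
  \<open>sum_contrast\<close>.\<close>

lemma step_eq_contrast:
  fixes \<mu>1 \<mu>2 :: real
  assumes "1 \<le> t" "t < n"
  defines "J \<equiv> sqrt (real t * (real n - real t) / real n) * (\<mu>1 - \<mu>2)"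
  shows "(if i \<le> t then \<mu>1 else \<mu>2) = 
    (\<mu>2 + J * sqrt (real t / (real n * (real n - real t)))) + J * contrast n t i"
proof (cases "i \<le> t")
  case True
  let ?g = "sqrt (real t * (real n - real t) / real n)"
  have "?g > 0" using assms(1,2) by simp
  then have "?g \<noteq> 0" by (metis less_irrefl)
  then have "J * (sqrt (real t / (real n * (real n - real t))) + sqrt ((real n - real t) / (real n * real t))) = \<mu>1 - \<mu>2"
    using contrast_step(2)[OF assms(1,2)] unfolding J_def by (simp add: add.commute del: real_sqrt_eq_0_iff)
  then show ?thesis using True by (simp add: contrast_def algebra_simps)
qed (simp add: contrast_def)

lemma sum_contrast_step:
  assumes "1 \<le> t" "t < n" "1 \<le> u" "u < n"
  shows "(\<Sum>i\<in>{1..n}. contrast n t i * (if i \<le> u then \<mu>1 else \<mu>2)) =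
    sqrt (real u * (real n - real u) / real n) * (\<mu>1 - \<mu>2) * contrast_corr n t u"
  unfolding step_eq_contrast[OF assms(3,4)]
  unfolding distrib_left sum.distrib sum_distrib_right[symmetric] sum_contrast[OF assms(1,2)] contrast_corr_def
  by (simp add: sum_distrib_left mult_ac)

section \<open>Joint law of the row statistics\<close>

lemma finite_idx: "finite (idx p n)"
  by (simp add: idx_def)

lemma sets_obs: "sets (obs p n \<theta>) = sets (sample_space p n)"
  by (simp add: obs_eq_gauss_vec sample_space_def sets_gauss_vec)

lemma space_obs: "space (obs p n \<theta>) = space (sample_space p n)"
  by (simp add: obs_eq_gauss_vec sample_space_def space_gauss_vec space_PiM)

lemma prob_space_obs: "prob_space (obs p n \<theta>)"
  by (simp add: obs_eq_gauss_vec prob_space_gauss_vec)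

lemma measurable_zstat:
  assumes "j \<in> {1..p}"
  shows "zstat n t j \<in> borel_measurable (sample_space p n)"
proof -
  have "(\<lambda>x. x (j, i)) \<in> borel_measurable (sample_space p n)" if "i \<in> {1..n}" for i
    using assms that unfolding sample_space_def by (intro measurable_component_singleton) (auto simp: idx_def)
  then show ?thesis
    unfolding zstat_def by (intro borel_measurable_sum borel_measurable_times) auto
qed

lemma distributed_zstat:
  assumes "1 \<le> t" "t < n" "j \<in> {1..p}"
  shows "distributed (obs p n \<theta>) lborel (zstat n t j)
    (normal_density (\<Sum>i\<in>{1..n}. contrast n t i * \<theta> (j, i)) 1)"
proof -
  have "distributed (gauss_vec (idx p n) \<theta>) lborel (\<lambda>x. \<Sum>k\<in>Pair j ` {1..n}. contrast n t (snd k) * x k)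
    (normal_density (\<Sum>k\<in>Pair j ` {1..n}. contrast n t (snd k) * \<theta> k) 1)"
    using assms contrast_corr_self[OF assms(1,2)]
    by (intro distributed_gauss_vec_lin)
      (auto simp: finite_idx idx_def contrast_nonzero sum.reindex inj_on_def contrast_corr_def power2_eq_square)
  then show ?thesis
    by (simp add: obs_eq_gauss_vec zstat_def[abs_def] sum.reindex inj_on_def)
qed

text \<open>Different rows use disjoint sets of coordinates.\<close>

lemma indep_vars_zstat:
  assumes "1 \<le> t" "t < n"
  shows "prob_space.indep_vars (obs p n \<theta>) (\<lambda>_. borel) (zstat n t) {1..p}"
proof -
  interpret prob_space "gauss_vec (idx p n) \<theta>" by (rule prob_space_gauss_vec)
  let ?K = "\<lambda>j. {j} \<times> {1..n}"
  have "indep_vars (\<lambda>j. PiM (?K j) (\<lambda>_. borel)) (\<lambda>j x. restrict (\<lambda>k. x k) (?K j)) {1..p}"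
    by (rule indep_vars_restrict[OF indep_vars_gauss_vec[OF finite_idx]])
      (auto simp: idx_def disjoint_family_on_def)
  then have "indep_vars (\<lambda>_. borel) (\<lambda>j x. zstat n t j (restrict x (?K j))) {1..p}"
  proof (rule indep_vars_compose2)
    fix j :: nat
    have "(\<lambda>x. x (j, i)) \<in> borel_measurable (PiM (?K j) (\<lambda>_. borel))" if "i \<in> {1..n}" for i
      using that by (intro measurable_component_singleton) auto
    then show "zstat n t j \<in> borel_measurable (PiM (?K j) (\<lambda>_. borel))"
      unfolding zstat_def by (intro borel_measurable_sum borel_measurable_times) auto
  qed
  also have "(\<lambda>j x. zstat n t j (restrict x (?K j))) = zstat n t"
    by (auto simp: fun_eq_iff zstat_def)
  finally show ?thesis by (simp add: obs_eq_gauss_vec)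
qed

text \<open>Two change points occur because the second moment of a mixture pairs its components. The
  exponent is linear in the entries of the matrix, so the geometry enters only through the inner
  product of the two contrasts.\<close>

lemma mgf_zstat:
  assumes t: "1 \<le> t" "t < n" "1 \<le> u" "u < n"
  shows "(\<integral>\<^sup>+x. ennreal (exp (\<Sum>j\<in>{1..p}. a j * zstat n t j x + b j * zstat n u j x)) \<partial>obs p n (\<lambda>_. 0)) =
    ennreal (exp (\<Sum>j\<in>{1..p}. ((a j)\<^sup>2 + (b j)\<^sup>2 + 2 * a j * b j * contrast_corr n t u) / 2))"
proof -
  define c where "c = (\<lambda>(j, i). a j * contrast n t i + b j * contrast n u i)"
  have 1: "(\<Sum>j\<in>{1..p}. a j * zstat n t j x + b j * zstat n u j x) = (\<Sum>k\<in>idx p n. c k * x k)" for x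
    by (simp add: zstat_def idx_def c_def sum.cartesian_product' sum_distrib_left
        sum.distrib[symmetric] distrib_right mult.assoc)
  have sq: "(\<Sum>i\<in>{1..n}. (contrast n t i)\<^sup>2) = 1" "(\<Sum>i\<in>{1..n}. (contrast n u i)\<^sup>2) = 1"
    using contrast_corr_self[of t n] contrast_corr_self[of u n] t
    by (auto simp: contrast_corr_def power2_eq_square)
  have "(\<Sum>k\<in>idx p n. (c k)\<^sup>2 / 2) = (\<Sum>j\<in>{1..p}. \<Sum>i\<in>{1..n}. (c (j, i))\<^sup>2 / 2)"
    by (simp add: idx_def sum.cartesian_product')
  also have "\<dots> = (\<Sum>j\<in>{1..p}. ((a j)\<^sup>2 + (b j)\<^sup>2 + 2 * a j * b j * contrast_corr n t u) / 2)"
  proof (rule sum.cong[OF refl])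
    fix j
    have "(\<Sum>i\<in>{1..n}. (c (j, i))\<^sup>2 / 2) = (\<Sum>i\<in>{1..n}. (a j)\<^sup>2 / 2 * (contrast n t i)\<^sup>2 +
        (b j)\<^sup>2 / 2 * (contrast n u i)\<^sup>2 + a j * b j * (contrast n t i * contrast n u i))"
      by (intro sum.cong refl) (simp add: c_def power2_eq_square field_simps)
    also have "\<dots> = (a j)\<^sup>2 / 2 + (b j)\<^sup>2 / 2 + a j * b j * contrast_corr n t u"
      by (simp only: sum.distrib sum_distrib_left[symmetric] sq contrast_corr_def[symmetric])
    also have "\<dots> = ((a j)\<^sup>2 + (b j)\<^sup>2 + 2 * a j * b j * contrast_corr n t u) / 2"
      by (simp add: field_simps)
    finally show "(\<Sum>i\<in>{1..n}. (c (j, i))\<^sup>2 / 2) = ((a j)\<^sup>2 + (b j)\<^sup>2 + 2 * a j * b j * contrast_corr n t u) / 2" .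
  qed
  finally show ?thesis
    unfolding 1 obs_eq_gauss_vec nn_integral_exp_gauss_vec[OF finite_idx] by simp
qed

section \<open>Lower bound\<close>

text \<open>The events \<open>E w\<close> truncate the likelihood ratios. Since \<open>k g \<le> 1 + (k g)\<^sup>2 / 4\<close> for every
  \<open>k\<close>, a small \<open>k\<close> makes any bounded second moment \<open>C\<close> sufficient.\<close>
lemma (in prob_space) bayes_risk_lower_bound:
  fixes l :: "'w \<Rightarrow> 'a \<Rightarrow> real"
  assumes W: "finite W" "W \<noteq> {}"
    and l[measurable]: "\<And>w. w \<in> W \<Longrightarrow> l w \<in> borel_measurable M"
    and l0: "\<And>w x. 0 \<le> l w x"
    and E[measurable]: "\<And>w. w \<in> W \<Longrightarrow> E w \<in> sets M" and A[measurable]: "A \<in> sets M"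
    and first: "\<And>w. w \<in> W \<Longrightarrow> ennreal c \<le> (\<integral>\<^sup>+x. ennreal (l w x) * indicator (E w) x \<partial>M)"
    and second: "(\<Sum>v\<in>W. \<Sum>w\<in>W. \<integral>\<^sup>+x. ennreal (l v x * indicator (E v) x * (l w x * indicator (E w) x)) \<partial>M)
      \<le> ennreal (C * (real (card W))\<^sup>2)"
    and b: "\<And>w. w \<in> W \<Longrightarrow> (\<integral>\<^sup>+x. ennreal (l w x) * indicator (space M - A) x \<partial>M) \<le> b"
    and k: "0 \<le> k" "k \<le> 1" and c: "0 \<le> c"
  shows "ennreal (k * c) \<le> emeasure M A + b + ennreal (k\<^sup>2 / 4 * C)"
proof -
  define N where "N = real (card W)"
  have N: "N > 0" using W by (simp add: N_def card_gt_0_iff)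
  define h where "h w x = l w x * indicator (E w) x" for w x
  have h[measurable]: "\<And>w. w \<in> W \<Longrightarrow> h w \<in> borel_measurable M"
    unfolding h_def[abs_def] by measurable
  have h0: "0 \<le> h w x" for w x by (simp add: h_def l0)
  define g where "g x = (\<Sum>w\<in>W. h w x) / N" for x
  have g0: "0 \<le> g x" for x using N by (auto simp: g_def h0 intro!: divide_nonneg_pos sum_nonneg)
  have g[measurable]: "g \<in> borel_measurable M" unfolding g_def[abs_def] by measurable
  have int_g: "(\<integral>\<^sup>+x. ennreal (g x) * indicator B x \<partial>M) =
      (\<Sum>w\<in>W. \<integral>\<^sup>+x. ennreal (h w x) * indicator B x \<partial>M) / ennreal N" if [measurable]: "B \<in> sets M" for B
  proof -
    have "(\<integral>\<^sup>+x. ennreal (g x) * indicator B x \<partial>M) =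
        (\<integral>\<^sup>+x. (\<Sum>w\<in>W. ennreal (h w x) * indicator B x) / ennreal N \<partial>M)"
      using N by (intro nn_integral_cong)
        (auto simp: g_def divide_ennreal[symmetric] sum_nonneg h0 sum_ennreal split: split_indicator)
    also have "\<dots> = (\<Sum>w\<in>W. \<integral>\<^sup>+x. ennreal (h w x) * indicator B x \<partial>M) / ennreal N"
      by (subst nn_integral_divide) (auto simp: nn_integral_sum)
    finally show ?thesis .
  qed
  have "ennreal k * ennreal c * ennreal N = (\<Sum>w\<in>W. ennreal c) * ennreal k"
    by (simp add: N_def ennreal_of_nat_eq_real_of_nat mult_ac)
  also have "\<dots> \<le> (\<Sum>w\<in>W. \<integral>\<^sup>+x. ennreal (h w x) * indicator (space M) x \<partial>M) * ennreal k"
  proof (intro mult_right_mono sum_mono)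
    fix w assume w: "w \<in> W"
    have "(\<integral>\<^sup>+x. ennreal (l w x) * indicator (E w) x \<partial>M) = (\<integral>\<^sup>+x. ennreal (h w x) * indicator (space M) x \<partial>M)"
      by (intro nn_integral_cong) (auto simp: h_def split: split_indicator)
    then show "ennreal c \<le> (\<integral>\<^sup>+x. ennreal (h w x) * indicator (space M) x \<partial>M)"
      using first[OF w] by simp
  qed auto
  finally have "ennreal k * ennreal c * ennreal N / ennreal N \<le>
      (\<Sum>w\<in>W. \<integral>\<^sup>+x. ennreal (h w x) * indicator (space M) x \<partial>M) * ennreal k / ennreal N"
    by (rule divide_right_mono_ennreal)
  also have "ennreal k * ennreal c * ennreal N / ennreal N = ennreal (k * c)"
    using N k c by (simp add: ennreal_mult[symmetric] divide_ennreal)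
  also have "(\<Sum>w\<in>W. \<integral>\<^sup>+x. ennreal (h w x) * indicator (space M) x \<partial>M) * ennreal k / ennreal N =
      ennreal k * (\<integral>\<^sup>+x. ennreal (g x) * indicator (space M) x \<partial>M)"
    by (subst int_g) (auto simp: mult.commute ennreal_times_divide)
  also have "\<dots> = (\<integral>\<^sup>+x. ennreal (k * g x) \<partial>M)"
    using k by (subst nn_integral_cmult[symmetric])
      (auto intro!: nn_integral_cong simp: ennreal_mult g0)
  also have "\<dots> \<le> (\<integral>\<^sup>+x. (indicator A x + ennreal (g x) * indicator (space M - A) x) + ennreal (k\<^sup>2 / 4 * (g x)\<^sup>2) \<partial>M)"
  proof (rule nn_integral_mono)
    fix x assume x: "x \<in> space M"
    show "ennreal (k * g x) \<le> (indicator A x + ennreal (g x) * indicator (space M - A) x) + ennreal (k\<^sup>2 / 4 * (g x)\<^sup>2)"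
    \<comment> \<open>The quadratic inequality is spent only where the test rejects. Where it
      accepts, \<open>k \<le> 1\<close> suffices and the type II error enters without loss.\<close>
    proof (cases "x \<in> A")
      case True
      have "0 \<le> (k * g x / 2 - 1)\<^sup>2" by simp
      then have "k * g x \<le> 1 + k\<^sup>2 / 4 * (g x)\<^sup>2" by (simp add: power2_eq_square field_simps)
      then have "ennreal (k * g x) \<le> ennreal (1 + k\<^sup>2 / 4 * (g x)\<^sup>2)" by (rule ennreal_leI)
      also have "\<dots> = ennreal 1 + ennreal (k\<^sup>2 / 4 * (g x)\<^sup>2)" by (rule ennreal_plus) auto
      finally show ?thesis using True by simp
    next
      case False
      have "k * g x \<le> 1 * g x" using k g0 by (intro mult_right_mono) auto
      then have "ennreal (k * g x) \<le> ennreal (g x)" by (simp add: ennreal_leI)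
      then show ?thesis using False x by (simp add: add_increasing2)
    qed
  qed
  also have "\<dots> = emeasure M A + (\<integral>\<^sup>+x. ennreal (g x) * indicator (space M - A) x \<partial>M) + (\<integral>\<^sup>+x. ennreal (k\<^sup>2 / 4 * (g x)\<^sup>2) \<partial>M)"
    by (subst nn_integral_add; (subst nn_integral_add)?) auto
  also have "\<dots> \<le> emeasure M A + b + ennreal (k\<^sup>2 / 4 * C)"
  proof (intro add_mono order.refl)
    have "(\<integral>\<^sup>+x. ennreal (g x) * indicator (space M - A) x \<partial>M) =
      (\<Sum>w\<in>W. \<integral>\<^sup>+x. ennreal (h w x) * indicator (space M - A) x \<partial>M) / ennreal N"
      by (rule int_g) auto
    also have "\<dots> \<le> (\<Sum>w\<in>W. b) / ennreal N"
    proof (intro divide_right_mono_ennreal sum_mono)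
      fix w assume w: "w \<in> W"
      have "(\<integral>\<^sup>+x. ennreal (h w x) * indicator (space M - A) x \<partial>M) \<le>
          (\<integral>\<^sup>+x. ennreal (l w x) * indicator (space M - A) x \<partial>M)"
        by (intro nn_integral_mono) (auto simp: h_def l0 split: split_indicator)
      then show "(\<integral>\<^sup>+x. ennreal (h w x) * indicator (space M - A) x \<partial>M) \<le> b"
        using b[OF w] by simp
    qed
    also have "\<dots> = b * ennreal N / ennreal N" by (simp add: N_def ennreal_of_nat_eq_real_of_nat mult.commute)
    also have "\<dots> = b"
      using N by (simp add: ennreal_times_divide[symmetric] divide_ennreal)
    finally show "(\<integral>\<^sup>+x. ennreal (g x) * indicator (space M - A) x \<partial>M) \<le> b" .
  next
    have "(\<integral>\<^sup>+x. ennreal (k\<^sup>2 / 4 * (g x)\<^sup>2) \<partial>M) =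
        (\<integral>\<^sup>+x. ennreal (k\<^sup>2 / 4 / N\<^sup>2) * (\<Sum>v\<in>W. \<Sum>w\<in>W. ennreal (h v x * h w x)) \<partial>M)"
    proof (rule nn_integral_cong)
      fix x
      have "k\<^sup>2 / 4 * (g x)\<^sup>2 = k\<^sup>2 / 4 / N\<^sup>2 * (\<Sum>v\<in>W. \<Sum>w\<in>W. h v x * h w x)"
        by (simp add: g_def power_divide sum_product[symmetric]) (simp add: power2_eq_square)
      moreover have "(\<Sum>v\<in>W. \<Sum>w\<in>W. ennreal (h v x * h w x)) = ennreal (\<Sum>v\<in>W. \<Sum>w\<in>W. h v x * h w x)"
        by (simp add: sum_ennreal h0 sum_nonneg)
      ultimately show "ennreal (k\<^sup>2 / 4 * (g x)\<^sup>2) = ennreal (k\<^sup>2 / 4 / N\<^sup>2) * (\<Sum>v\<in>W. \<Sum>w\<in>W. ennreal (h v x * h w x))"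
        using ennreal_mult'[of "k\<^sup>2 / 4 / N\<^sup>2" "\<Sum>v\<in>W. \<Sum>w\<in>W. h v x * h w x"] by (simp only:) simp
    qed
    also have "\<dots> = ennreal (k\<^sup>2 / 4 / N\<^sup>2) * (\<Sum>v\<in>W. \<Sum>w\<in>W. \<integral>\<^sup>+x. ennreal (h v x * h w x) \<partial>M)"
      by (subst nn_integral_cmult) (auto simp: nn_integral_sum)
    also have "\<dots> \<le> ennreal (k\<^sup>2 / 4 / N\<^sup>2) * ennreal (C * N\<^sup>2)"
      using second by (intro mult_left_mono) (auto simp: h_def N_def)
    also have "\<dots> = ennreal (k\<^sup>2 / 4 * C)"
      using N by (simp add: ennreal_mult'[symmetric])
    finally show "(\<integral>\<^sup>+x. ennreal (k\<^sup>2 / 4 * (g x)\<^sup>2) \<partial>M) \<le> ennreal (k\<^sup>2 / 4 * C)" .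
  qed
  finally show ?thesis .
qed

text \<open>For independent uniform \<open>f\<close> and \<open>g\<close> the number of agreements
  is binomial with parameters \<open>s\<close> and \<open>1 / m\<close>. This is its generating
  function at \<open>K\<close>, multiplied by the number of pairs.\<close>

lemma sum_power_card_agree:
  fixes K :: real
  assumes "m \<ge> 1"
  shows "(\<Sum>f\<in>PiE {..<s} (\<lambda>_. {..<m}). \<Sum>g\<in>PiE {..<s} (\<lambda>_. {..<m}). K ^ card {b\<in>{..<s}. f b = g b}) =
    (1 + (K - 1) / real m) ^ s * (real (m ^ s))\<^sup>2"
proof -
  let ?F = "PiE {..<s} (\<lambda>_. {..<m})"
  have inner: "(\<Sum>g\<in>?F. K ^ card {b\<in>{..<s}. f b = g b}) = (real m + (K - 1)) ^ s" if f: "f \<in> ?F" for f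
  proof -
    have "K ^ card {b\<in>{..<s}. f b = g b} = (\<Prod>b\<in>{..<s}. if f b = g b then K else 1)" for g
    proof -
      have "(\<Prod>b\<in>{..<s}. if f b = g b then K else 1) = (\<Prod>b\<in>{b\<in>{..<s}. f b = g b}. K)"
        by (rule prod.inter_filter[symmetric]) simp
      then show ?thesis by simp
    qed
    then have "(\<Sum>g\<in>?F. K ^ card {b\<in>{..<s}. f b = g b}) = (\<Sum>g\<in>?F. \<Prod>b\<in>{..<s}. if f b = g b then K else 1)"
      by simp
    also have "\<dots> = (\<Prod>b\<in>{..<s}. \<Sum>c\<in>{..<m}. if f b = c then K else 1)"
      by (rule prod_sum_PiE[symmetric]) auto
    also have "\<dots> = (\<Prod>b\<in>{..<s}. real m + (K - 1))"
    proof (rule prod.cong[OF refl])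
      fix b assume "b \<in> {..<s}"
      then have fb: "f b \<in> {..<m}" using f by (auto simp: PiE_iff)
      have "(\<Sum>c\<in>{..<m}. if f b = c then K else 1) = (\<Sum>c\<in>{..<m}. 1 + (if f b = c then K - 1 else 0))"
        by (intro sum.cong) auto
      also have "\<dots> = real m + (K - 1)" using fb by (simp add: sum.distrib)
      finally show "(\<Sum>c\<in>{..<m}. if f b = c then K else 1) = real m + (K - 1)" .
    qed
    finally show ?thesis by simp
  qed
  have "(\<Sum>f\<in>?F. \<Sum>g\<in>?F. K ^ card {b\<in>{..<s}. f b = g b}) = (\<Sum>f\<in>?F. (real m + (K - 1)) ^ s)"
    by (intro sum.cong refl inner)
  also have "\<dots> = real (m ^ s) * (real m + (K - 1)) ^ s"
    by (simp add: card_PiE)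
  also have "real m + (K - 1) = (1 + (K - 1) / real m) * real m" using assms by (simp add: field_simps)
  finally show ?thesis by (simp add: power_mult_distrib power2_eq_square mult_ac)
qed

lemma sum_if_mem:
  fixes c :: real
  assumes "finite B" "R \<subseteq> B" shows "(\<Sum>j\<in>B. if j \<in> R then c else 0) = real (card R) * c"
proof -
  have "(\<Sum>j\<in>B. if j \<in> R then c else 0) = sum (\<lambda>_. c) (B \<inter> R)"
    using assms(1) by (rule sum.inter_restrict[symmetric])
  also have "B \<inter> R = R" using assms(2) by auto
  finally show ?thesis by simp
qed

text \<open>On the truncation event every factor \<open>exp (\<mu> * (y - zstat n t j x))\<close> is
  at least 1. Inserting it for the rows common to \<open>R\<close> and \<open>R'\<close> tilts
  \<open>\<rho>\<close> to \<open>\<rho> - \<mu>\<close> there, and the integral is again given by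
  \<open>mgf_zstat\<close>. A row in only one of the two sets contributes the mean of a likelihood
  ratio, namely 1.\<close>

lemma truncated_pair_moment:
  fixes \<rho> \<mu> y :: real
  assumes t: "1 \<le> t" "t < n" "1 \<le> u" "u < n"
    and R: "R \<subseteq> {1..p}" "R' \<subseteq> {1..p}" and mu: "0 \<le> \<mu>"
  defines "l \<equiv> \<lambda>t R x. exp (\<Sum>j\<in>R. \<rho> * zstat n t j x - \<rho>\<^sup>2 / 2)"
    and "E \<equiv> \<lambda>t R. {x \<in> space (obs p n (\<lambda>_. 0)). \<forall>j\<in>R. zstat n t j x \<le> y}"
  shows "(\<integral>\<^sup>+x. ennreal (l t R x * indicator (E t R) x * (l u R' x * indicator (E u R') x)) \<partial>obs p n (\<lambda>_. 0)) \<le>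
    ennreal (exp (((\<rho> - \<mu>)\<^sup>2 + \<rho>\<^sup>2 + 2 * (\<rho> - \<mu>) * \<rho> * contrast_corr n t u) / 2 - \<rho>\<^sup>2 + \<mu> * y) ^ card (R \<inter> R'))"
proof -
  let ?M = "obs p n (\<lambda>_. 0)" and ?I = "{1..p}"
  define a where "a j = (if j \<in> R then \<rho> else 0) - (if j \<in> R \<inter> R' then \<mu> else 0)" for j
  define b where "b j = (if j \<in> R' then \<rho> else 0)" for j
  define c0 where "c0 = real (card (R \<inter> R')) * (\<mu> * y) - real (card R) * (\<rho>\<^sup>2 / 2) - real (card R') * (\<rho>\<^sup>2 / 2)"
  define D where "D = ((\<rho> - \<mu>)\<^sup>2 + \<rho>\<^sup>2 + 2 * (\<rho> - \<mu>) * \<rho> * contrast_corr n t u) / 2 - \<rho>\<^sup>2"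
  have R3: "R \<inter> R' \<subseteq> ?I" using R by auto
  have finR: "finite R" "finite R'" using R finite_subset by blast+
  have sum_ext: "sum f Q = (\<Sum>j\<in>?I. if j \<in> Q then f j else 0)" if "Q \<subseteq> ?I" for f :: "nat \<Rightarrow> real" and Q
  proof -
    have "(\<Sum>j\<in>?I. if j \<in> Q then f j else 0) = sum f (?I \<inter> Q)" by (rule sum.inter_restrict[symmetric]) simp
    then show ?thesis using that by (simp add: Int_absorb1)
  qed
  have "(\<integral>\<^sup>+x. ennreal (l t R x * indicator (E t R) x * (l u R' x * indicator (E u R') x)) \<partial>?M) \<le>
      (\<integral>\<^sup>+x. ennreal (exp c0) * ennreal (exp (\<Sum>j\<in>?I. a j * zstat n t j x + b j * zstat n u j x)) \<partial>?M)"
  proof (rule nn_integral_mono)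
    fix x
    show "ennreal (l t R x * indicator (E t R) x * (l u R' x * indicator (E u R') x)) \<le>
        ennreal (exp c0) * ennreal (exp (\<Sum>j\<in>?I. a j * zstat n t j x + b j * zstat n u j x))"
    proof (cases "x \<in> E t R \<inter> E u R'")
      case True
      \<comment> \<open>The added terms are the logarithms of the tilting factors; they are
        nonnegative by truncation. \<open>c0\<close> collects everything that does not depend on
        \<open>x\<close>.\<close>
      have "(\<Sum>j\<in>R. \<rho> * zstat n t j x - \<rho>\<^sup>2 / 2) + (\<Sum>j\<in>R'. \<rho> * zstat n u j x - \<rho>\<^sup>2 / 2) \<le>
         (\<Sum>j\<in>R. \<rho> * zstat n t j x - \<rho>\<^sup>2 / 2) + (\<Sum>j\<in>R'. \<rho> * zstat n u j x - \<rho>\<^sup>2 / 2) +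
         (\<Sum>j\<in>R \<inter> R'. \<mu> * (y - zstat n t j x))"
        using True mu by (auto simp: E_def intro!: sum_nonneg)
      also have "\<dots> = c0 + ((\<Sum>j\<in>R. \<rho> * zstat n t j x) + (\<Sum>j\<in>R'. \<rho> * zstat n u j x) - (\<Sum>j\<in>R \<inter> R'. \<mu> * zstat n t j x))"
        by (simp add: sum_subtractf c0_def right_diff_distrib)
      also have "((\<Sum>j\<in>R. \<rho> * zstat n t j x) + (\<Sum>j\<in>R'. \<rho> * zstat n u j x) - (\<Sum>j\<in>R \<inter> R'. \<mu> * zstat n t j x)) =
          (\<Sum>j\<in>?I. a j * zstat n t j x + b j * zstat n u j x)"
        unfolding sum_ext[OF R(1)] sum_ext[OF R(2)] sum_ext[OF R3] sum.distrib[symmetric] sum_subtractf[symmetric]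
        by (intro sum.cong refl) (auto simp: a_def b_def algebra_simps)
      finally have "l t R x * l u R' x \<le> exp c0 * exp (\<Sum>j\<in>?I. a j * zstat n t j x + b j * zstat n u j x)"
        by (simp add: l_def exp_add[symmetric])
      then show ?thesis using True by (simp add: ennreal_mult[symmetric] ennreal_leI)
    qed (auto simp: indicator_def)
  qed
  also have "\<dots> = ennreal (exp c0) * (\<integral>\<^sup>+x. ennreal (exp (\<Sum>j\<in>?I. a j * zstat n t j x + b j * zstat n u j x)) \<partial>?M)"
  proof (rule nn_integral_cmult)
    have [measurable]: "\<And>j t. j \<in> ?I \<Longrightarrow> zstat n t j \<in> borel_measurable ?M"
      using measurable_zstat measurable_cong_sets[OF sets_obs refl] by blast
    show "(\<lambda>x. ennreal (exp (\<Sum>j\<in>?I. a j * zstat n t j x + b j * zstat n u j x))) \<in> borel_measurable ?M"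
      by measurable
  qed
  also have "\<dots> = ennreal (exp c0 * exp (\<Sum>j\<in>?I. ((a j)\<^sup>2 + (b j)\<^sup>2 + 2 * a j * b j * contrast_corr n t u) / 2))"
    unfolding mgf_zstat[OF t] by (rule ennreal_mult[symmetric]) auto
  \<comment> \<open>The terms \<open>\<rho>\<^sup>2 / 2\<close> cancel the normalising constants in
    \<open>c0\<close>, so that only the overlap with its excess \<open>D\<close> survives.\<close>
  also have "(\<Sum>j\<in>?I. ((a j)\<^sup>2 + (b j)\<^sup>2 + 2 * a j * b j * contrast_corr n t u) / 2) =
     (\<Sum>j\<in>?I. (if j \<in> R then \<rho>\<^sup>2 / 2 else 0) + (if j \<in> R' then \<rho>\<^sup>2 / 2 else 0) + (if j \<in> R \<inter> R' then D else 0))"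
    by (intro sum.cong refl) (auto simp: a_def b_def D_def field_simps)
  also have "\<dots> = real (card R) * (\<rho>\<^sup>2 / 2) + real (card R') * (\<rho>\<^sup>2 / 2) + real (card (R \<inter> R')) * D"
    by (simp only: sum.distrib sum_if_mem[OF finite_atLeastAtMost R(1)]
        sum_if_mem[OF finite_atLeastAtMost R(2)] sum_if_mem[OF finite_atLeastAtMost R3])
  also have "exp c0 * exp \<dots> = exp (real (card (R \<inter> R')) * (D + \<mu> * y))"
    by (simp add: exp_add[symmetric] c0_def algebra_simps)
  also have "\<dots> = exp (D + \<mu> * y) ^ card (R \<inter> R')" by (simp add: exp_of_nat_mult)
  finally show ?thesis by (simp add: D_def)
qed

section \<open>The prior on the alternatives\<close>

text \<open>Affected rows are \<open>\<rho>\<close> times a unit vector of mean zero. The likelihood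
  ratio against the zero matrix then depends on the data only through \<open>zstat\<close>, and the
  scaled jump equals \<open>\<rho>\<close> exactly.\<close>

definition spike :: "nat \<Rightarrow> real \<Rightarrow> nat \<Rightarrow> nat set \<Rightarrow> nat \<times> nat \<Rightarrow> real" where
  "spike n \<rho> t R = (\<lambda>(j, i). if j \<in> R then \<rho> * contrast n t i else 0)"

lemma obs_spike_density:
  assumes t: "1 \<le> t" "t < n" and R: "R \<subseteq> {1..p}"
  shows "obs p n (spike n \<rho> t R) = density (obs p n (\<lambda>_. 0))
    (\<lambda>x. ennreal (exp (\<Sum>j\<in>R. \<rho> * zstat n t j x - \<rho>\<^sup>2 / 2)))"
proof -
  have "(\<Sum>k\<in>idx p n. spike n \<rho> t R k * x k - (spike n \<rho> t R k)\<^sup>2 / 2) =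
    (\<Sum>j\<in>R. \<rho> * zstat n t j x - \<rho>\<^sup>2 / 2)" for x
  proof -
    have sq: "(\<Sum>i\<in>{1..n}. (contrast n t i)\<^sup>2) = 1"
      using contrast_corr_self[OF t] by (simp add: contrast_corr_def power2_eq_square)
    have "(\<Sum>k\<in>idx p n. spike n \<rho> t R k * x k - (spike n \<rho> t R k)\<^sup>2 / 2) =
      (\<Sum>j\<in>{1..p}. \<Sum>i\<in>{1..n}. if j \<in> R then \<rho> * (contrast n t i * x (j, i)) - \<rho>\<^sup>2 / 2 * (contrast n t i)\<^sup>2 else 0)"
      unfolding idx_def sum.cartesian_product'
      by (intro sum.cong refl) (simp add: spike_def power_mult_distrib)
    also have "\<dots> = (\<Sum>j\<in>{1..p}. if j \<in> R then \<rho> * zstat n t j x - \<rho>\<^sup>2 / 2 else 0)"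
    proof (rule sum.cong[OF refl])
      fix j
      have "(\<Sum>i\<in>{1..n}. \<rho> * (contrast n t i * x (j, i)) - \<rho>\<^sup>2 / 2 * (contrast n t i)\<^sup>2) = \<rho> * zstat n t j x - \<rho>\<^sup>2 / 2"
        unfolding sum_subtractf sum_distrib_left[symmetric] sq zstat_def by simp
      then show "(\<Sum>i\<in>{1..n}. if j \<in> R then \<rho> * (contrast n t i * x (j, i)) - \<rho>\<^sup>2 / 2 * (contrast n t i)\<^sup>2 else 0) =
        (if j \<in> R then \<rho> * zstat n t j x - \<rho>\<^sup>2 / 2 else 0)"
        by simp
    qed
    also have "\<dots> = (\<Sum>j\<in>{1..p} \<inter> R. \<rho> * zstat n t j x - \<rho>\<^sup>2 / 2)"
      by (rule sum.inter_restrict[symmetric]) simp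
    also have "{1..p} \<inter> R = R" using R by auto
    finally show ?thesis .
  qed
  then show ?thesis
    unfolding obs_eq_gauss_vec gauss_vec_density[OF finite_idx, of p n "spike n \<rho> t R"] by simp
qed

lemma spike_in_Theta1:
  assumes t: "1 \<le> t" "t < n" and R: "R \<subseteq> {1..p}" "s \<le> card R"
  shows "spike n \<rho> t R \<in> Theta1_1side p n \<rho> s"
proof -
  let ?A = "sqrt ((real n - real t) / (real n * real t))"
  let ?B = "sqrt (real t / (real n * (real n - real t)))"
  let ?g = "sqrt (real t * (real n - real t) / real n)"
  have "?g > 0" using t by simp
  then have "?g \<noteq> 0" by (metis less_irrefl)
  then have g: "?g * (\<rho> * ?A - \<rho> * - ?B) = \<rho>"
    using contrast_step(2)[OF t] by (simp add: distrib_left[symmetric] del: real_sqrt_eq_0_iff)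
  show ?thesis
    unfolding Theta1_1side_def mem_Collect_eq
    apply (rule bexI[of _ t])
     apply (rule exI[of _ "\<lambda>j. if j \<in> R then \<rho> * ?A else 0"])
     apply (rule exI[of _ "\<lambda>j. if j \<in> R then \<rho> * - ?B else 0"])
     apply (rule exI[of _ R])
    using R t g by (auto simp: spike_def contrast_def)
qed

lemma prob_zstat_greater:
  assumes "1 \<le> t" "t < n" "j \<in> {1..p}"
  shows "measure (obs p n \<theta>) {x \<in> space (obs p n \<theta>). zstat n t j x > y} =
    gauss_tail (y - (\<Sum>i\<in>{1..n}. contrast n t i * \<theta> (j, i)))"
  by (rule prob_space.prob_normal_greater[OF prob_space_obs distributed_zstat[OF assms]])

text \<open>Under the spike the statistics of the rows in \<open>R\<close> have mean
  \<open>\<rho>\<close>; a union bound pays one tail at distance \<open>y - \<rho>\<close> for each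
  of them.\<close>

lemma emeasure_obs_spike_truncation:
  assumes t: "1 \<le> t" "t < n" and R: "R \<subseteq> {1..p}" and y: "\<rho> \<le> y"
  shows "ennreal (1 - real (card R) * exp (- (y - \<rho>)\<^sup>2 / 2)) \<le>
    emeasure (obs p n (spike n \<rho> t R)) {x \<in> space (obs p n (spike n \<rho> t R)). \<forall>j\<in>R. zstat n t j x \<le> y}"
proof -
  let ?P = "obs p n (spike n \<rho> t R)"
  interpret prob_space ?P by (rule prob_space_obs)
  have [measurable]: "\<And>j. j \<in> {1..p} \<Longrightarrow> zstat n t j \<in> borel_measurable ?P"
    using measurable_zstat measurable_cong_sets[OF sets_obs refl] by blast
  have finR: "finite R" using R finite_subset by blast
  have B: "{x \<in> space ?P. zstat n t j x > y} \<in> events" if "j \<in> R" for j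
  proof -
    have [measurable]: "zstat n t j \<in> borel_measurable ?P" using that R by auto
    show ?thesis by measurable
  qed
  have "prob (\<Union>j\<in>R. {x \<in> space ?P. zstat n t j x > y}) \<le> (\<Sum>j\<in>R. prob {x \<in> space ?P. zstat n t j x > y})"
    using finR B by (intro measure_UNION_le) auto
  also have "\<dots> \<le> (\<Sum>j\<in>R. exp (- (y - \<rho>)\<^sup>2 / 2))"
  proof (rule sum_mono)
    fix j assume j: "j \<in> R"
    then have j': "j \<in> {1..p}" using R by auto
    have "(\<Sum>i\<in>{1..n}. contrast n t i * spike n \<rho> t R (j, i)) = \<rho> * contrast_corr n t t"
      using j by (simp add: spike_def contrast_corr_def sum_distrib_left mult_ac)
    then have "prob {x \<in> space ?P. zstat n t j x > y} = gauss_tail (y - \<rho>)"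
      using prob_zstat_greater[OF t j'] contrast_corr_self[OF t] by simp
    then show "prob {x \<in> space ?P. zstat n t j x > y} \<le> exp (- (y - \<rho>)\<^sup>2 / 2)"
      using gauss_tail_le[of "y - \<rho>"] y by simp
  qed
  finally have 1: "prob (\<Union>j\<in>R. {x \<in> space ?P. zstat n t j x > y}) \<le> real (card R) * exp (- (y - \<rho>)\<^sup>2 / 2)"
    by simp
  have "{x \<in> space ?P. \<forall>j\<in>R. zstat n t j x \<le> y} = space ?P - (\<Union>j\<in>R. {x \<in> space ?P. zstat n t j x > y})"
    by (auto simp: not_less)
  then have "prob {x \<in> space ?P. \<forall>j\<in>R. zstat n t j x \<le> y} = 1 - prob (\<Union>j\<in>R. {x \<in> space ?P. zstat n t j x > y})"
    using B finR by (simp only:) (rule prob_compl, auto)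
  then show ?thesis using 1 by (simp add: emeasure_eq_measure ennreal_leI)
qed

text \<open>One row from each of \<open>s\<close> consecutive blocks of length \<open>m\<close>: the support has exactly \<open>s\<close>
  elements, yet the choices in different blocks are independent.\<close>
definition block_rows :: "nat \<Rightarrow> nat \<Rightarrow> (nat \<Rightarrow> nat) \<Rightarrow> nat set" where
  "block_rows s m f = (\<lambda>b. b * m + f b + 1) ` {..<s}"

lemma block_index_inject:
  fixes m :: nat
  assumes "b * m + c = b' * m + c'" "c < m" "c' < m"
  shows "b = b' \<and> c = c'"
proof -
  have "b = (b * m + c) div m" using assms(2) by simp
  also have "\<dots> = (b' * m + c') div m" by (simp only: assms(1))
  also have "\<dots> = b'" using assms(3) by simp
  finally have "b = b'" .
  then show ?thesis using assms by simp
qed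

lemma inj_on_block_rows:
  fixes s m :: nat and f :: "nat \<Rightarrow> nat"
  assumes "f \<in> PiE {..<s} (\<lambda>_. {..<m})"
  shows "inj_on (\<lambda>b. b * m + f b + 1) {..<s}"
proof (rule inj_onI)
  fix b b' :: nat assume b: "b \<in> {..<s}" "b' \<in> {..<s}" "b * m + f b + 1 = b' * m + f b' + 1"
  have "f b < m" "f b' < m" using PiE_mem[OF assms b(1)] PiE_mem[OF assms b(2)] by auto
  then show "b = b'" using block_index_inject[of b m "f b" b' "f b'"] b(3) by simp
qed

lemma card_block_rows:
  assumes "f \<in> PiE {..<s} (\<lambda>_. {..<m})"
  shows "card (block_rows s m f) = s"
  using inj_on_block_rows[OF assms] by (simp add: block_rows_def card_image)

text \<open>This converts the overlap exponent of \<open>truncated_pair_moment\<close> into the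
  agreement count of \<open>sum_power_card_agree\<close>.\<close>

lemma card_block_rows_Int:
  assumes f: "f \<in> PiE {..<s} (\<lambda>_. {..<m})" and g: "g \<in> PiE {..<s} (\<lambda>_. {..<m})"
  shows "card (block_rows s m f \<inter> block_rows s m g) = card {b\<in>{..<s}. f b = g b}"
proof -
  note inj = inj_on_block_rows[OF f]
  have "block_rows s m f \<inter> block_rows s m g = (\<lambda>b. b * m + f b + 1) ` {b\<in>{..<s}. f b = g b}"
  proof (intro equalityI subsetI)
    fix j assume "j \<in> block_rows s m f \<inter> block_rows s m g"
    then obtain b b' where b: "b < s" "b' < s" "j = b * m + f b + 1" "j = b' * m + g b' + 1"
      by (auto simp: block_rows_def)
    then have "b = b' \<and> f b = g b'"
      using PiE_mem[OF f, of b] PiE_mem[OF g, of b'] by (intro block_index_inject[of b m]) auto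
    then show "j \<in> (\<lambda>b. b * m + f b + 1) ` {b\<in>{..<s}. f b = g b}"
      using b by (intro image_eqI[of _ _ b]) auto
  next
    fix j assume "j \<in> (\<lambda>b. b * m + f b + 1) ` {b\<in>{..<s}. f b = g b}"
    then obtain b where b: "b < s" "f b = g b" "j = b * m + f b + 1" by auto
    then have "j \<in> block_rows s m f" "j \<in> block_rows s m g"
      unfolding block_rows_def by (intro image_eqI[of _ _ b]; simp)+
    then show "j \<in> block_rows s m f \<inter> block_rows s m g" ..
  qed
  moreover have "inj_on (\<lambda>b. b * m + f b + 1) {b\<in>{..<s}. f b = g b}"
    by (rule inj_on_subset[OF inj]) auto
  ultimately show ?thesis by (simp only: card_image)
qed

lemma block_rows_subset:
  assumes "f \<in> PiE {..<s} (\<lambda>_. {..<m})" "s * m \<le> p"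
  shows "block_rows s m f \<subseteq> {1..p}"
proof
  fix j assume "j \<in> block_rows s m f"
  then obtain b where b: "b < s" "j = b * m + f b + 1" by (auto simp: block_rows_def)
  have "f b < m" using PiE_mem[OF assms(1), of b] b by auto
  then have "j \<le> (b + 1) * m" using b by simp
  also have "\<dots> \<le> s * m" using b by (intro mult_right_mono) auto
  finally show "j \<in> {1..p}" using assms(2) b by simp
qed

text \<open>Hypothesis \<open>first\<close> leaves every component at least half of its mass after
  truncation. In \<open>second\<close> the first term stems from pairs with the same change point,
  which have weight \<open>1 / card T\<close> and need the tilt \<mu>; the other term stems from
  different change points, where small correlation replaces truncation.\<close>

lemma risk_1side_lower_bound:
  fixes \<rho> y \<mu> \<kappa> C :: real
  assumes T: "finite T" "T \<noteq> {}" "T \<subseteq> {1..<n}" and m: "m \<ge> 1" "s * m \<le> p"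
    and corr: "\<And>t u. t \<in> T \<Longrightarrow> u \<in> T \<Longrightarrow> t \<noteq> u \<Longrightarrow> contrast_corr n t u \<le> \<kappa>"
    and y: "\<rho> \<le> y" and mu: "0 \<le> \<mu>"
    and first: "real s * exp (- (y - \<rho>)\<^sup>2 / 2) \<le> 1/2"
    and second: "(1 + exp ((2 * \<rho> - \<mu>)\<^sup>2 / 2 - \<rho>\<^sup>2 + \<mu> * y) / real m) ^ s / real (card T)
      + (1 + exp (\<rho>\<^sup>2 * \<kappa>) / real m) ^ s \<le> C" and C: "1 \<le> C"
  shows "ennreal (1 / (4 * C)) \<le> risk_1side p n \<rho> s"
  unfolding risk_1side_def
proof (rule INF_greatest)
  fix \<psi> assume \<psi>: "\<psi> \<in> tests p n"
  let ?M = "obs p n (\<lambda>_. 0)"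
  interpret prob_space ?M by (rule prob_space_obs)
  define F where "F = PiE {..<s} (\<lambda>_. {..<m})"
  define A where "A = {x \<in> space ?M. \<psi> x}"
  define K where "K = exp ((2 * \<rho> - \<mu>)\<^sup>2 / 2 - \<rho>\<^sup>2 + \<mu> * y)"
  define K' where "K' = exp (\<rho>\<^sup>2 * \<kappa>)"
  define l where "l = (\<lambda>(t, f) x. exp (\<Sum>j\<in>block_rows s m f. \<rho> * zstat n t j x - \<rho>\<^sup>2 / 2))"
  define E where "E = (\<lambda>(t, f). {x \<in> space ?M. \<forall>j\<in>block_rows s m f. zstat n t j x \<le> y})"
  define b where "b = (SUP \<theta>\<in>Theta1_1side p n \<rho> s. acc_prob p n \<theta> \<psi>)"
  have finF: "finite F" by (simp add: F_def finite_PiE)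
  have cardF: "card F = m ^ s" by (simp add: F_def card_PiE)
  then have cF: "real (card F) > 0" using m by simp
  have cT: "real (card T) > 0" using T by (simp add: card_gt_0_iff)
  have tT: "1 \<le> t" "t < n" if "t \<in> T" for t using T that by auto
  have R: "block_rows s m f \<subseteq> {1..p}" if "f \<in> F" for f
    using that m(2) unfolding F_def by (rule block_rows_subset)
  have [measurable]: "\<And>j t. j \<in> {1..p} \<Longrightarrow> zstat n t j \<in> borel_measurable ?M"
    using measurable_zstat measurable_cong_sets[OF sets_obs refl] by blast
  have z[measurable]: "zstat n t j \<in> borel_measurable ?M" if "f \<in> F" "j \<in> block_rows s m f" for f j t
    using R[OF that(1)] that(2) by auto
  have Am[measurable]: "A \<in> sets ?M"
  proof -
    have "measurable ?M (count_space UNIV) = measurable (sample_space p n) (count_space (UNIV :: bool set))"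
      by (rule measurable_cong_sets[OF sets_obs refl])
    then have [measurable]: "\<psi> \<in> ?M \<rightarrow>\<^sub>M count_space UNIV"
      using \<psi> by (simp add: tests_def)
    show ?thesis unfolding A_def by measurable
  qed
  have lm: "l w \<in> borel_measurable ?M" if "w \<in> T \<times> F" for w
    using that z by (cases w) (auto simp: l_def intro!: borel_measurable_exp borel_measurable_sum borel_measurable_diff borel_measurable_times)
  have Em: "E w \<in> sets ?M" if w: "w \<in> T \<times> F" for w
  proof -
    obtain t f where tf: "w = (t, f)" "f \<in> F" using w by auto
    \<comment> \<open>For \<open>s = 0\<close> the intersection over no rows would be
      \<open>UNIV\<close> instead of the sample space.\<close>
    have "E w = (if s = 0 then space ?M else (\<Inter>j\<in>block_rows s m f. {x \<in> space ?M. zstat n t j x \<le> y}))"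
      by (auto simp: E_def tf block_rows_def)
    moreover have "{x \<in> space ?M. zstat n t j x \<le> y} \<in> sets ?M" if "j \<in> block_rows s m f" for j
    proof -
      have [measurable]: "zstat n t j \<in> borel_measurable ?M" using tf that by (auto intro: z)
      show ?thesis by measurable
    qed
    ultimately show ?thesis
      by (auto simp: block_rows_def intro!: sets.finite_INT)
  qed
  have dens: "emeasure (obs p n (spike n \<rho> t (block_rows s m f))) B = (\<integral>\<^sup>+x. ennreal (l (t, f) x) * indicator B x \<partial>?M)"
    if "t \<in> T" "f \<in> F" "B \<in> sets ?M" for t f B
    unfolding obs_spike_density[OF tT[OF that(1)] R[OF that(2)]]
    using lm[of "(t, f)"] that by (subst emeasure_density) (auto simp: l_def)
  \<comment> \<open>With \<open>c = 1/2\<close> the choice \<open>k = 1 / C\<close> maximises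
    \<open>k * c - k\<^sup>2 * C / 4\<close>, with value \<open>1 / (4 * C)\<close>.\<close>
  have "ennreal (1 / C * (1/2)) \<le> emeasure ?M A + b + ennreal ((1 / C)\<^sup>2 / 4 * C)"
  proof (rule bayes_risk_lower_bound[where W = "T \<times> F" and l = l and E = E])
    show "finite (T \<times> F)" "T \<times> F \<noteq> {}" using T finF cF by auto
    show "ennreal (1/2) \<le> (\<integral>\<^sup>+x. ennreal (l w x) * indicator (E w) x \<partial>?M)" if w: "w \<in> T \<times> F" for w
    proof -
      obtain t f where tf: "w = (t, f)" "t \<in> T" "f \<in> F" using w by auto
      have "ennreal (1/2) \<le> ennreal (1 - real (card (block_rows s m f)) * exp (- (y - \<rho>)\<^sup>2 / 2))"
        using first tf by (intro ennreal_leI) (simp add: F_def card_block_rows)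
      also have "\<dots> \<le> emeasure (obs p n (spike n \<rho> t (block_rows s m f)))
          {x \<in> space (obs p n (spike n \<rho> t (block_rows s m f))). \<forall>j\<in>block_rows s m f. zstat n t j x \<le> y}"
        using tf by (intro emeasure_obs_spike_truncation tT R y)
      also have "\<dots> = emeasure (obs p n (spike n \<rho> t (block_rows s m f))) (E w)"
        by (simp add: E_def tf space_obs)
      also have "\<dots> = (\<integral>\<^sup>+x. ennreal (l w x) * indicator (E w) x \<partial>?M)"
        unfolding tf(1) using tf w Em by (intro dens) auto
      finally show ?thesis .
    qed
    show "(\<integral>\<^sup>+x. ennreal (l w x) * indicator (space ?M - A) x \<partial>?M) \<le> b" if w: "w \<in> T \<times> F" for w
    proof -
      obtain t f where tf: "w = (t, f)" "t \<in> T" "f \<in> F" using w by auto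
      have "(\<integral>\<^sup>+x. ennreal (l w x) * indicator (space ?M - A) x \<partial>?M) =
          emeasure (obs p n (spike n \<rho> t (block_rows s m f))) (space ?M - A)"
        unfolding tf(1) using tf by (intro dens[symmetric]) auto
      also have "\<dots> = acc_prob p n (spike n \<rho> t (block_rows s m f)) \<psi>"
        unfolding acc_prob_def by (rule arg_cong[where f="emeasure _"]) (auto simp: A_def space_obs)
      also have "\<dots> \<le> b"
        unfolding b_def using tf tT R
        by (intro SUP_upper spike_in_Theta1) (auto simp: F_def card_block_rows)
      finally show ?thesis .
    qed
    show "(\<Sum>v\<in>T \<times> F. \<Sum>w\<in>T \<times> F. \<integral>\<^sup>+x. ennreal (l v x * indicator (E v) x * (l w x * indicator (E w) x)) \<partial>?M)
      \<le> ennreal (C * (real (card (T \<times> F)))\<^sup>2)"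
    proof -
      define G where "G K = (\<Sum>f\<in>F. \<Sum>g\<in>F. K ^ card {b\<in>{..<s}. f b = g b})" for K :: real
      have G: "0 \<le> G K" "G K \<le> (1 + K / real m) ^ s * (real (card F))\<^sup>2" if "K > 0" for K
      proof -
        show "0 \<le> G K" unfolding G_def using that by (intro sum_nonneg) auto
        have "(K - 1) / real m \<le> K / real m" using m by (intro divide_right_mono) auto
        moreover have "0 \<le> 1 + (K - 1) / real m" using m that by (simp add: field_simps)
        ultimately show "G K \<le> (1 + K / real m) ^ s * (real (card F))\<^sup>2"
          unfolding G_def F_def sum_power_card_agree[OF m(1)] 
          by (intro mult_mono power_mono) (auto simp: card_PiE)
      qed
      have pair: "(\<integral>\<^sup>+x. ennreal (l (t,f) x * indicator (E (t,f)) x * (l (u,g) x * indicator (E (u,g)) x)) \<partial>?M)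
        \<le> ennreal ((if t = u then K else K') ^ card {b\<in>{..<s}. f b = g b})"
        if tu: "t \<in> T" "u \<in> T" "f \<in> F" "g \<in> F" for t u f g
      proof -
        \<comment> \<open>For different change points the truncation indicators are simply bounded
          by 1, which is the tilt 0.\<close>
        define \<mu>' where "\<mu>' = (if t = u then \<mu> else 0)"
        have "(\<integral>\<^sup>+x. ennreal (l (t,f) x * indicator (E (t,f)) x * (l (u,g) x * indicator (E (u,g)) x)) \<partial>?M) \<le>
           ennreal (exp (((\<rho> - \<mu>')\<^sup>2 + \<rho>\<^sup>2 + 2 * (\<rho> - \<mu>') * \<rho> * contrast_corr n t u) / 2 - \<rho>\<^sup>2 + \<mu>' * y)
             ^ card (block_rows s m f \<inter> block_rows s m g))"
          unfolding l_def E_def prod.case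
          using tu mu by (intro truncated_pair_moment tT R) (auto simp: \<mu>'_def)
        also have "card (block_rows s m f \<inter> block_rows s m g) = card {b\<in>{..<s}. f b = g b}"
          using tu by (intro card_block_rows_Int) (auto simp: F_def)
        also have "ennreal (exp (((\<rho> - \<mu>')\<^sup>2 + \<rho>\<^sup>2 + 2 * (\<rho> - \<mu>') * \<rho> * contrast_corr n t u) / 2 - \<rho>\<^sup>2 + \<mu>' * y) ^ card {b\<in>{..<s}. f b = g b})
          \<le> ennreal ((if t = u then K else K') ^ card {b\<in>{..<s}. f b = g b})"
        proof (intro ennreal_leI power_mono)
          show "exp (((\<rho> - \<mu>')\<^sup>2 + \<rho>\<^sup>2 + 2 * (\<rho> - \<mu>') * \<rho> * contrast_corr n t u) / 2 - \<rho>\<^sup>2 + \<mu>' * y) \<le> (if t = u then K else K')"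
          proof (cases "t = u")
            case True
            then have "contrast_corr n t u = 1" using contrast_corr_self tT tu by simp
            then have "((\<rho> - \<mu>')\<^sup>2 + \<rho>\<^sup>2 + 2 * (\<rho> - \<mu>') * \<rho> * contrast_corr n t u) / 2 = (2 * \<rho> - \<mu>)\<^sup>2 / 2"
              using True by (simp add: \<mu>'_def power2_eq_square algebra_simps)
            then show ?thesis using True by (simp add: K_def \<mu>'_def)
          next
            case False
            have "((\<rho> - \<mu>')\<^sup>2 + \<rho>\<^sup>2 + 2 * (\<rho> - \<mu>') * \<rho> * contrast_corr n t u) / 2 - \<rho>\<^sup>2 + \<mu>' * y = \<rho>\<^sup>2 * contrast_corr n t u"
              using False by (simp add: \<mu>'_def power2_eq_square field_simps)
            also have "\<dots> \<le> \<rho>\<^sup>2 * \<kappa>" using corr[OF tu(1,2) False] by (intro mult_left_mono) auto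
            finally show ?thesis using False by (simp add: K'_def)
          qed
        qed auto
        finally show ?thesis .
      qed
      have "(\<Sum>v\<in>T \<times> F. \<Sum>w\<in>T \<times> F. \<integral>\<^sup>+x. ennreal (l v x * indicator (E v) x * (l w x * indicator (E w) x)) \<partial>?M)
        = (\<Sum>t\<in>T. \<Sum>f\<in>F. \<Sum>u\<in>T. \<Sum>g\<in>F. \<integral>\<^sup>+x. ennreal (l (t,f) x * indicator (E (t,f)) x * (l (u,g) x * indicator (E (u,g)) x)) \<partial>?M)"
        by (simp only: sum.cartesian_product')
      also have "\<dots> \<le> (\<Sum>t\<in>T. \<Sum>f\<in>F. \<Sum>u\<in>T. \<Sum>g\<in>F. ennreal ((if t = u then K else K') ^ card {b\<in>{..<s}. f b = g b}))"
        by (intro sum_mono pair)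
      also have "\<dots> = ennreal (\<Sum>t\<in>T. \<Sum>f\<in>F. \<Sum>u\<in>T. \<Sum>g\<in>F. (if t = u then K else K') ^ card {b\<in>{..<s}. f b = g b})"
        by (simp add: sum_ennreal sum_nonneg K_def K'_def)
      also have "(\<Sum>t\<in>T. \<Sum>f\<in>F. \<Sum>u\<in>T. \<Sum>g\<in>F. (if t = u then K else K') ^ card {b\<in>{..<s}. f b = g b}) =
         (\<Sum>t\<in>T. \<Sum>u\<in>T. if t = u then G K else G K')"
        by (intro sum.cong refl) (subst sum.swap, auto simp: G_def intro!: sum.cong)
      also have "\<dots> \<le> (\<Sum>t\<in>T. G K + real (card T) * G K')"
      proof (rule sum_mono)
        fix t assume t: "t \<in> T"
        have "(\<Sum>u\<in>T. if t = u then G K else G K') \<le> (\<Sum>u\<in>T. (if t = u then G K else 0) + G K')"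
          using G(1) by (intro sum_mono) (auto simp: K'_def)
        also have "\<dots> = G K + real (card T) * G K'" using t T by (simp add: sum.distrib)
        finally show "(\<Sum>u\<in>T. if t = u then G K else G K') \<le> G K + real (card T) * G K'" .
      qed
      also have "\<dots> = real (card T) * G K + (real (card T))\<^sup>2 * G K'"
        by (simp add: power2_eq_square algebra_simps)
      also have "\<dots> \<le> real (card T) * ((1 + K / real m) ^ s * (real (card F))\<^sup>2) + (real (card T))\<^sup>2 * ((1 + K' / real m) ^ s * (real (card F))\<^sup>2)"
        by (intro add_mono mult_left_mono G) (auto simp: K_def K'_def)
      also have "\<dots> = ((1 + K / real m) ^ s / real (card T) + (1 + K' / real m) ^ s) * (real (card (T \<times> F)))\<^sup>2"
        using cT by (simp add: card_cartesian_product power_mult_distrib power2_eq_square field_simps)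
      also have "\<dots> \<le> C * (real (card (T \<times> F)))\<^sup>2"
        using second by (intro mult_right_mono) (auto simp: K_def K'_def)
      finally show ?thesis by (simp add: ennreal_leI)
    qed
  qed (use lm Em C in \<open>auto simp: l_def split: prod.splits\<close>)
  also have "(1 / C)\<^sup>2 / 4 * C = 1 / (4 * C)" using C by (simp add: power2_eq_square)
  also have "1 / C * (1/2) = 1 / (4 * C) + 1 / (4 * C)" by (simp add: field_simps)
  also have "ennreal (1 / (4 * C) + 1 / (4 * C)) = ennreal (1 / (4 * C)) + ennreal (1 / (4 * C))"
    using C by (intro ennreal_plus) auto
  finally have "ennreal (1 / (4 * C)) + ennreal (1 / (4 * C)) \<le> ennreal (1 / (4 * C)) + (emeasure ?M A + b)"
    by (simp only: add.commute)
  then have "ennreal (1 / (4 * C)) \<le> emeasure ?M A + b"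
    unfolding ennreal_add_left_cancel_le by simp
  also have "emeasure ?M A \<le> (SUP \<theta>\<in>Theta0 p n. rej_prob p n \<theta> \<psi>)"
    unfolding A_def rej_prob_def[symmetric] by (rule SUP_upper) (auto simp: Theta0_def)
  finally show "ennreal (1 / (4 * C)) \<le> (SUP \<theta>\<in>Theta0 p n. rej_prob p n \<theta> \<psi>) + (SUP \<theta>\<in>Theta1_1side p n \<rho> s. acc_prob p n \<theta> \<psi>)"
    by (simp add: b_def add_right_mono)
qed

section \<open>Upper bound\<close>

text \<open>Cut the log-odds line into cells of length \<open>L\<close> and choose one change point
  from each occupied cell. Log odds in a common cell differ by less than \<open>L\<close>, which is
  a correlation of at least \<open>exp (- L / 2)\<close>. All log odds lie between
  \<open>- ln n\<close> and \<open>ln n\<close>; the summand 2 accounts for rounding at the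
  ends.\<close>

lemma odds_cover:
  fixes L :: real
  assumes n: "2 \<le> n" and L: "0 < L"
  obtains T where "finite T" "T \<subseteq> {1..<n}" "real (card T) \<le> 2 * ln (real n) / L + 2"
    "\<And>u. u \<in> {1..<n} \<Longrightarrow> \<exists>t\<in>T. exp (- L / 2) \<le> contrast_corr n t u"
proof
  define lo where "lo u = ln (real u / (real n - real u))" for u
  define B where "B u = \<lfloor>lo u / L\<rfloor>" for u
  define T where "T = (\<lambda>k. SOME u. u \<in> {1..<n} \<and> B u = k) ` B ` {1..<n}"
  have rep: "(SOME v. v \<in> {1..<n} \<and> B v = B u) \<in> {1..<n} \<and> B (SOME v. v \<in> {1..<n} \<and> B v = B u) = B u"
    if "u \<in> {1..<n}" for u
    using that by (intro someI[where P="\<lambda>v. v \<in> {1..<n} \<and> B v = B u"]) auto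
  show "finite T" by (simp add: T_def)
  show "T \<subseteq> {1..<n}" using rep by (auto simp: T_def)
  have lo: "\<bar>lo u\<bar> \<le> ln (real n)" if u: "u \<in> {1..<n}" for u
  proof -
    have pos: "0 < real u" "1 \<le> real u" "1 \<le> real n - real u" "0 < real n" using u by auto
    have "lo u = ln (real u) - ln (real n - real u)" using pos by (simp add: lo_def ln_div)
    moreover have "0 \<le> ln (real u)" "0 \<le> ln (real n - real u)" "ln (real u) \<le> ln (real n)"
      "ln (real n - real u) \<le> ln (real n)"
      using u pos by auto
    ultimately show ?thesis by linarith
  qed
  have "B ` {1..<n} \<subseteq> {\<lfloor>- (ln (real n) / L)\<rfloor>..\<lfloor>ln (real n) / L\<rfloor>}"
  proof
    fix k assume "k \<in> B ` {1..<n}"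
    then obtain u where u: "u \<in> {1..<n}" "k = B u" by auto
    have "- (ln (real n) / L) \<le> lo u / L" "lo u / L \<le> ln (real n) / L"
      using lo[OF u(1)] L by (auto simp: field_simps abs_le_iff)
    then show "k \<in> {\<lfloor>- (ln (real n) / L)\<rfloor>..\<lfloor>ln (real n) / L\<rfloor>}"
      by (auto simp: u B_def intro!: floor_mono)
  qed
  then have "card (B ` {1..<n}) \<le> card {\<lfloor>- (ln (real n) / L)\<rfloor>..\<lfloor>ln (real n) / L\<rfloor>}"
    by (intro card_mono) auto
  moreover have "card T \<le> card (B ` {1..<n})" unfolding T_def by (rule card_image_le) auto
  moreover have "0 \<le> ln (real n) / L" using n L by simp
  then have "real (card {\<lfloor>- (ln (real n) / L)\<rfloor>..\<lfloor>ln (real n) / L\<rfloor>}) \<le> 2 * ln (real n) / L + 2"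
    by (simp add: nat_diff_distrib) linarith
  ultimately show "real (card T) \<le> 2 * ln (real n) / L + 2" by linarith
  show "\<exists>t\<in>T. exp (- L / 2) \<le> contrast_corr n t u" if u: "u \<in> {1..<n}" for u
  proof -
    define t where "t = (SOME v. v \<in> {1..<n} \<and> B v = B u)"
    have t: "t \<in> {1..<n}" "B t = B u" "t \<in> T" using rep[OF u] u by (auto simp: t_def T_def)
    have close: "\<bar>lo t / L - lo u / L\<bar> < 1" using t(2) unfolding B_def by linarith
    have "\<bar>lo t - lo u\<bar> = \<bar>lo t / L - lo u / L\<bar> * L"
      using L by (simp add: diff_divide_distrib[symmetric])
    also have "\<dots> < 1 * L" using close L by (intro mult_strict_right_mono)
    finally have close: "\<bar>lo t - lo u\<bar> < L" by simp
    have main: "exp (- L / 2) \<le> contrast_corr n v w"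
      if vw: "v \<in> {1..<n}" "w \<in> {1..<n}" "v \<le> w" "\<bar>lo v - lo w\<bar> < L" for v w
    proof -
      let ?o = "\<lambda>u. real u / (real n - real u)"
      have pos: "0 < ?o v" "0 < ?o w" using vw by auto
      have "?o v / ?o w = exp (ln (?o v / ?o w))" by (rule exp_ln[symmetric]) (rule divide_pos_pos[OF pos])
      also have "ln (?o v / ?o w) = lo v - lo w" unfolding lo_def by (rule ln_divide_pos[OF pos])
      finally have "contrast_corr n v w = sqrt (exp (lo v - lo w))"
        using contrast_corr_eq[of v w n] vw by simp
      also have "\<dots> = exp ((lo v - lo w) / 2)"
        by (rule real_sqrt_unique) (simp_all add: power2_eq_square exp_add[symmetric])
      also have "\<dots> \<ge> exp (- L / 2)" using vw by simp
      finally show ?thesis .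
    qed
    show ?thesis
    proof (cases "t \<le> u")
      case True then show ?thesis using main[of t u] t u close by auto
    next
      case False
      then have "exp (- L / 2) \<le> contrast_corr n u t" using main[of u t] t u close by auto
      then show ?thesis using t(3) unfolding contrast_corr_commute[of n u t] by blast
    qed
  qed
qed

text \<open>The two errors scale differently: a false alarm may come from any candidate, whereas a
  detection needs only the one candidate close to the true change point. Hence only
  \<open>e0\<close> is multiplied by \<open>card T\<close>.\<close>

lemma risk_1side_le_scan:
  assumes T: "finite T" and A: "\<And>t. t \<in> T \<Longrightarrow> A t \<in> sets (sample_space p n)"
    and null: "\<And>\<theta> t. \<theta> \<in> Theta0 p n \<Longrightarrow> t \<in> T \<Longrightarrow> measure (obs p n \<theta>) (A t) \<le> e0"
    and alt: "\<And>\<theta>. \<theta> \<in> Theta1_1side p n \<rho> s \<Longrightarrow>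
      \<exists>t\<in>T. measure (obs p n \<theta>) (space (sample_space p n) - A t) \<le> e1"
    and e: "0 \<le> e0" "0 \<le> e1"
  shows "risk_1side p n \<rho> s \<le> ennreal (real (card T) * e0 + e1)"
proof -
  define U where "U = (\<Union>t\<in>T. A t)"
  define \<psi> where "\<psi> x \<longleftrightarrow> x \<in> U" for x
  have U: "U \<in> sets (sample_space p n)" using T A by (auto simp: U_def)
  have \<psi>: "\<psi> \<in> tests p n"
    unfolding tests_def mem_Collect_eq \<psi>_def[abs_def] using U by measurable
  have rej: "rej_prob p n \<theta> \<psi> \<le> ennreal (real (card T) * e0)" if \<theta>: "\<theta> \<in> Theta0 p n" for \<theta>
  proof -
    interpret prob_space "obs p n \<theta>" by (rule prob_space_obs)
    have "{x \<in> space (obs p n \<theta>). \<psi> x} = U"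
      using sets.sets_into_space[OF U] by (auto simp: \<psi>_def space_obs)
    then have "rej_prob p n \<theta> \<psi> = ennreal (prob U)" by (simp add: rej_prob_def emeasure_eq_measure)
    also have "prob U \<le> (\<Sum>t\<in>T. prob (A t))"
      unfolding U_def using A T by (intro measure_UNION_le) (auto simp: sets_obs)
    also have "\<dots> \<le> (\<Sum>t\<in>T. e0)" using null[OF \<theta>] by (intro sum_mono)
    finally show ?thesis by (simp add: ennreal_leI)
  qed
  have acc: "acc_prob p n \<theta> \<psi> \<le> ennreal e1" if \<theta>: "\<theta> \<in> Theta1_1side p n \<rho> s" for \<theta>
  proof -
    interpret prob_space "obs p n \<theta>" by (rule prob_space_obs)
    obtain t where t: "t \<in> T" "measure (obs p n \<theta>) (space (sample_space p n) - A t) \<le> e1"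
      using alt[OF \<theta>] by auto
    have "acc_prob p n \<theta> \<psi> \<le> emeasure (obs p n \<theta>) (space (sample_space p n) - A t)"
      unfolding acc_prob_def using t(1) A[OF t(1)]
      by (intro emeasure_mono) (auto simp: \<psi>_def U_def space_obs sets_obs)
    also have "\<dots> \<le> ennreal e1" using t(2) by (simp add: emeasure_eq_measure ennreal_leI)
    finally show ?thesis .
  qed
  have "risk_1side p n \<rho> s \<le> (SUP \<theta>\<in>Theta0 p n. rej_prob p n \<theta> \<psi>) + (SUP \<theta>\<in>Theta1_1side p n \<rho> s. acc_prob p n \<theta> \<psi>)"
    unfolding risk_1side_def using \<psi> by (rule INF_lower)
  also have "\<dots> \<le> ennreal (real (card T) * e0) + ennreal e1"
    by (intro add_mono SUP_least rej acc)
  also have "\<dots> = ennreal (real (card T) * e0 + e1)" using e by (intro ennreal_plus[symmetric]) auto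
  finally show ?thesis .
qed

lemma zstat_mean_Theta0:
  assumes "\<theta> \<in> Theta0 p n" "1 \<le> t" "t < n" "j \<in> {1..p}"
  shows "(\<Sum>i\<in>{1..n}. contrast n t i * \<theta> (j, i)) = 0"
proof -
  obtain \<mu> where "\<forall>j\<in>{1..p}. \<forall>i\<in>{1..n}. \<theta> (j, i) = \<mu> j"
    using assms(1) unfolding Theta0_def by blast
  with assms(4) have "(\<Sum>i\<in>{1..n}. contrast n t i * \<theta> (j, i)) = (\<Sum>i\<in>{1..n}. contrast n t i) * \<mu> j"
    unfolding sum_distrib_right by (intro sum.cong) auto
  then show ?thesis using sum_contrast[OF assms(2,3)] by simp
qed

lemma Theta1_obtain:
  assumes "\<theta> \<in> Theta1_1side p n \<rho> s" "0 \<le> \<rho>" "2 \<le> n"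
  obtains u S where "u \<in> {1..<n}" "S \<subseteq> {1..p}" "s \<le> card S"
    "\<And>t j c. t \<in> {1..<n} \<Longrightarrow> j \<in> S \<Longrightarrow> 0 \<le> c \<Longrightarrow> c \<le> contrast_corr n t u \<Longrightarrow>
      \<rho> * c \<le> (\<Sum>i\<in>{1..n}. contrast n t i * \<theta> (j, i))"
proof -
  from assms(1) obtain u \<mu>1 \<mu>2 S where u: "u \<in> {1..n-1}" and S: "S \<subseteq> {1..p}" "s \<le> card S"
    and \<theta>: "\<forall>j\<in>{1..p}. \<forall>i\<in>{1..n}. \<theta> (j, i) = (if i \<le> u then \<mu>1 j else \<mu>2 j)"
    and jump: "\<forall>j\<in>S. sqrt (real u * (real n - real u) / real n) * (\<mu>1 j - \<mu>2 j) \<ge> \<rho>"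
    unfolding Theta1_1side_def by blast
  show ?thesis
  proof
    show u': "u \<in> {1..<n}" using u assms(3) by auto
    fix t j c assume t: "t \<in> {1..<n}" and j: "j \<in> S" and c: "0 \<le> c" "c \<le> contrast_corr n t u"
    have j': "j \<in> {1..p}" using j S by auto
    have "(\<Sum>i\<in>{1..n}. contrast n t i * \<theta> (j, i)) = (\<Sum>i\<in>{1..n}. contrast n t i * (if i \<le> u then \<mu>1 j else \<mu>2 j))"
      using \<theta> j' by (intro sum.cong) auto
    also have "\<dots> = sqrt (real u * (real n - real u) / real n) * (\<mu>1 j - \<mu>2 j) * contrast_corr n t u"
      using t u' by (intro sum_contrast_step) auto
    also have "\<dots> \<ge> \<rho> * c" using jump[rule_format, OF j] c assms(2) by (intro mult_mono) auto
    finally show "\<rho> * c \<le> (\<Sum>i\<in>{1..n}. contrast n t i * \<theta> (j, i))" .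
  qed (use S in auto)
qed

text \<open>Reflection gives an upper tail, but at a closed half-line. The slack 1 avoids discussing
  the boundary point and is harmless because the gaps \<open>m - y\<close> in use tend to
  infinity.\<close>

lemma (in prob_space) prob_normal_le:
  assumes "distributed M lborel X (normal_density m 1)"
  shows "prob {\<omega> \<in> space M. X \<omega> \<le> y} \<le> gauss_tail (m - y - 1)"
proof -
  have X: "distributed M lborel (\<lambda>\<omega>. 0 + (-1) * X \<omega>) (normal_density (- m) 1)"
    using normal_density_affine[OF assms, of "- 1" 0] by simp
  have [measurable]: "X \<in> borel_measurable M" using distributed_measurable[OF assms] by simp
  have "prob {\<omega> \<in> space M. X \<omega> \<le> y} \<le> prob {\<omega> \<in> space M. 0 + (-1) * X \<omega> > - y - 1}"
    by (rule finite_measure_mono) auto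
  also have "\<dots> = gauss_tail (- y - 1 - - m)" by (rule prob_normal_greater[OF X])
  finally show ?thesis by (simp add: algebra_simps)
qed

text \<open>The null pays a union bound over \<open>p\<close> rows and all candidates. Under the
  alternative a single affected row already triggers the test, hence \<open>1 \<le> s\<close>; its
  mean at the nearest candidate is at least \<open>\<rho> * exp (- L / 2)\<close>.\<close>

lemma risk_1side_le_max_test:
  fixes L \<rho> y :: real
  assumes n: "2 \<le> n" and L: "0 < L" and y: "0 \<le> y" "y + 1 \<le> \<rho> * exp (- L / 2)" and s: "1 \<le> s"
  shows "risk_1side p n \<rho> s \<le> ennreal ((2 * ln (real n) / L + 2) * (real p * exp (- y\<^sup>2 / 2)) +
    exp (- (\<rho> * exp (- L / 2) - y - 1)\<^sup>2 / 2))"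
proof -
  obtain T where T: "finite T" "T \<subseteq> {1..<n}" "real (card T) \<le> 2 * ln (real n) / L + 2"
    and cover: "\<And>u. u \<in> {1..<n} \<Longrightarrow> \<exists>t\<in>T. exp (- L / 2) \<le> contrast_corr n t u"
    using odds_cover[OF n L] by blast
  have "0 \<le> \<rho> * exp (- L / 2)" using y by linarith
  then have \<rho>: "0 \<le> \<rho>" by (simp add: zero_le_mult_iff)
  define A where "A t = (\<Union>j\<in>{1..p}. {x \<in> space (sample_space p n). zstat n t j x > y})" for t
  have A1: "{x \<in> space (sample_space p n). zstat n t j x > y} \<in> sets (sample_space p n)" if "j \<in> {1..p}" for t j
  proof -
    note [measurable] = measurable_zstat[OF that]
    show ?thesis by measurable
  qed
  have "risk_1side p n \<rho> s \<le> ennreal (real (card T) * (real p * exp (- y\<^sup>2 / 2)) +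
    exp (- (\<rho> * exp (- L / 2) - y - 1)\<^sup>2 / 2))"
  proof (rule risk_1side_le_scan[OF T(1)])
    show "A t \<in> sets (sample_space p n)" for t
      unfolding A_def using A1 by auto
    show "measure (obs p n \<theta>) (A t) \<le> real p * exp (- y\<^sup>2 / 2)" if \<theta>: "\<theta> \<in> Theta0 p n" and t: "t \<in> T" for \<theta> t
    proof -
      interpret prob_space "obs p n \<theta>" by (rule prob_space_obs)
      have "prob (A t) \<le> (\<Sum>j\<in>{1..p}. prob {x \<in> space (sample_space p n). zstat n t j x > y})"
        unfolding A_def using A1 by (intro measure_UNION_le) (auto simp: sets_obs)
      also have "\<dots> \<le> (\<Sum>j\<in>{1..p}. exp (- y\<^sup>2 / 2))"
      proof (rule sum_mono)
        fix j assume j: "j \<in> {1..p}"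
        have t': "1 \<le> t" "t < n" using T(2) t by auto
        show "prob {x \<in> space (sample_space p n). zstat n t j x > y} \<le> exp (- y\<^sup>2 / 2)"
          using prob_zstat_greater[OF t' j, of \<theta> y] zstat_mean_Theta0[OF \<theta> t' j] gauss_tail_le[OF y(1)]
          by (simp add: space_obs)
      qed
      finally show ?thesis by simp
    qed
    show "\<exists>t\<in>T. measure (obs p n \<theta>) (space (sample_space p n) - A t) \<le> exp (- (\<rho> * exp (- L / 2) - y - 1)\<^sup>2 / 2)"
      if \<theta>: "\<theta> \<in> Theta1_1side p n \<rho> s" for \<theta>
    proof -
      interpret prob_space "obs p n \<theta>" by (rule prob_space_obs)
      obtain u S where u: "u \<in> {1..<n}" and S: "S \<subseteq> {1..p}" "s \<le> card S"
        and mean: "\<And>t j c. t \<in> {1..<n} \<Longrightarrow> j \<in> S \<Longrightarrow> 0 \<le> c \<Longrightarrow> c \<le> contrast_corr n t u \<Longrightarrow>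
            \<rho> * c \<le> (\<Sum>i\<in>{1..n}. contrast n t i * \<theta> (j, i))"
        using Theta1_obtain[OF \<theta> \<rho> n] by blast
      obtain t where t: "t \<in> T" "exp (- L / 2) \<le> contrast_corr n t u" using cover[OF u] by blast
      have "S \<noteq> {}" using S s by auto
      then obtain j where j: "j \<in> S" by auto
      have t': "t \<in> {1..<n}" "1 \<le> t" "t < n" and j': "j \<in> {1..p}" using T t j S by auto
      let ?m = "\<Sum>i\<in>{1..n}. contrast n t i * \<theta> (j, i)"
      have "prob (space (sample_space p n) - A t) \<le> prob {x \<in> space (obs p n \<theta>). zstat n t j x \<le> y}"
      proof (rule finite_measure_mono)
        show "space (sample_space p n) - A t \<subseteq> {x \<in> space (obs p n \<theta>). zstat n t j x \<le> y}"
          using j' by (auto simp: A_def space_obs not_less)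
        have "zstat n t j \<in> borel_measurable (obs p n \<theta>)"
          using distributed_measurable[OF distributed_zstat[OF t'(2,3) j']] by simp
        then show "{x \<in> space (obs p n \<theta>). zstat n t j x \<le> y} \<in> events" by measurable
      qed
      also have "\<dots> \<le> gauss_tail (?m - y - 1)"
        by (rule prob_normal_le[OF distributed_zstat[OF t'(2,3) j']])
      also have "\<dots> \<le> gauss_tail (\<rho> * exp (- L / 2) - y - 1)"
        using mean[OF t'(1) j _ t(2)] by (intro gauss_tail_antimono) auto
      also have "\<dots> \<le> exp (- (\<rho> * exp (- L / 2) - y - 1)\<^sup>2 / 2)"
        using y by (intro gauss_tail_le) auto
      finally show ?thesis using t(1) by blast
    qed
  qed auto
  also have "\<dots> \<le> ennreal ((2 * ln (real n) / L + 2) * (real p * exp (- y\<^sup>2 / 2)) +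
    exp (- (\<rho> * exp (- L / 2) - y - 1)\<^sup>2 / 2))"
    using T(3) by (intro ennreal_leI add_mono mult_right_mono) auto
  finally show ?thesis .
qed

section \<open>Exponential moments of the score statistic\<close>

text \<open>The weight of the second indicator makes the mean of the score smallest for a centred
  Gaussian, so rows outside the support cannot mask the signal.\<close>
definition score :: "real \<Rightarrow> real \<Rightarrow> real" where
  "score y z = indicator {y<..} z - exp (- y\<^sup>2 / 2) * indicator {0<..} z"

definition score_mean :: "real \<Rightarrow> real \<Rightarrow> real" where
  "score_mean y m = gauss_tail (y - m) - exp (- y\<^sup>2 / 2) * gauss_tail (- m)"

lemma score_mean_0_le: "0 \<le> y \<Longrightarrow> score_mean y 0 \<le> score_mean y m"
  using gauss_tail_tangent[of y m] by (simp add: score_mean_def)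

lemma abs_score_mean_0_le:
  assumes "0 \<le> y" shows "\<bar>score_mean y 0\<bar> \<le> exp (- y\<^sup>2 / 2)"
proof -
  have "exp (- y\<^sup>2 / 2) * gauss_tail 0 \<le> exp (- y\<^sup>2 / 2) * 1"
    using gauss_tail_le_1 by (intro mult_left_mono) auto
  moreover have "0 \<le> exp (- y\<^sup>2 / 2) * gauss_tail 0" using gauss_tail_nonneg by simp
  moreover have "score_mean y 0 = gauss_tail y - exp (- y\<^sup>2 / 2) * gauss_tail 0"
    by (simp add: score_mean_def)
  ultimately show ?thesis
    unfolding abs_le_iff using gauss_tail_le[OF assms] gauss_tail_nonneg[of y] by linarith
qed

text \<open>For negative \<open>u\<close> use \<open>exp u \<le> 1 / (1 - u)\<close> together with
  \<open>(1 + u + u\<^sup>2) * (1 - u) = 1 - u^3 \<ge> 1\<close>.\<close>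

lemma exp_le_quadratic:
  fixes u :: real assumes "\<bar>u\<bar> \<le> 1" shows "exp u \<le> 1 + u + u\<^sup>2"
proof (cases "0 \<le> u")
  case True then show ?thesis using assms exp_bound[of u] by simp
next
  case False
  have pos: "0 < 1 - u" using False by simp
  have "exp u * (1 - u) \<le> exp u * exp (- u)"
    using exp_ge_add_one_self[of "- u"] by (intro mult_left_mono) auto
  also have "\<dots> = 1" by (simp add: exp_minus_inverse)
  also have "\<dots> \<le> (1 + u + u\<^sup>2) * (1 - u)"
  proof -
    have "(1 + u + u\<^sup>2) * (1 - u) = 1 + u\<^sup>2 * (- u)" by (simp add: power2_eq_square algebra_simps)
    moreover have "0 \<le> u\<^sup>2 * (- u)" using False by (intro mult_nonneg_nonneg) auto
    ultimately show ?thesis by linarith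
  qed
  finally show ?thesis using pos by (rule mult_right_le_imp_le)
qed

text \<open>The row mean \<open>m\<close> is arbitrary, so the second moment of the centred score
  cannot be bounded by \<eta> alone. It is at most \<open>2 * d + 8 * \<eta>\<close>, where
  \<open>d\<close> is the gain in mean itself; for small \<open>h\<close> the extra
  \<open>h\<^sup>2 * d\<close> is dominated by the linear term \<open>h * d\<close>.\<close>

lemma (in prob_space) score_mgf:
  assumes Z: "distributed M lborel Z (normal_density m 1)" and y: "0 \<le> y" and h: "\<bar>h\<bar> \<le> 1/2"
  defines "\<eta> \<equiv> exp (- y\<^sup>2 / 2)" and "d \<equiv> score_mean y m - score_mean y 0"
  shows "integrable M (\<lambda>\<omega>. exp (h * (score y (Z \<omega>) - score_mean y 0)))" (is ?int)
    and "expectation (\<lambda>\<omega>. exp (h * (score y (Z \<omega>) - score_mean y 0))) \<le>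
      exp (h * d + 2 * h\<^sup>2 * d + 8 * h\<^sup>2 * \<eta>)" (is ?bound)
proof -
  let ?w0 = "score_mean y 0"
  have [measurable]: "Z \<in> borel_measurable M" using distributed_measurable[OF Z] by simp
  have [measurable]: "(\<lambda>\<omega>. score y (Z \<omega>)) \<in> borel_measurable M" unfolding score_def by measurable
  have lam: "0 < \<eta>" "\<eta> \<le> 1" by (auto simp: \<eta>_def)
  have w0: "\<bar>?w0\<bar> \<le> \<eta>" using abs_score_mean_0_le[OF y] by (simp add: \<eta>_def)
  let ?i = "\<lambda>a \<omega>. indicator {a<..} (Z \<omega>) :: real"
  have i: "integrable M (?i a)" "expectation (?i a) = gauss_tail (a - m)" for a
  proof -
    show "integrable M (?i a)" by (rule integrable_const_bound[of _ 1]) (auto simp: indicator_def)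
    have "expectation (?i a) = expectation (indicator {\<omega> \<in> space M. Z \<omega> > a})"
      by (intro Bochner_Integration.integral_cong) (auto simp: indicator_def)
    also have "\<dots> = prob {\<omega> \<in> space M. Z \<omega> > a}" by simp
    also have "\<dots> = gauss_tail (a - m)" by (rule prob_normal_greater[OF Z])
    finally show "expectation (?i a) = gauss_tail (a - m)" .
  qed
  have score_bound: "\<bar>score y z\<bar> \<le> 1" for z
    using lam by (auto simp: score_def \<eta>_def[symmetric] split: split_indicator)
  have score_sq: "(score y z)\<^sup>2 \<le> indicator {y<..} z + \<eta>\<^sup>2" for z
  proof -
    show "(score y z)\<^sup>2 \<le> indicator {y<..} z + \<eta>\<^sup>2"
    proof (cases "z > y")
      case True
      have "(score y z)\<^sup>2 \<le> 1" using score_bound by (simp only: abs_square_le_1)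
      then show ?thesis using True by (simp add: add_increasing2)
    next
      case False then show ?thesis by (simp add: score_def \<eta>_def power_mult_distrib split: split_indicator)
    qed
  qed
  have bnd: "\<bar>h * (score y z - ?w0)\<bar> \<le> 1" for z
  proof -
    have "\<bar>score y z - ?w0\<bar> \<le> 2" using score_bound[of z] w0 lam by linarith
    then have "\<bar>h\<bar> * \<bar>score y z - ?w0\<bar> \<le> (1/2) * 2" using h by (intro mult_mono) auto
    then show ?thesis by (simp add: abs_mult)
  qed
  show int: ?int
  proof (rule integrable_const_bound[of _ "exp 1"])
    show "AE \<omega> in M. norm (exp (h * (score y (Z \<omega>) - ?w0))) \<le> exp 1"
      using bnd by (auto simp: abs_le_iff)
  qed measurable
  define g where "g \<omega> = 1 + h * (?i y \<omega> - \<eta> * ?i 0 \<omega> - ?w0) + h\<^sup>2 * (2 * ?i y \<omega> + 4 * \<eta>)" for \<omega>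
  have "expectation (\<lambda>\<omega>. exp (h * (score y (Z \<omega>) - ?w0))) \<le> expectation g"
  proof (rule integral_mono[OF int])
    show "integrable M g" unfolding g_def using i by auto
    fix \<omega>
    have "exp (h * (score y (Z \<omega>) - ?w0)) \<le> 1 + h * (score y (Z \<omega>) - ?w0) + (h * (score y (Z \<omega>) - ?w0))\<^sup>2"
      by (rule exp_le_quadratic[OF bnd])
    also have "(h * (score y (Z \<omega>) - ?w0))\<^sup>2 \<le> h\<^sup>2 * (2 * ?i y \<omega> + 4 * \<eta>)"
    proof -
      have "0 \<le> (score y (Z \<omega>) + ?w0)\<^sup>2" by simp
      then have "(score y (Z \<omega>) - ?w0)\<^sup>2 \<le> 2 * (score y (Z \<omega>))\<^sup>2 + 2 * ?w0\<^sup>2"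
        by (simp add: power2_eq_square algebra_simps)
      also have "?w0\<^sup>2 \<le> \<eta>\<^sup>2" using power_mono[OF w0, of 2] by simp
      finally have "(score y (Z \<omega>) - ?w0)\<^sup>2 \<le> 2 * ?i y \<omega> + 4 * \<eta>\<^sup>2" using score_sq[of "Z \<omega>"] by linarith
      moreover have "\<eta>\<^sup>2 \<le> \<eta>" using lam by (simp add: power2_eq_square mult_left_le_one_le)
      ultimately have "(score y (Z \<omega>) - ?w0)\<^sup>2 \<le> 2 * ?i y \<omega> + 4 * \<eta>" by linarith
      then show ?thesis by (simp only: power_mult_distrib) (intro mult_left_mono, auto)
    qed
    finally show "exp (h * (score y (Z \<omega>) - ?w0)) \<le> g \<omega>" by (simp add: g_def score_def \<eta>_def)
  qed
  also have "expectation g = 1 + h * (gauss_tail (y - m) - \<eta> * gauss_tail (- m) - ?w0) + h\<^sup>2 * (2 * gauss_tail (y - m) + 4 * \<eta>)"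
    unfolding g_def using i i(2)[of 0] by (simp add: prob_space)
  also have "gauss_tail (y - m) - \<eta> * gauss_tail (- m) - ?w0 = d"
    by (simp add: d_def score_mean_def \<eta>_def)
  also have "1 + h * d + h\<^sup>2 * (2 * gauss_tail (y - m) + 4 * \<eta>) \<le> 1 + h * d + h\<^sup>2 * (2 * (d + 2 * \<eta>) + 4 * \<eta>)"
  proof -
    have "\<eta> * gauss_tail (- m) \<le> \<eta> * 1" using gauss_tail_le_1 lam by (intro mult_left_mono) auto
    \<comment> \<open>Solving the definition of \<open>d\<close> for the exceedance probability
      leaves two corrections, the mean at 0 and the subtracted indicator, each at most
      \<eta>.\<close>
    then have "gauss_tail (y - m) \<le> d + 2 * \<eta>"
      using w0 unfolding d_def score_mean_def[of y m] \<eta>_def[symmetric] by linarith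
    then have "2 * gauss_tail (y - m) + 4 * \<eta> \<le> 2 * (d + 2 * \<eta>) + 4 * \<eta>" by simp
    then show ?thesis by (intro add_left_mono mult_left_mono) auto
  qed
  also have "\<dots> = 1 + (h * d + 2 * h\<^sup>2 * d + 8 * h\<^sup>2 * \<eta>)" by (simp add: algebra_simps)
  also have "\<dots> \<le> exp (h * d + 2 * h\<^sup>2 * d + 8 * h\<^sup>2 * \<eta>)" by (rule exp_ge_add_one_self)
  finally show ?bound .
qed

lemma score_sum_mgf:
  fixes p :: nat and \<theta> :: "nat \<times> nat \<Rightarrow> real"
  assumes t: "1 \<le> t" "t < n" and y: "0 \<le> y" and h: "\<bar>h\<bar> \<le> 1/2"
  defines "D \<equiv> (\<Sum>j\<in>{1..p}. score_mean y (\<Sum>i\<in>{1..n}. contrast n t i * \<theta> (j, i)) - score_mean y 0)"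
    and "W \<equiv> \<lambda>x. \<Sum>j\<in>{1..p}. score y (zstat n t j x) - score_mean y 0"
  shows "integrable (obs p n \<theta>) (\<lambda>x. exp (h * W x))"
    and "prob_space.expectation (obs p n \<theta>) (\<lambda>x. exp (h * W x)) \<le>
      exp (h * D + 2 * h\<^sup>2 * D + 8 * h\<^sup>2 * real p * exp (- y\<^sup>2 / 2))"
proof -
  interpret prob_space "obs p n \<theta>" by (rule prob_space_obs)
  let ?m = "\<lambda>j. \<Sum>i\<in>{1..n}. contrast n t i * \<theta> (j, i)"
  let ?f = "\<lambda>j x. exp (h * (score y (zstat n t j x) - score_mean y 0))"
  have [measurable]: "score y \<in> borel_measurable borel" unfolding score_def[abs_def] by measurable
  have ind: "indep_vars (\<lambda>_. borel) ?f {1..p}"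
    using indep_vars_compose2[OF indep_vars_zstat[OF t, where p = p and \<theta> = \<theta>],
        of "\<lambda>_ z. exp (h * (score y z - score_mean y 0))" "\<lambda>_. borel"] by simp
  note mgf = score_mgf[OF distributed_zstat[OF t] y h]
  have int: "integrable (obs p n \<theta>) (?f j)" if "j \<in> {1..p}" for j
    using that by (rule mgf(1))
  have eq: "(\<lambda>x. exp (h * W x)) = (\<lambda>x. \<Prod>j\<in>{1..p}. ?f j x)"
    by (simp add: W_def sum_distrib_left exp_sum)
  show "integrable (obs p n \<theta>) (\<lambda>x. exp (h * W x))"
    unfolding eq by (rule indep_vars_integrable[OF _ ind int]) auto
  have "expectation (\<lambda>x. exp (h * W x)) = (\<Prod>j\<in>{1..p}. expectation (?f j))"
    unfolding eq by (rule indep_vars_lebesgue_integral[OF _ ind int]) auto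
  also have "\<dots> \<le> (\<Prod>j\<in>{1..p}. exp (h * (score_mean y (?m j) - score_mean y 0) +
      2 * h\<^sup>2 * (score_mean y (?m j) - score_mean y 0) + 8 * h\<^sup>2 * exp (- y\<^sup>2 / 2)))"
    by (intro prod_mono conjI mgf(2) integral_nonneg_AE) auto
  also have "\<dots> = exp (\<Sum>j\<in>{1..p}. h * (score_mean y (?m j) - score_mean y 0) +
      2 * h\<^sup>2 * (score_mean y (?m j) - score_mean y 0) + 8 * h\<^sup>2 * exp (- y\<^sup>2 / 2))"
    by (simp add: exp_sum)
  also have "(\<Sum>j\<in>{1..p}. h * (score_mean y (?m j) - score_mean y 0) +
      2 * h\<^sup>2 * (score_mean y (?m j) - score_mean y 0) + 8 * h\<^sup>2 * exp (- y\<^sup>2 / 2)) =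
      h * D + 2 * h\<^sup>2 * D + 8 * h\<^sup>2 * real p * exp (- y\<^sup>2 / 2)"
    unfolding sum.distrib D_def sum_distrib_left[symmetric] by simp
  finally show "expectation (\<lambda>x. exp (h * W x)) \<le>
      exp (h * D + 2 * h\<^sup>2 * D + 8 * h\<^sup>2 * real p * exp (- y\<^sup>2 / 2))" .
qed

text \<open>Chernoff bounds with the same \<open>h\<close> on both sides. The alternative shifts the
  mean of the sum by some \<open>D \<ge> s * G\<close>, and \<open>h \<le> 1/4\<close> gives
  \<open>2 * h\<^sup>2 * D \<le> h * D / 2\<close>. A threshold of a quarter of \<open>s * G\<close>
  then makes both error exponents at least \<open>h * s * G / 4\<close>, up to the common variance
  term. Of the constant 3, two units come from \<open>odds_cover\<close> and one from the type II
  error.\<close>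

lemma risk_1side_le_score_test:
  fixes L \<rho> y h G :: real
  assumes n: "2 \<le> n" and L: "0 < L" and y: "0 \<le> y" and \<rho>: "0 \<le> \<rho>" and h: "0 < h" "h \<le> 1/4"
    and G: "0 \<le> G" "G \<le> gauss_tail (y - \<rho> * exp (- L / 2)) - 2 * exp (- y\<^sup>2 / 2)"
  shows "risk_1side p n \<rho> s \<le> ennreal ((2 * ln (real n) / L + 3) *
    exp (8 * h\<^sup>2 * real p * exp (- y\<^sup>2 / 2) - h * (real s * G) / 4))"
proof -
  obtain T where T: "finite T" "T \<subseteq> {1..<n}" "real (card T) \<le> 2 * ln (real n) / L + 2"
    and cover: "\<And>u. u \<in> {1..<n} \<Longrightarrow> \<exists>t\<in>T. exp (- L / 2) \<le> contrast_corr n t u"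
    using odds_cover[OF n L] by blast
  define \<tau> where "\<tau> = real s * G / 4"
  define W where "W t x = (\<Sum>j\<in>{1..p}. score y (zstat n t j x) - score_mean y 0)" for t x
  define A where "A t = {x \<in> space (sample_space p n). W t x \<ge> \<tau>}" for t
  define e where "e = exp (8 * h\<^sup>2 * real p * exp (- y\<^sup>2 / 2) - h * (real s * G) / 4)"
  define m where "m \<theta> t j = (\<Sum>i\<in>{1..n}. contrast n t i * \<theta> (j, i))" for \<theta> :: "nat \<times> nat \<Rightarrow> real" and t j
  define D where "D \<theta> t = (\<Sum>j\<in>{1..p}. score_mean y (m \<theta> t j) - score_mean y 0)" for \<theta> t
  have [measurable]: "score y \<in> borel_measurable borel" unfolding score_def[abs_def] by measurable
  have W[measurable]: "W t \<in> borel_measurable (sample_space p n)" for t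
  proof -
    have "(\<lambda>x. score y (zstat n t j x)) \<in> borel_measurable (sample_space p n)" if "j \<in> {1..p}" for j
      using measurable_zstat[OF that] by measurable
    then show ?thesis unfolding W_def by (intro borel_measurable_sum borel_measurable_diff) auto
  qed
  have A[measurable]: "A t \<in> sets (sample_space p n)" for t unfolding A_def by measurable
  have mgf: "prob_space.expectation (obs p n \<theta>) (\<lambda>x. exp (g * W t x)) \<le>
      exp (g * D \<theta> t + 2 * g\<^sup>2 * D \<theta> t + 8 * g\<^sup>2 * real p * exp (- y\<^sup>2 / 2))"
     "integrable (obs p n \<theta>) (\<lambda>x. exp (g * W t x))"
    if "t \<in> T" "\<bar>g\<bar> \<le> 1/2" for \<theta> t g
    using score_sum_mgf[of t n y g p \<theta>] that T(2) y unfolding W_def D_def m_def by auto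
  have "risk_1side p n \<rho> s \<le> ennreal (real (card T) * e + e)"
  proof (rule risk_1side_le_scan[OF T(1) A])
    show "measure (obs p n \<theta>) (A t) \<le> e" if \<theta>: "\<theta> \<in> Theta0 p n" and t: "t \<in> T" for \<theta> t
    proof -
      interpret prob_space "obs p n \<theta>" by (rule prob_space_obs)
      have t': "1 \<le> t" "t < n" using T t by auto
      have D0: "D \<theta> t = 0"
        unfolding D_def m_def by (intro sum.neutral) (auto simp: zstat_mean_Theta0[OF \<theta> t'] simp del: One_nat_def)
      have int: "integrable (obs p n \<theta>) (\<lambda>x. exp (h * W t x))" using mgf(2)[OF t] h by auto
      have "prob {x \<in> space (obs p n \<theta>). W t x \<ge> \<tau>} \<le>
          exp (- h * \<tau>) * (\<integral>x\<in>space (obs p n \<theta>). exp (h * W t x) \<partial>obs p n \<theta>)"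
        using h by (intro Chernoff_ineq_ge) (auto simp only: set_integrable_def intro!: integrable_mult_indicator int)
      also have "(\<integral>x\<in>space (obs p n \<theta>). exp (h * W t x) \<partial>obs p n \<theta>) = expectation (\<lambda>x. exp (h * W t x))"
        by (rule set_integral_space[OF int])
      also have "exp (- h * \<tau>) * \<dots> \<le> exp (- h * \<tau>) * exp (h * D \<theta> t + 2 * h\<^sup>2 * D \<theta> t + 8 * h\<^sup>2 * real p * exp (- y\<^sup>2 / 2))"
        using h by (intro mult_left_mono mgf(1)[OF t]) auto
      also have "\<dots> = e" by (simp add: D0 e_def \<tau>_def exp_add[symmetric])
      finally show ?thesis by (simp add: A_def space_obs)
    qed
    show "\<exists>t\<in>T. measure (obs p n \<theta>) (space (sample_space p n) - A t) \<le> e"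
      if \<theta>: "\<theta> \<in> Theta1_1side p n \<rho> s" for \<theta>
    proof -
      interpret prob_space "obs p n \<theta>" by (rule prob_space_obs)
      obtain u S where u: "u \<in> {1..<n}" and S: "S \<subseteq> {1..p}" "s \<le> card S"
        and mean: "\<And>t j c. t \<in> {1..<n} \<Longrightarrow> j \<in> S \<Longrightarrow> 0 \<le> c \<Longrightarrow> c \<le> contrast_corr n t u \<Longrightarrow>
            \<rho> * c \<le> m \<theta> t j"
        using Theta1_obtain[OF \<theta> \<rho> n] unfolding m_def by blast
      obtain t where t: "t \<in> T" "exp (- L / 2) \<le> contrast_corr n t u" using cover[OF u] by blast
      have t': "t \<in> {1..<n}" using T t by auto
      have "real s * G \<le> real (card S) * G" using S G by (intro mult_right_mono) auto
      also have "\<dots> = (\<Sum>j\<in>S. G)" by simp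
      also have "\<dots> \<le> (\<Sum>j\<in>S. score_mean y (m \<theta> t j) - score_mean y 0)"
      proof (rule sum_mono)
        fix j assume j: "j \<in> S"
        have "gauss_tail (y - \<rho> * exp (- L / 2)) \<le> gauss_tail (y - m \<theta> t j)"
          using mean[OF t' j _ t(2)] by (intro gauss_tail_antimono) auto
        moreover have "exp (- y\<^sup>2 / 2) * gauss_tail (- m \<theta> t j) \<le> exp (- y\<^sup>2 / 2) * 1"
          using gauss_tail_le_1 by (intro mult_left_mono) auto
        \<comment> \<open>The two copies of \<open>exp (- y\<^sup>2 / 2)\<close> in the hypothesis
          on \<open>G\<close> pay for the subtracted indicator and for the mean under the
          null.\<close>
        ultimately show "G \<le> score_mean y (m \<theta> t j) - score_mean y 0"
          using G(2) abs_score_mean_0_le[OF y] unfolding score_mean_def[of y "m \<theta> t j"] by linarith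
      qed
      also have "\<dots> \<le> D \<theta> t"
        unfolding D_def using S score_mean_0_le[OF y] by (intro sum_mono2) auto
      finally have D: "real s * G \<le> D \<theta> t" .
      then have D0: "0 \<le> D \<theta> t" using G by (meson mult_nonneg_nonneg of_nat_0_le_iff order_trans)
      have int: "integrable (obs p n \<theta>) (\<lambda>x. exp (- h * W t x))" using mgf(2)[OF t(1), of "- h"] h by auto
      have "prob (space (sample_space p n) - A t) \<le> prob {x \<in> space (obs p n \<theta>). W t x \<le> \<tau>}"
      proof (rule finite_measure_mono)
        show "space (sample_space p n) - A t \<subseteq> {x \<in> space (obs p n \<theta>). W t x \<le> \<tau>}"
          by (auto simp: A_def space_obs)
        have "{x \<in> space (sample_space p n). W t x \<le> \<tau>} \<in> sets (sample_space p n)" by measurable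
        then show "{x \<in> space (obs p n \<theta>). W t x \<le> \<tau>} \<in> events" by (simp add: space_obs sets_obs)
      qed
      also have "\<dots> \<le> exp (h * \<tau>) * (\<integral>x\<in>space (obs p n \<theta>). exp (- h * W t x) \<partial>obs p n \<theta>)"
        using h by (intro Chernoff_ineq_le) (auto simp only: set_integrable_def intro!: integrable_mult_indicator int)
      also have "(\<integral>x\<in>space (obs p n \<theta>). exp (- h * W t x) \<partial>obs p n \<theta>) = expectation (\<lambda>x. exp (- h * W t x))"
        by (rule set_integral_space[OF int])
      also have "exp (h * \<tau>) * \<dots> \<le> exp (h * \<tau>) *
          exp ((- h) * D \<theta> t + 2 * (- h)\<^sup>2 * D \<theta> t + 8 * (- h)\<^sup>2 * real p * exp (- y\<^sup>2 / 2))"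
        using h by (intro mult_left_mono mgf(1)[OF t(1)]) auto
      also have "\<dots> = exp (8 * h\<^sup>2 * real p * exp (- y\<^sup>2 / 2) + (h * \<tau> - h * D \<theta> t + 2 * h\<^sup>2 * D \<theta> t))"
        by (simp add: exp_add[symmetric] algebra_simps)
      also have "\<dots> \<le> e"
      proof -
        have "h * h * D \<theta> t \<le> h * (1/4) * D \<theta> t" using h D0 by (intro mult_right_mono mult_left_mono) auto
        then have "2 * h\<^sup>2 * D \<theta> t \<le> h * D \<theta> t / 2" by (simp add: power2_eq_square)
        moreover have "h * (real s * G) \<le> h * D \<theta> t" using D h by (intro mult_left_mono) auto
        moreover have "h * \<tau> = h * (real s * G) / 4" by (simp add: \<tau>_def)
        ultimately have "h * \<tau> - h * D \<theta> t + 2 * h\<^sup>2 * D \<theta> t \<le> - (h * (real s * G) / 4)"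
          by linarith
        then show ?thesis by (simp add: e_def)
      qed
      finally show ?thesis using t(1) by blast
    qed
  qed (auto simp: e_def)
  also have "\<dots> = ennreal ((real (card T) + 1) * e)" by (simp add: algebra_simps)
  also have "\<dots> \<le> ennreal ((2 * ln (real n) / L + 3) * e)"
    using T(3) by (intro ennreal_leI mult_right_mono) (auto simp: e_def)
  finally show ?thesis by (simp add: e_def)
qed

section \<open>The detection boundary\<close>

text \<open>In the unit of length \<open>w = sqrt (2 * ln p)\<close> a Gaussian tail at
  \<open>z * w\<close> is \<open>p powr (- z\<^sup>2)\<close> up to subpolynomial factors, so the
  estimates below become comparisons of exponents.\<close>

lemma powr_eq_exp_sqrt:
  assumes "1 \<le> p" shows "p powr c = exp (c * (sqrt (2 * ln p))\<^sup>2 / 2)"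
  using assms by (simp add: powr_def)

lemma sqrt_two_ln: "sqrt (2 * r * ln p) = sqrt r * sqrt (2 * ln p)"
  by (simp add: real_sqrt_mult)

lemma asymp_equiv_loglog_bounds:
  fixes n :: "nat \<Rightarrow> nat" and a e :: real
  assumes a: "0 < a" and e: "0 < e" and n: "(\<lambda>p. ln (ln (real (n p)))) \<sim>[at_top] (\<lambda>p. a * ln (real p))"
  shows "\<forall>\<^sub>F p in at_top. real p powr (a - e) \<le> ln (real (n p)) \<and> ln (real (n p)) \<le> real p powr (a + e)"
proof -
  \<comment> \<open>The cap 1 on the tolerance keeps the ratio positive and thus forces
    \<open>ln (ln n)\<close> to be positive.\<close>
  have same: "\<forall>\<^sub>F p in at_top. \<bar>ln (ln (real (n p))) / (a * ln (real p)) - 1\<bar> < min 1 (e / a)"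
  proof -
    have "((\<lambda>p. ln (ln (real (n p))) / (a * ln (real p))) \<longlongrightarrow> 1) at_top"
    proof (rule asymp_equivD_strong[OF n])
      have "\<forall>\<^sub>F p::nat in at_top. 1 < p" by (rule eventually_gt_at_top)
      then show "\<forall>\<^sub>F p in at_top. ln (ln (real (n p))) \<noteq> 0 \<or> a * ln (real p) \<noteq> 0"
        by eventually_elim (use a in auto)
    qed
    from tendstoD[OF this, of "min 1 (e / a)"] show ?thesis using a e by (simp add: dist_real_def)
  qed
  have "\<forall>\<^sub>F p::nat in at_top. 1 < p" by (rule eventually_gt_at_top)
  with same show ?thesis
  proof eventually_elim
    case (elim p)
    let ?l = "ln (real p)" and ?L = "ln (real (n p))"
    have l: "0 < ?l" using elim by simp
    let ?q = "ln ?L / (a * ?l)"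
    have q: "0 < ?q" "1 - e / a < ?q" "?q < 1 + e / a" using elim(1) by (auto simp: abs_less_iff)
    have eq: "ln ?L = ?q * (a * ?l)" using a l by simp
    then have "0 < ln ?L" using q a l by (metis mult_pos_pos)
    moreover have "0 \<le> ?L" by (cases "n p = 0") auto
    \<comment> \<open>Since \<open>ln 0 = 0\<close>, a positive \<open>ln ?L\<close> rules out
      \<open>?L = 0\<close>.\<close>
    ultimately have L: "0 < ?L" by (cases "?L = 0") auto
    have "(1 - e / a) * (a * ?l) \<le> ln ?L" "ln ?L \<le> (1 + e / a) * (a * ?l)"
      using q a l by (subst eq, intro mult_right_mono; simp)+
    moreover have "(1 - e / a) * (a * ?l) = (a - e) * ?l" "(1 + e / a) * (a * ?l) = (a + e) * ?l"
      using a by (simp_all add: field_simps)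
    ultimately have "(a - e) * ?l \<le> ln ?L" "ln ?L \<le> (a + e) * ?l" by simp_all
    then have "exp ((a - e) * ?l) \<le> exp (ln ?L)" "exp (ln ?L) \<le> exp ((a + e) * ?l)" by auto
    then show ?case using L elim(2) by (simp add: powr_def)
  qed
qed

lemma eventually_ge_2_if_ln_ge_powr:
  fixes n :: "nat \<Rightarrow> nat"
  assumes "\<forall>\<^sub>F p in at_top. real p powr c \<le> ln (real (n p))"
  shows "\<forall>\<^sub>F p in at_top. 2 \<le> n p"
  using assms eventually_gt_at_top[of 0]
proof eventually_elim
  case (elim p)
  then have "0 < real p powr c" by simp
  then have "0 < ln (real (n p))" using elim by linarith
  then show ?case by (cases "n p = 0"; cases "n p = 1") auto
qed

lemma asymp_equiv_sparsity_bounds: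
  fixes s :: "nat \<Rightarrow> nat"
  assumes "(\<lambda>p. real (s p)) \<sim>[at_top] (\<lambda>p. real p powr (1 - \<beta>))"
  shows "\<forall>\<^sub>F p in at_top. real p powr (1 - \<beta>) / 2 \<le> real (s p) \<and> real (s p) \<le> 2 * real p powr (1 - \<beta>)"
  using asymp_equiv_imp_eventually_ge[OF assms, of "1/2"] asymp_equiv_imp_eventually_le[OF assms, of 2]
  by (simp add: eventually_conj_iff)

lemma not_tendsto_0_if_bounded_below:
  fixes f :: "nat \<Rightarrow> ennreal"
  assumes "\<forall>\<^sub>F p in at_top. ennreal c \<le> f p" "0 < c"
  shows "\<not> f \<longlonglongrightarrow> 0"
proof
  assume "f \<longlonglongrightarrow> 0"
  then have "\<forall>\<^sub>F p in at_top. f p < ennreal c" by (rule order_tendstoD) (use assms in simp)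
  with assms(1) have "\<forall>\<^sub>F p::nat in at_top. False" by eventually_elim auto
  then show False by simp
qed

lemma power_one_plus_le_exp: "0 \<le> x \<Longrightarrow> (1 + x) ^ k \<le> exp (real k * x)" for x :: real
  using power_mono[OF exp_ge_add_one_self[of x], of k] by (simp add: exp_of_nat_mult)

text \<open>One change point is enough. Truncation at \<open>y = w\<close>, the size of the maximum
  of \<open>p\<close> null statistics, keeps most of the mass because of \<open>sep\<close>. A
  common row contributes \<open>p\<close> to the power
  \<open>(2 * sqrt r - c)\<^sup>2 - 2 * r + 2 * c\<close>, and since \<open>s / m\<close> is of
  order \<open>p powr (1 - 2 * \<beta>)\<close>, the second condition on \<open>c\<close> says that
  the second moment stays bounded.\<close>

lemma risk_not_tendsto_0_sparse:
  fixes \<beta> r c :: real and n s :: "nat \<Rightarrow> nat"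
  assumes \<beta>: "1/2 < \<beta>" "\<beta> < 1" and r: "0 < r" "r < 1" and sep: "1 - \<beta> < (1 - sqrt r)\<^sup>2"
    and c: "0 \<le> c" "1 - 2 * \<beta> + ((2 * sqrt r - c)\<^sup>2 - 2 * r + 2 * c) \<le> 0"
    and n: "\<forall>\<^sub>F p in at_top. 2 \<le> n p"
    and s: "\<forall>\<^sub>F p in at_top. real p powr (1 - \<beta>) / 2 \<le> real (s p) \<and> real (s p) \<le> 2 * real p powr (1 - \<beta>)"
  shows "\<not> (\<lambda>p. risk_1side p (n p) (sqrt (2 * r * ln (real p))) (s p)) \<longlonglongrightarrow> 0"
proof (rule not_tendsto_0_if_bounded_below)
  have 1: "\<forall>\<^sub>F p::nat in at_top. 1 < real p powr (1 - \<beta>) / 2" using \<beta> by real_asymp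
  have 2: "\<forall>\<^sub>F p::nat in at_top. 2 * (2 * real p powr (1 - \<beta>)) \<le> real p" using \<beta> by real_asymp
  have 3: "\<forall>\<^sub>F p::nat in at_top. 2 * real p powr (1 - \<beta> - (1 - sqrt r)\<^sup>2) \<le> 1/2"
  proof -
    have "\<forall>\<^sub>F p::nat in at_top. 2 * real p powr d \<le> 1/2" if "d < 0" for d :: real
      using that by real_asymp
    then show ?thesis using sep by simp
  qed
  have 4: "\<forall>\<^sub>F p::nat in at_top. 1 < p" by (rule eventually_gt_at_top)
  show "\<forall>\<^sub>F p in at_top. ennreal (1 / (4 * (2 * exp 8))) \<le> risk_1side p (n p) (sqrt (2 * r * ln (real p))) (s p)"
    using 1 2 3 4 n s
  proof eventually_elim
    case (elim p)
    define w where "w = sqrt (2 * ln (real p))"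
    define m where "m = p div s p"
    have p: "1 \<le> real p" "0 < real p" using elim by auto
    note P = powr_eq_exp_sqrt[OF p(1), folded w_def]
    have w: "0 \<le> w" using p by (simp add: w_def)
    have s1: "1 \<le> real (s p)" "2 * real (s p) \<le> real p" using elim by auto
    \<comment> \<open>Rounding in \<open>p div s p\<close> costs at most a factor 2, because
      \<open>p \<ge> 2 * s p\<close>.\<close>
    have m: "real p / (2 * real (s p)) \<le> real m"
    proof -
      have "real p / real (s p) - 1 \<le> real m" using floor_divide_of_nat_eq[of p "s p", where 'a = real] unfolding m_def by linarith
      moreover have "1 \<le> real p / (2 * real (s p))" using s1 by (simp add: field_simps)
      moreover have "real p / real (s p) = 2 * (real p / (2 * real (s p)))" by simp
      ultimately show ?thesis by linarith
    qed
    have "1 \<le> real p / (2 * real (s p))" using s1 by (simp add: field_simps)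
    with m have m1: "1 \<le> real m" by linarith
    \<comment> \<open>The constant 8 is one factor 2 from the rounding of \<open>m\<close> and the
      square of the factor 2 in the bound on \<open>s p\<close>. It reappears in the bound
      \<open>exp 8\<close> for each of the two second moment terms.\<close>
    have sm: "real (s p) / real m \<le> 8 * real p powr (1 - 2 * \<beta>)"
    proof -
      have "real (s p) / real m \<le> real (s p) / (real p / (2 * real (s p)))"
        using m m1 p s1 by (intro divide_left_mono) (auto intro!: mult_pos_pos divide_pos_pos)
      also have "\<dots> = 2 * (real (s p))\<^sup>2 / real p" by (simp add: power2_eq_square)
      also have "\<dots> \<le> 2 * (2 * real p powr (1 - \<beta>))\<^sup>2 / real p"
        using elim p by (intro divide_right_mono mult_left_mono power_mono) auto
      also have "\<dots> = 8 * (real p powr (2 * (1 - \<beta>)) / real p powr 1)"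
        using p by (simp add: power_mult_distrib powr_power)
      also have "\<dots> = 8 * real p powr (1 - 2 * \<beta>)"
        unfolding powr_diff[symmetric] by (simp add: algebra_simps)
      finally show ?thesis .
    qed
    have step: "(1 + real p powr k / real m) ^ s p \<le> exp 8" if k: "1 - 2 * \<beta> + k \<le> 0" for k
    proof -
      have "(1 + real p powr k / real m) ^ s p \<le> exp (real (s p) * (real p powr k / real m))"
        by (intro power_one_plus_le_exp) auto
      also have "real (s p) * (real p powr k / real m) = (real (s p) / real m) * real p powr k" by simp
      also have "\<dots> \<le> 8 * real p powr (1 - 2 * \<beta>) * real p powr k" using sm by (intro mult_right_mono) auto
      also have "\<dots> = 8 * real p powr (1 - 2 * \<beta> + k)" by (simp add: powr_add)
      also have "\<dots> \<le> 8 * real p powr 0" using k p by (intro mult_left_mono powr_mono) auto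
      finally show ?thesis using p by simp
    qed
    show "ennreal (1 / (4 * (2 * exp 8))) \<le> risk_1side p (n p) (sqrt (2 * r * ln (real p))) (s p)"
    proof (rule risk_1side_lower_bound[where T = "{1}" and m = m and y = w and \<mu> = "c * w" and \<kappa> = 0])
      show "{1} \<subseteq> {1..<n p}" using elim by auto
      show "m \<ge> 1" using m1 by simp
      show "s p * m \<le> p" by (simp add: m_def)
      show "sqrt (2 * r * ln (real p)) \<le> w"
        unfolding sqrt_two_ln w_def[symmetric] using r w by (intro mult_left_le_one_le) auto
      show "0 \<le> c * w" using c w by simp
      have "w - sqrt r * w = (1 - sqrt r) * w" by (simp add: algebra_simps)
      then have E: "exp (- (w - sqrt r * w)\<^sup>2 / 2) = real p powr (- (1 - sqrt r)\<^sup>2)"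
        unfolding P by (simp add: power_mult_distrib)
      have "real (s p) * real p powr (- (1 - sqrt r)\<^sup>2) \<le> 2 * real p powr (1 - \<beta>) * real p powr (- (1 - sqrt r)\<^sup>2)"
        using elim by (intro mult_right_mono) auto
      also have "\<dots> = 2 * real p powr (1 - \<beta> - (1 - sqrt r)\<^sup>2)"
        using p by (simp add: powr_add[symmetric])
      finally show "real (s p) * exp (- (w - sqrt (2 * r * ln (real p)))\<^sup>2 / 2) \<le> 1 / 2"
        unfolding sqrt_two_ln w_def[symmetric] E using elim by linarith
      have K: "exp ((2 * (sqrt r * w) - c * w)\<^sup>2 / 2 - (sqrt r * w)\<^sup>2 + c * w * w) =
        real p powr ((2 * sqrt r - c)\<^sup>2 - 2 * r + 2 * c)"
      proof -
        have "(2 * (sqrt r * w) - c * w)\<^sup>2 / 2 - (sqrt r * w)\<^sup>2 + c * w * w =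
          ((2 * sqrt r - c)\<^sup>2 - 2 * (sqrt r)\<^sup>2 + 2 * c) * w\<^sup>2 / 2"
          by (simp add: power2_eq_square field_simps)
        then show ?thesis unfolding P using r by simp
      qed
      have "(1 + exp ((2 * (sqrt r * w) - c * w)\<^sup>2 / 2 - (sqrt r * w)\<^sup>2 + c * w * w) / real m) ^ s p \<le> exp 8"
        unfolding K by (rule step[OF c(2)])
      moreover have "(1 + 1 / real m) ^ s p \<le> exp 8" using step[of 0] \<beta> p by simp
      ultimately show "(1 + exp ((2 * sqrt (2 * r * ln (real p)) - c * w)\<^sup>2 / 2 - (sqrt (2 * r * ln (real p)))\<^sup>2 + c * w * w) / real m) ^ s p / real (card {1::nat}) +
        (1 + exp ((sqrt (2 * r * ln (real p)))\<^sup>2 * 0) / real m) ^ s p \<le> 2 * exp 8"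
        unfolding sqrt_two_ln w_def[symmetric] by simp
      have "1 \<le> exp (8::real)" by simp
      then show "1 \<le> 2 * exp (8::real)" by linarith
    qed auto
  qed
qed simp

lemma contrast_corr_le_sqrt_ratio:
  assumes "1 \<le> t" "t \<le> u" "u < n"
  shows "contrast_corr n t u \<le> sqrt (real t / real u)"
proof -
  have pos: "0 < real t" "0 < real u" "0 < real n - real t" "0 < real n - real u" using assms by auto
  have "(real t / (real n - real t)) / (real u / (real n - real u)) = (real t / real u) * ((real n - real u) / (real n - real t))"
    by simp
  also have "\<dots> \<le> (real t / real u) * 1"
    using pos assms by (intro mult_left_mono) auto
  finally show ?thesis unfolding contrast_corr_eq[OF assms] by simp
qed

text \<open>Powers of \<open>M\<close> up to about \<open>sqrt n\<close>: the ratio of two different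
  points is at least \<open>M\<close>, and \<open>M ^ N \<le> sqrt n < n\<close> leaves all of them
  admissible. As \<open>ln n / (2 * ln M)\<close> is at least 2, rounding it down loses at most
  half.\<close>

lemma geometric_grid:
  fixes M n :: nat
  assumes M: "2 \<le> M" and n: "4 * ln (real M) \<le> ln (real n)" "2 \<le> n"
  obtains T where "finite T" "T \<noteq> {}" "T \<subseteq> {1..<n}" "ln (real n) / (4 * ln (real M)) \<le> real (card T)"
    "\<And>t u. t \<in> T \<Longrightarrow> u \<in> T \<Longrightarrow> t \<noteq> u \<Longrightarrow> contrast_corr n t u \<le> 1 / sqrt (real M)"
proof
  define N where "N = nat \<lfloor>ln (real n) / (2 * ln (real M))\<rfloor>"
  define T where "T = (\<lambda>i. M ^ i) ` {1..N}"
  have lM: "0 < ln (real M)" using M by simp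
  have ge2: "2 \<le> ln (real n) / (2 * ln (real M))" using n lM by (simp add: field_simps)
  then have N: "ln (real n) / (2 * ln (real M)) - 1 \<le> real N" "real N \<le> ln (real n) / (2 * ln (real M))" "1 \<le> N"
    unfolding N_def by linarith+
  have inj: "inj_on (\<lambda>i. M ^ i) {1..N}" using M by (auto simp: inj_on_def power_inject_exp)
  have lt: "M ^ i < n" if "i \<in> {1..N}" for i
  proof -
    have "real (M ^ i) \<le> real (M ^ N)" using that M by (intro of_nat_mono power_increasing) auto
    also have "\<dots> = exp (real N * ln (real M))" using M by (simp add: exp_of_nat_mult)
    also have "real N * ln (real M) \<le> ln (real n) / 2" using N(2) lM by (simp add: field_simps)
    also have "exp (ln (real n) / 2) < exp (ln (real n))"
      unfolding exp_less_cancel_iff using n lM by linarith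
    also have "\<dots> = real n" using n by simp
    finally show ?thesis by simp
  qed
  show "finite T" "T \<noteq> {}" using N by (auto simp: T_def)
  show sub: "T \<subseteq> {1..<n}" using lt M by (auto simp: T_def)
  have "card T = N" using inj by (simp add: T_def card_image)
  moreover have "ln (real n) / (4 * ln (real M)) = ln (real n) / (2 * ln (real M)) / 2" by simp
  ultimately show "ln (real n) / (4 * ln (real M)) \<le> real (card T)" using N(1) ge2 by linarith
  have corr: "contrast_corr n (M ^ i) (M ^ j) \<le> 1 / sqrt (real M)" if ij: "i < j" "i \<in> {1..N}" "j \<in> {1..N}" for i j
  proof -
    have Mi: "1 \<le> M ^ i" using M by simp
    have "real (M ^ i) * real M = real (M ^ Suc i)" by simp
    also have "\<dots> \<le> real (M ^ j)" using ij M by (intro of_nat_mono power_increasing) auto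
    finally have le: "real (M ^ i) * real M \<le> real (M ^ j)" .
    have "M ^ i \<le> M ^ j" using ij M by (intro power_increasing) auto
    then have "contrast_corr n (M ^ i) (M ^ j) \<le> sqrt (real (M ^ i) / real (M ^ j))"
      using Mi lt[OF ij(3)] by (intro contrast_corr_le_sqrt_ratio)
    also have "\<dots> \<le> sqrt (1 / real M)"
    proof -
      have "0 < real (M ^ j)" "0 < real M" using M by auto
      then have "real (M ^ i) / real (M ^ j) \<le> 1 / real M"
        using le by (simp only: divide_le_eq le_divide_eq times_divide_eq_left) (simp add: mult.commute)
      then show ?thesis by simp
    qed
    finally show ?thesis by (simp add: real_sqrt_divide)
  qed
  fix t u assume "t \<in> T" "u \<in> T" "t \<noteq> u"
  then obtain i j where ij: "i \<in> {1..N}" "j \<in> {1..N}" "t = M ^ i" "u = M ^ j"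
    unfolding T_def by blast
  moreover from this \<open>t \<noteq> u\<close> have "i \<noteq> j" by auto
  ultimately show "contrast_corr n t u \<le> 1 / sqrt (real M)"
    using corr[of i j] corr[of j i] contrast_corr_commute[of n t u] by (cases "i < j") auto
qed

text \<open>Truncation just above the mean, at \<open>z * w\<close> with \<open>z\<close> slightly
  larger than \<open>sqrt r\<close>, together with the tilt \<open>\<mu> = \<rho>\<close> lowers the
  diagonal moment from \<open>p powr (2 * r)\<close> to the exponent
  \<open>2 * sqrt r * z - r\<close>, which is close to \<open>r\<close>. It is divided by
  \<open>p\<close> rows and about \<open>ln n\<close> change points, so r < 1 + a suffices;
  \<open>d\<close> is the slack left. A fixed \<open>M\<close> with
  \<open>sqrt M \<ge> 2 * r\<close> bounds the off-diagonal moments by \<open>p\<close>.\<close>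

lemma risk_not_tendsto_0_single:
  fixes a r :: real and n s :: "nat \<Rightarrow> nat"
  assumes a: "0 < a" and r: "0 < r" "r < 1 + a"
    and n: "\<And>e. 0 < e \<Longrightarrow> \<forall>\<^sub>F p in at_top. real p powr (a - e) \<le> ln (real (n p))"
    and s: "\<forall>\<^sub>F p in at_top. s p = 1"
  shows "\<not> (\<lambda>p. risk_1side p (n p) (sqrt (2 * r * ln (real p))) (s p)) \<longlonglongrightarrow> 0"
proof -
  obtain M :: nat where M: "2 \<le> M" "(2 * r)\<^sup>2 \<le> real M"
  proof
    show "2 \<le> max 2 (nat \<lceil>(2 * r)\<^sup>2\<rceil>)" by simp
    show "(2 * r)\<^sup>2 \<le> real (max 2 (nat \<lceil>(2 * r)\<^sup>2\<rceil>))" by linarith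
  qed
  have sr: "0 < sqrt r" "sqrt r * sqrt r = r" using r by auto
  have "sqrt r * (2 * sqrt r) < 1 + a + r" using r sr(2) by (simp only: mult.left_commute[of _ 2])
  then have "sqrt r < (1 + a + r) / (2 * sqrt r)" using sr by (simp only: pos_less_divide_eq mult_pos_pos zero_less_numeral)
  then obtain z where z: "sqrt r < z" "z < (1 + a + r) / (2 * sqrt r)" using dense by blast
  define d where "d = 1 + a + r - 2 * sqrt r * z"
  have "z * (2 * sqrt r) < 1 + a + r" using z(2) sr by (simp only: pos_less_divide_eq mult_pos_pos zero_less_numeral)
  then have d: "0 < d" by (simp add: d_def mult_ac)
  \<comment> \<open>The diagonal term is at most \<open>1 + 4 * ln M\<close>, the second summand
    being the inverse density of the grid; the off-diagonal term is at most 2.\<close>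
  define C where "C = 3 + 4 * ln (real M)"
  have lM: "0 < ln (real M)" using M by simp
  have 1: "\<forall>\<^sub>F p::nat in at_top. 4 * ln (real M) + 1 \<le> real p powr (a - a / 2)" using a by real_asymp
  have 2: "\<forall>\<^sub>F p::nat in at_top. real p powr (- ((z - sqrt r)\<^sup>2)) \<le> 1/2"
  proof -
    have "\<forall>\<^sub>F p::nat in at_top. real p powr (- d) \<le> 1/2" if "0 < d" for d :: real
      using that by real_asymp
    then show ?thesis using z by simp
  qed
  have 3: "\<forall>\<^sub>F p::nat in at_top. 1 < p" by (rule eventually_gt_at_top)
  have "\<forall>\<^sub>F p in at_top. ennreal (1 / (4 * C)) \<le> risk_1side p (n p) (sqrt (2 * r * ln (real p))) (s p)"
    using 1 2 3 n[OF d] n[of "a/2", OF half_gt_zero[OF a]] s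
  proof eventually_elim
    case (elim p)
    define w where "w = sqrt (2 * ln (real p))"
    have p: "1 \<le> real p" "0 < real p" using elim by auto
    note P = powr_eq_exp_sqrt[OF p(1), folded w_def]
    have w: "0 \<le> w" using p by (simp add: w_def)
    have ln_n: "4 * ln (real M) \<le> ln (real (n p))" "0 < ln (real (n p))" using elim lM by auto
    then have n2: "2 \<le> n p" by (cases "n p = 0"; cases "n p = 1") auto
    obtain T where T: "finite T" "T \<noteq> {}" "T \<subseteq> {1..<n p}" "ln (real (n p)) / (4 * ln (real M)) \<le> real (card T)"
      and corr: "\<And>t u. t \<in> T \<Longrightarrow> u \<in> T \<Longrightarrow> t \<noteq> u \<Longrightarrow> contrast_corr (n p) t u \<le> 1 / sqrt (real M)"
      using geometric_grid[OF M(1) ln_n(1) n2] by blast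
    have cT: "1 \<le> real (card T)" using T by (simp add: Suc_le_eq card_gt_0_iff)
    show "ennreal (1 / (4 * C)) \<le> risk_1side p (n p) (sqrt (2 * r * ln (real p))) (s p)"
    proof (rule risk_1side_lower_bound[where T = T and m = p and y = "z * w" and \<mu> = "sqrt r * w" and \<kappa> = "1 / sqrt (real M)"])
      show "p \<ge> 1" "s p * p \<le> p" using elim by auto
      show "sqrt (2 * r * ln (real p)) \<le> z * w"
        unfolding sqrt_two_ln w_def[symmetric] using z w by (intro mult_right_mono) auto
      show "0 \<le> sqrt r * w" using sr w by simp
      have "exp (- (z * w - sqrt r * w)\<^sup>2 / 2) = real p powr (- ((z - sqrt r)\<^sup>2))"
        unfolding P by (simp add: power_mult_distrib left_diff_distrib[symmetric])
      then show "real (s p) * exp (- (z * w - sqrt (2 * r * ln (real p)))\<^sup>2 / 2) \<le> 1 / 2"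
        unfolding sqrt_two_ln w_def[symmetric] using elim by simp
      have K: "exp ((2 * (sqrt r * w) - sqrt r * w)\<^sup>2 / 2 - (sqrt r * w)\<^sup>2 + sqrt r * w * (z * w)) = real p powr (1 + a - d)"
      proof -
        have "(2 * (sqrt r * w) - sqrt r * w)\<^sup>2 / 2 - (sqrt r * w)\<^sup>2 + sqrt r * w * (z * w) =
          (- (sqrt r * sqrt r) + 2 * sqrt r * z) * w\<^sup>2 / 2"
          using less_imp_le[OF r(1)] by (simp add: power2_eq_square field_simps)
        also have "\<dots> = (1 + a - d) * w\<^sup>2 / 2" using r(1) by (simp add: d_def)
        finally show ?thesis unfolding P by simp
      qed
      have K': "exp ((sqrt r * w)\<^sup>2 * (1 / sqrt (real M))) \<le> real p"
      proof -
        have "2 * r \<le> sqrt (real M)" using M(2) by (rule real_le_rsqrt)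
        then have "2 * r / sqrt (real M) \<le> 1" using r M by simp
        then have "real p powr (2 * r / sqrt (real M)) \<le> real p powr 1" using p by (intro powr_mono) auto
        moreover
        have "(sqrt r * w)\<^sup>2 * (1 / sqrt (real M)) = (2 * r / sqrt (real M)) * w\<^sup>2 / 2"
          using less_imp_le[OF r(1)] by (simp add: power_mult_distrib)
        then have "exp ((sqrt r * w)\<^sup>2 * (1 / sqrt (real M))) = real p powr (2 * r / sqrt (real M))"
          unfolding P by simp
        ultimately show ?thesis using p by simp
      qed
      have "real p powr (1 + a - d) / real p / real (card T) \<le> 4 * ln (real M)"
      proof -
        have "real p powr (1 + a - d) / real p = real p powr (1 + a - d) / real p powr 1" using p by simp
        also have "\<dots> = real p powr (a - d)" unfolding powr_diff[symmetric] by (simp add: algebra_simps)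
        also have "\<dots> \<le> ln (real (n p))" using elim by simp
        also have "\<dots> \<le> 4 * ln (real M) * real (card T)" using T(4) lM by (simp add: field_simps)
        finally show ?thesis using cT by (subst pos_divide_le_eq) auto
      qed
      moreover have "1 / real (card T) \<le> 1" using cT by simp
      moreover have "exp ((sqrt r * w)\<^sup>2 * (1 / sqrt (real M))) / real p \<le> 1" using K' p by simp
      ultimately show "(1 + exp ((2 * sqrt (2 * r * ln (real p)) - sqrt r * w)\<^sup>2 / 2 - (sqrt (2 * r * ln (real p)))\<^sup>2 + sqrt r * w * (z * w)) / real p) ^ s p / real (card T) +
        (1 + exp ((sqrt (2 * r * ln (real p)))\<^sup>2 * (1 / sqrt (real M))) / real p) ^ s p \<le> C"
        unfolding sqrt_two_ln w_def[symmetric] K using elim(6) by (simp add: C_def add_divide_distrib)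
      show "1 \<le> C" using lM by (simp add: C_def)
    qed (use T corr in auto)
  qed
  moreover have "0 < 1 / (4 * C)" using lM by (simp add: C_def)
  ultimately show ?thesis by (rule not_tendsto_0_if_bounded_below)
qed

section \<open>Upper bounds in powers of \<open>p\<close>\<close>

lemma tendsto_0_if_eventually_le_ennreal:
  fixes f :: "nat \<Rightarrow> ennreal" and g :: "nat \<Rightarrow> real"
  assumes "\<forall>\<^sub>F p in at_top. f p \<le> ennreal (g p)" "g \<longlonglongrightarrow> 0"
  shows "f \<longlonglongrightarrow> 0"
proof (rule tendsto_sandwich[where f = "\<lambda>_. 0"])
  show "(\<lambda>p. ennreal (g p)) \<longlonglongrightarrow> 0" using tendsto_ennrealI[OF assms(2)] by simp
qed (use assms(1) in auto)

text \<open>The cell length \<open>L = ln (r / r')\<close> is the one at which the correlation loss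
  of the cover turns \<open>r\<close> into \<open>r'\<close>. It does not depend on
  \<open>p\<close>, so the cover still has only order \<open>ln n\<close> points.\<close>

lemma sqrt_scale_exp_ln:
  assumes "0 < r" "0 < r'"
  shows "sqrt r * w * exp (- ln (r / r') / 2) = sqrt r' * w"
proof -
  have "exp (- ln (r / r') / 2) = sqrt (exp (- ln (r / r')))"
    by (rule real_sqrt_unique[symmetric]) (simp_all add: power2_eq_square exp_add[symmetric])
  also have "exp (- ln (r / r')) = r' / r" using assms by (simp add: exp_minus)
  finally show ?thesis using assms by (simp add: real_sqrt_divide)
qed

text \<open>Between \<open>1 + a\<close> and \<open>r\<close> there is room for two exponents:
  \<open>r'\<close> for the signal seen at the nearest candidate and \<open>q < r'\<close> for the
  level. The false alarm term is of order \<open>p powr (a + e + 1 - q) = p powr (- e)\<close>, and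
  the gap \<open>(sqrt r' - sqrt q) * w\<close> tends to infinity.\<close>

lemma risk_tendsto_0_single:
  fixes a r :: real and n s :: "nat \<Rightarrow> nat"
  assumes a: "0 < a" and r: "1 + a < r"
    and n: "\<And>e. 0 < e \<Longrightarrow> \<forall>\<^sub>F p in at_top. real p powr (a - e) \<le> ln (real (n p)) \<and> ln (real (n p)) \<le> real p powr (a + e)"
    and s: "\<forall>\<^sub>F p in at_top. s p = 1"
  shows "(\<lambda>p. risk_1side p (n p) (sqrt (2 * r * ln (real p))) (s p)) \<longlonglongrightarrow> 0"
proof -
  obtain r' where r': "1 + a < r'" "r' < r" using dense[OF r] by blast
  obtain q where q: "1 + a < q" "q < r'" using dense[OF r'(1)] by blast
  define L where "L = ln (r / r')"
  have L: "0 < L" using r' a by (simp add: L_def)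
  define d where "d = sqrt r' - sqrt q"
  have d: "0 < d" using q by (simp add: d_def)
  define e where "e = (q - 1 - a) / 2"
  have e: "0 < e" "q = 1 + a + 2 * e" using q by (auto simp: e_def field_simps)
  define g where "g p = (2 * real p powr (a + e) / L + 2) * (real p * real p powr (- q)) +
    exp (- (d * sqrt (2 * ln (real p)) - 1)\<^sup>2 / 2)" for p :: nat
  have 1: "\<forall>\<^sub>F p::nat in at_top. 1 \<le> d * sqrt (2 * ln (real p))" using d by real_asymp
  have 2: "\<forall>\<^sub>F p::nat in at_top. 1 < p" by (rule eventually_gt_at_top)
  \<comment> \<open>With tolerance \<open>a\<close> the lower bound on \<open>ln (n p)\<close> is
    \<open>p powr 0\<close>, which excludes \<open>n p = 0\<close> and
    \<open>n p = 1\<close>.\<close>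
  have n2: "\<forall>\<^sub>F p in at_top. 2 \<le> n p"
    using n[OF a] unfolding eventually_conj_iff by (blast intro: eventually_ge_2_if_ln_ge_powr)
  show ?thesis
  proof (rule tendsto_0_if_eventually_le_ennreal)
    show "\<forall>\<^sub>F p in at_top. risk_1side p (n p) (sqrt (2 * r * ln (real p))) (s p) \<le> ennreal (g p)"
      using 1 2 n2 n[OF e(1)] s
    proof eventually_elim
      case (elim p)
      define w where "w = sqrt (2 * ln (real p))"
      have p: "1 \<le> real p" "0 < real p" using elim by auto
      note P = powr_eq_exp_sqrt[OF p(1), folded w_def]
      have w: "0 \<le> w" using p by (simp add: w_def)
      have \<rho>: "sqrt (2 * r * ln (real p)) * exp (- L / 2) = sqrt r' * w"
        unfolding sqrt_two_ln w_def[symmetric] L_def using r' a by (intro sqrt_scale_exp_ln) auto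
      have gap: "sqrt r' * w - sqrt q * w = d * w" by (simp add: d_def left_diff_distrib)
      have "risk_1side p (n p) (sqrt (2 * r * ln (real p))) (s p) \<le>
        ennreal ((2 * ln (real (n p)) / L + 2) * (real p * exp (- (sqrt q * w)\<^sup>2 / 2)) +
          exp (- (sqrt (2 * r * ln (real p)) * exp (- L / 2) - sqrt q * w - 1)\<^sup>2 / 2))"
      proof (rule risk_1side_le_max_test)
        show "sqrt q * w + 1 \<le> sqrt (2 * r * ln (real p)) * exp (- L / 2)"
          unfolding \<rho> using gap elim(1) unfolding w_def[symmetric] by linarith
      qed (use L elim w q a in auto)
      also have "exp (- (sqrt q * w)\<^sup>2 / 2) = real p powr (- q)"
        unfolding P using q a by (simp add: power_mult_distrib)
      also have "sqrt (2 * r * ln (real p)) * exp (- L / 2) - sqrt q * w = d * w" unfolding \<rho> by (rule gap)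
      also have "(2 * ln (real (n p)) / L + 2) * (real p * real p powr (- q)) + exp (- (d * w - 1)\<^sup>2 / 2) \<le> g p"
        unfolding g_def w_def[symmetric] using elim L
        by (intro add_right_mono mult_right_mono divide_right_mono add_mono) auto
      finally show ?case by (simp add: ennreal_leI order_trans)
    qed
    have "(\<lambda>p::nat. (2 * real p powr (a + e) / L + 2) * (real p * real p powr (- (1 + a + 2 * e))) +
      exp (- (d * sqrt (2 * ln (real p)) - 1)\<^sup>2 / 2)) \<longlonglongrightarrow> 0 + 0"
    proof (rule tendsto_add)
      show "(\<lambda>p::nat. (2 * real p powr (a + e) / L + 2) * (real p * real p powr (- (1 + a + 2 * e)))) \<longlonglongrightarrow> 0"
        using a e(1) L by real_asymp
      show "(\<lambda>p::nat. exp (- (d * sqrt (2 * ln (real p)) - 1)\<^sup>2 / 2)) \<longlonglongrightarrow> 0"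
        using d by real_asymp
    qed
    then show "g \<longlonglongrightarrow> 0" unfolding g_def e(2)[symmetric] by simp
  qed
qed

text \<open>The factor \<open>exp (- d * w - 1/2) / sqrt (2 * pi)\<close> lost in
  \<open>gauss_tail_ge\<close> is absorbed by \<open>p powr (- e)\<close>, because \<open>w\<close>
  grows more slowly than \<open>ln p\<close>.\<close>

lemma gauss_tail_ge_powr:
  fixes d e :: real
  assumes "0 \<le> d" "0 < e"
  shows "\<forall>\<^sub>F p::nat in at_top. real p powr (- d\<^sup>2 - e) \<le> gauss_tail (d * sqrt (2 * ln (real p)))"
proof -
  have 1: "\<forall>\<^sub>F p::nat in at_top. d * sqrt (2 * ln (real p)) + 1 / 2 + ln (sqrt (2 * pi)) \<le> e * ln (real p)"
    using assms by real_asymp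
  have 2: "\<forall>\<^sub>F p::nat in at_top. 1 < p" by (rule eventually_gt_at_top)
  show ?thesis
    using 1 2
  proof eventually_elim
    case (elim p)
    define w where "w = sqrt (2 * ln (real p))"
    have w2: "w\<^sup>2 = 2 * ln (real p)" using elim by (simp add: w_def)
    have "(- d\<^sup>2 - e) * ln (real p) \<le> - (d * w + 1)\<^sup>2 / 2 - ln (sqrt (2 * pi))"
    proof -
      have "(d * w + 1)\<^sup>2 / 2 = d\<^sup>2 * w\<^sup>2 / 2 + d * w + 1 / 2" by (simp add: power2_eq_square field_simps)
      also have "\<dots> = d\<^sup>2 * ln (real p) + d * w + 1 / 2" unfolding w2 by simp
      finally have "(d * w + 1)\<^sup>2 / 2 = d\<^sup>2 * ln (real p) + d * w + 1 / 2" .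
      moreover have "(- d\<^sup>2 - e) * ln (real p) = - (d\<^sup>2 * ln (real p)) - e * ln (real p)"
        by (simp add: algebra_simps)
      ultimately show ?thesis using elim(1) unfolding w_def[symmetric] minus_divide_left[symmetric] by linarith
    qed
    then have "real p powr (- d\<^sup>2 - e) \<le> exp (- (d * w + 1)\<^sup>2 / 2 - ln (sqrt (2 * pi)))"
      using elim(2) by (simp add: powr_def)
    also have "\<dots> = exp (- (d * w + 1)\<^sup>2 / 2) / sqrt (2 * pi)" by (simp add: exp_diff)
    also have "\<dots> \<le> gauss_tail (d * w)" using assms(1) elim(2) by (intro gauss_tail_ge) (simp add: w_def)
    finally show ?case by (simp add: w_def)
  qed
qed

text \<open>With level \<open>z * w\<close> and \<open>h = p powr (- \<eta>)\<close> the condition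
  \<open>1 - z\<^sup>2 \<le> 2 * \<eta>\<close> bounds the variance term
  \<open>h\<^sup>2 * p * exp (- y\<^sup>2 / 2)\<close>. The strict upper bound on \<eta> makes the
  signal term \<open>h * s * G\<close> at least a positive power of \<open>p\<close>, and its
  exponential outweighs every polynomial bound on \<open>ln n\<close>.\<close>

lemma risk_tendsto_0_sparse:
  fixes a \<beta> r r' z \<eta> :: real and n s :: "nat \<Rightarrow> nat"
  assumes a: "0 < a" and r': "0 < r'" "r' < r" and z: "sqrt r' \<le> z"
    and \<eta>: "0 < \<eta>" "1 - z\<^sup>2 \<le> 2 * \<eta>" "\<eta> < 1 - \<beta> - (z - sqrt r')\<^sup>2"
    and n: "\<And>e. 0 < e \<Longrightarrow> \<forall>\<^sub>F p in at_top. real p powr (a - e) \<le> ln (real (n p)) \<and> ln (real (n p)) \<le> real p powr (a + e)"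
    and s: "\<forall>\<^sub>F p in at_top. real p powr (1 - \<beta>) / 2 \<le> real (s p)"
  shows "(\<lambda>p. risk_1side p (n p) (sqrt (2 * r * ln (real p))) (s p)) \<longlonglongrightarrow> 0"
proof -
  define d where "d = z - sqrt r'"
  define L where "L = ln (r / r')"
  have L: "0 < L" using r' by (simp add: L_def)
  have d: "0 \<le> d" using z by (simp add: d_def)
  have "d < z" "0 < z" using r' z by (auto simp: d_def intro: less_le_trans[of _ "sqrt r'"])
  then have dz: "d\<^sup>2 < z\<^sup>2" using d by (intro power_strict_mono) auto
  \<comment> \<open>The first bound leaves exponent \<open>2 * e\<close> in \<open>h * s * G\<close>
    after \<open>G\<close> has given up \<open>2 * e\<close>. The second makes
    \<open>p powr (- z\<^sup>2)\<close> at most \<open>G\<close>, so that \<open>3 * G\<close> fits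
    below the tail once \<open>p powr e \<ge> 3\<close>.\<close>
  define e where "e = min ((1 - \<beta> - d\<^sup>2 - \<eta>) / 4) ((z\<^sup>2 - d\<^sup>2) / 2)"
  have "e \<le> (1 - \<beta> - d\<^sup>2 - \<eta>) / 4" "e \<le> (z\<^sup>2 - d\<^sup>2) / 2"
    unfolding e_def by (rule min.cobounded1, rule min.cobounded2)
  then have e: "0 < e" "4 * e \<le> 1 - \<beta> - d\<^sup>2 - \<eta>" "2 * e \<le> z\<^sup>2 - d\<^sup>2"
    using \<eta> dz by (auto simp: e_def d_def)
  define g where "g p = (2 * real p powr (a + 1) / L + 3) * exp (8 - real p powr (2 * e) / 8)" for p :: nat
  have 1: "\<forall>\<^sub>F p::nat in at_top. 3 \<le> real p powr e" using e by real_asymp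
  have 2: "\<forall>\<^sub>F p::nat in at_top. real p powr (- \<eta>) \<le> 1/4" using \<eta> by real_asymp
  have 3: "\<forall>\<^sub>F p::nat in at_top. 1 < p" by (rule eventually_gt_at_top)
  have n2: "\<forall>\<^sub>F p in at_top. 2 \<le> n p"
    using n[OF a] unfolding eventually_conj_iff by (blast intro: eventually_ge_2_if_ln_ge_powr)
  show ?thesis
  proof (rule tendsto_0_if_eventually_le_ennreal)
    show "\<forall>\<^sub>F p in at_top. risk_1side p (n p) (sqrt (2 * r * ln (real p))) (s p) \<le> ennreal (g p)"
      using 1 2 3 n2 n[OF zero_less_one] s gauss_tail_ge_powr[OF d e(1)]
    proof eventually_elim
      case (elim p)
      define w where "w = sqrt (2 * ln (real p))"
      have p: "1 \<le> real p" "0 < real p" using elim by auto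
      note P = powr_eq_exp_sqrt[OF p(1), folded w_def]
      have w: "0 \<le> w" using p by (simp add: w_def)
      define G where "G = real p powr (- d\<^sup>2 - 2 * e)"
      define h where "h = real p powr (- \<eta>)"
      have \<rho>: "sqrt (2 * r * ln (real p)) * exp (- L / 2) = sqrt r' * w"
        unfolding sqrt_two_ln w_def[symmetric] L_def using r' by (intro sqrt_scale_exp_ln) auto
      have tail: "exp (- (z * w)\<^sup>2 / 2) = real p powr (- (z\<^sup>2))"
        unfolding P by (simp add: power_mult_distrib)
      have "risk_1side p (n p) (sqrt (2 * r * ln (real p))) (s p) \<le>
        ennreal ((2 * ln (real (n p)) / L + 3) *
          exp (8 * h\<^sup>2 * real p * exp (- (z * w)\<^sup>2 / 2) - h * (real (s p) * G) / 4))"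
      proof (rule risk_1side_le_score_test)
        have "real p powr (- (z\<^sup>2)) \<le> G" unfolding G_def using e p by (intro powr_mono) auto
        then have "G + 2 * real p powr (- (z\<^sup>2)) \<le> 3 * G" by linarith
        also have "\<dots> \<le> real p powr e * G" using elim(1) by (intro mult_right_mono) (auto simp: G_def)
        also have "\<dots> = real p powr (- d\<^sup>2 - e)" unfolding G_def powr_add[symmetric] by (rule arg_cong[where f="(powr) (real p)"]) simp
        also have "\<dots> \<le> gauss_tail (d * w)" using elim by (simp add: w_def)
        also have "d * w = z * w - sqrt (2 * r * ln (real p)) * exp (- L / 2)"
          unfolding \<rho> by (simp add: d_def algebra_simps)
        finally show "G \<le> gauss_tail (z * w - sqrt (2 * r * ln (real p)) * exp (- L / 2)) - 2 * exp (- (z * w)\<^sup>2 / 2)"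
          unfolding tail by linarith
        show "0 \<le> z * w" using w \<open>0 < z\<close> by simp
      qed (use L elim p r' in \<open>auto simp: h_def G_def\<close>)
      also have "(2 * ln (real (n p)) / L + 3) *
          exp (8 * h\<^sup>2 * real p * exp (- (z * w)\<^sup>2 / 2) - h * (real (s p) * G) / 4) \<le> g p"
        unfolding g_def
      proof (intro mult_mono add_right_mono divide_right_mono mult_left_mono)
        show "ln (real (n p)) \<le> real p powr (a + 1)" using elim by simp
        have "h\<^sup>2 * real p * exp (- (z * w)\<^sup>2 / 2) = real p powr (1 - z\<^sup>2 - 2 * \<eta>)"
        proof -
          have "h\<^sup>2 = real p powr (- (2 * \<eta>))" by (simp add: h_def power2_eq_square powr_add[symmetric])
          moreover have "real p = real p powr 1" using p by simp
          ultimately have "h\<^sup>2 * real p * exp (- (z * w)\<^sup>2 / 2) = real p powr (- (2 * \<eta>)) * real p powr 1 * real p powr (- (z\<^sup>2))"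
            unfolding tail by simp
          then show ?thesis unfolding powr_add[symmetric] by (simp add: algebra_simps)
        qed
        also have "\<dots> \<le> real p powr 0" using \<eta> p by (intro powr_mono) auto
        finally have A: "8 * h\<^sup>2 * real p * exp (- (z * w)\<^sup>2 / 2) \<le> 8" using p by simp
        \<comment> \<open>The factor 1/2 comes from the lower bound on \<open>s p\<close>; with the
          quarter in the test it gives the 8 in \<open>g\<close>.\<close>
        have "real p powr (2 * e) / 2 \<le> real p powr (1 - \<beta> - d\<^sup>2 - 2 * e - \<eta>) / 2"
          using e p by (intro divide_right_mono powr_mono) auto
        also have "\<dots> = h * ((real p powr (1 - \<beta>) / 2) * G)"
          unfolding h_def G_def using p by (simp add: powr_add[symmetric] algebra_simps)
        also have "\<dots> \<le> h * (real (s p) * G)"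
          using elim by (intro mult_left_mono mult_right_mono) (auto simp: h_def G_def)
        finally show "exp (8 * h\<^sup>2 * real p * exp (- (z * w)\<^sup>2 / 2) - h * (real (s p) * G) / 4) \<le> exp (8 - real p powr (2 * e) / 8)"
          using A by simp
      qed (use L elim in auto)
      finally show ?case by (simp add: ennreal_leI order_trans)
    qed
    show "g \<longlonglongrightarrow> 0"
      unfolding g_def using a e(1) L by real_asymp
  qed
qed

section \<open>Arithmetic of the boundary\<close>

text \<open>With \<open>v = sqrt (1 - \<beta>)\<close> the difference of the sides is
  \<open>(1 - 2 * v)\<^sup>2 / 2\<close>: the two branches of the boundary touch at \<beta> = 3/4
  without crossing.\<close>

lemma boundary_pieces_le:
  fixes \<beta> :: real
  assumes "\<beta> \<le> 1"
  shows "\<beta> - 1/2 \<le> (1 - sqrt (1 - \<beta>))\<^sup>2"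
proof -
  define v where "v = sqrt (1 - \<beta>)"
  have "0 \<le> (1 - 2 * v)\<^sup>2" by simp
  then have "0 \<le> 1 - 4 * v + 4 * v\<^sup>2" by (simp add: power2_eq_square algebra_simps)
  moreover have "(1 - v)\<^sup>2 = 1 - 2 * v + v\<^sup>2" by (simp add: power2_eq_square algebra_simps)
  moreover have "v\<^sup>2 = 1 - \<beta>" using assms by (simp add: v_def)
  ultimately show ?thesis unfolding v_def[symmetric] by linarith
qed

text \<open>The slack \<open>1 - \<beta> - (z - sqrt r')\<^sup>2 - (1 - z\<^sup>2) / 2\<close> is
  largest at \<open>z = 2 * sqrt r'\<close>, where it equals \<open>1/2 - \<beta> + r'\<close>. From
  r' = 1/4 on this level would reach the maximum of the noise; then \<open>z = 1\<close>, any small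
  \<eta> is allowed, and the requirement becomes
  \<open>(1 - sqrt r')\<^sup>2 < 1 - \<beta>\<close>.\<close>

lemma above_boundary_parameters:
  fixes \<beta> r' :: real
  assumes \<beta>: "1/2 < \<beta>" "\<beta> < 1" and r': "r2star a \<beta> < r'" "r' < 1"
  obtains z \<eta> where "0 < r'" "sqrt r' \<le> z" "0 < \<eta>" "1 - z\<^sup>2 \<le> 2 * \<eta>" "\<eta> < 1 - \<beta> - (z - sqrt r')\<^sup>2"
proof -
  define v where "v = sqrt (1 - \<beta>)"
  have v: "0 < v" "v\<^sup>2 = 1 - \<beta>" "v < 1" using \<beta> by (auto simp: v_def)
  have cmp: "\<beta> - 1/2 \<le> (1 - v)\<^sup>2"
    using boundary_pieces_le[of \<beta>] \<beta> by (simp add: v_def)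
  have r0: "0 < r'" "\<beta> - 1/2 < r'"
    using r' \<beta> cmp by (auto simp: r2star_def v_def split: if_splits)
  have sr: "0 < sqrt r'" "(sqrt r')\<^sup>2 = r'" "sqrt r' < 1" using r0 r' by auto
  show ?thesis
  proof (cases "r' < 1/4")
    case True
    have "sqrt r' \<le> 2 * sqrt r'" using sr by simp
    moreover have "1 - (2 * sqrt r')\<^sup>2 = 1 - 4 * r'" using sr(2) by (simp add: power_mult_distrib)
    moreover have "(2 * sqrt r' - sqrt r')\<^sup>2 = r'" using sr(2) by simp
    moreover have "0 < (1 - 4 * r') / 2" using True by simp
    moreover have "(1 - 4 * r') / 2 < 1 - \<beta> - r'" using r0(2) by (simp add: field_simps)
    ultimately show ?thesis using r0 by (intro that[of "2 * sqrt r'" "(1 - 4 * r') / 2"]) auto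
  next
    case False
    have "1 - v < sqrt r'"
    proof (cases "\<beta> \<le> 3/4")
      case True
      have "(1/2)\<^sup>2 \<le> v\<^sup>2" using True v(2) by (simp add: power2_eq_square)
      then have v2: "1/2 \<le> v" using v(1) by (rule_tac power2_le_imp_le) auto
      have s2: "1/2 \<le> sqrt r'"
        using False by (intro real_le_rsqrt) (simp add: power2_eq_square)
      show ?thesis
      \<comment> \<open>At \<beta> = 3/4 both bounds by 1/2 may be equalities, and strictness has to
        come from \<open>\<beta> - 1/2 < r'\<close>.\<close>
      proof (cases "v = 1/2")
        case True
        then have "1 - \<beta> = (1/2)\<^sup>2" using v(2) by (simp only:)
        then have "\<beta> = 3/4" by (simp add: power2_eq_square)
        then have "(1/2)\<^sup>2 < r'" using r0(2) by (simp add: power2_eq_square)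
        then have "1/2 < sqrt r'" by (rule real_less_rsqrt)
        then show ?thesis using True by simp
      qed (use v2 s2 in linarith)
    next
      case False
      then have "(1 - v)\<^sup>2 < r'" using r' \<beta> by (simp add: r2star_def v_def)
      then show ?thesis by (rule real_less_rsqrt)
    qed
    then have "(1 - sqrt r')\<^sup>2 < v\<^sup>2" using sr v by (intro power_strict_mono) auto
    then have pos: "0 < 1 - \<beta> - (1 - sqrt r')\<^sup>2" using v by simp
    then obtain \<eta> where "0 < \<eta>" "\<eta> < 1 - \<beta> - (1 - sqrt r')\<^sup>2" using dense by blast
    then show ?thesis using sr r0 by (intro that[of 1 \<eta>]) auto
  qed
qed

text \<open>Over c \<ge> 0 the exponent is smallest at \<open>c = 2 * sqrt r - 1\<close>, or at 0 if
  that is negative. In the latter case truncation brings nothing and r \<le> \<beta> - 1/2 is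
  needed. In the former the exponent is \<open>2 * (2 * sqrt r - r - \<beta>)\<close>, whose
  negativity is the condition that truncation keeps the mass.\<close>

lemma below_boundary_parameters:
  fixes \<beta> r :: real
  assumes \<beta>: "1/2 < \<beta>" "\<beta> < 1" and r: "0 < r" "r < r2star a \<beta>"
  obtains c where "r < 1" "1 - \<beta> < (1 - sqrt r)\<^sup>2" "0 \<le> c"
    "1 - 2 * \<beta> + ((2 * sqrt r - c)\<^sup>2 - 2 * r + 2 * c) \<le> 0"
proof -
  define v where "v = sqrt (1 - \<beta>)"
  have v: "0 < v" "v\<^sup>2 = 1 - \<beta>" "v < 1" using \<beta> by (auto simp: v_def)
  have sr: "0 < sqrt r" "(sqrt r)\<^sup>2 = r" using r by auto
  have cmp: "\<beta> - 1/2 \<le> (1 - v)\<^sup>2"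
    using boundary_pieces_le[of \<beta>] \<beta> by (simp add: v_def)
  have "r < (1 - v)\<^sup>2" using r \<beta> cmp by (auto simp: r2star_def v_def split: if_splits)
  then have "(sqrt r)\<^sup>2 < (1 - v)\<^sup>2" using sr by simp
  then have lt: "sqrt r < 1 - v" using v by (intro power_less_imp_less_base[of "sqrt r" 2]) auto
  then have "v\<^sup>2 < (1 - sqrt r)\<^sup>2" using v by (intro power_strict_mono) auto
  then have sep: "1 - \<beta> < (1 - sqrt r)\<^sup>2" using v by simp
  have "sqrt r < 1" using lt v(1) by linarith
  then have "r < 1" by simp
  show ?thesis
  proof (cases "r \<le> 1/4")
    case True
    \<comment> \<open>On the branch \<beta> > 3/4 this follows from
      \<open>r \<le> 1/4\<close>.\<close>
    have "r \<le> \<beta> - 1/2" using True r \<beta> by (auto simp: r2star_def split: if_splits)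
    then show ?thesis using sep \<open>r < 1\<close> sr(2) by (intro that[of 0]) (auto simp: power_mult_distrib)
  next
    case False
    then have "(1/2)\<^sup>2 \<le> r" by (simp add: power2_eq_square)
    then have half: "1/2 \<le> sqrt r" by (rule real_le_rsqrt)
    have "(1 - sqrt r)\<^sup>2 = 1 - 2 * sqrt r + r"
      using sr(2) by (simp add: power2_eq_square algebra_simps)
    then have "1 - 2 * \<beta> + ((2 * sqrt r - (2 * sqrt r - 1))\<^sup>2 - 2 * r + 2 * (2 * sqrt r - 1)) \<le> 0"
      using sep by simp
    then show ?thesis using sep \<open>r < 1\<close> half by (intro that[of "2 * sqrt r - 1"]) auto
  qed
qed

theorem theorem3:
  fixes a \<beta> :: real and n s :: "nat \<Rightarrow> nat"
  assumes "a > 0" and "1/2 < \<beta>" and "\<beta> \<le> 1"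
    and "(\<lambda>p. ln (ln (real (n p)))) \<sim>[at_top] (\<lambda>p. a * ln (real p))"
    and "(\<lambda>p. real (s p)) \<sim>[at_top] (\<lambda>p. real p powr (1 - \<beta>))"
  shows "(\<forall>r>0. r < r2star a \<beta> \<longrightarrow>
           \<not> ((\<lambda>p. risk_1side p (n p) (sqrt (2 * r * ln (real p))) (s p)) \<longlonglongrightarrow> 0))
       \<and> (\<forall>r>0. r > r2star a \<beta> \<longrightarrow>
           ((\<lambda>p. risk_1side p (n p) (sqrt (2 * r * ln (real p))) (s p)) \<longlonglongrightarrow> 0))"
proof -
  have n: "\<forall>\<^sub>F p in at_top. real p powr (a - e) \<le> ln (real (n p)) \<and> ln (real (n p)) \<le> real p powr (a + e)"
    if "0 < e" for e
    by (rule asymp_equiv_loglog_bounds[OF assms(1) that assms(4)])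
  note s = asymp_equiv_sparsity_bounds[OF assms(5)]
  show ?thesis
  proof (cases "\<beta> = 1")
    case True
    have "(\<lambda>p. real (s p)) \<sim>[at_top] (\<lambda>_. 1)"
    proof (rule asymp_equiv_cong[THEN iffD1, OF _ _ assms(5)])
      show "\<forall>\<^sub>F p in at_top. real p powr (1 - \<beta>) = 1"
        using eventually_gt_at_top[of 0] by eventually_elim (simp add: True)
    qed simp
    then have "(\<lambda>p. real (s p)) \<longlonglongrightarrow> 1" by (rule asymp_equivD_const)
    \<comment> \<open>An integer sequence converging to 1 is eventually equal to 1.\<close>
    from tendstoD[OF this, of "1/2"] have "\<forall>\<^sub>F p in at_top. dist (real (s p)) 1 < 1/2" by simp
    then have s1: "\<forall>\<^sub>F p in at_top. s p = 1"
    proof eventually_elim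
      case (elim p)
      then show ?case unfolding dist_real_def by linarith
    qed
    have star: "r2star a \<beta> = 1 + a" using True by (simp add: r2star_def)
    show ?thesis
      unfolding star
    proof (intro conjI allI impI)
      fix r :: real assume "0 < r" "r < 1 + a"
      then show "\<not> (\<lambda>p. risk_1side p (n p) (sqrt (2 * r * ln (real p))) (s p)) \<longlonglongrightarrow> 0"
        using n[unfolded eventually_conj_iff, THEN conjunct1] s1 assms(1) by (intro risk_not_tendsto_0_single)
    next
      fix r :: real assume "0 < r" "1 + a < r"
      then show "(\<lambda>p. risk_1side p (n p) (sqrt (2 * r * ln (real p))) (s p)) \<longlonglongrightarrow> 0"
        using n s1 assms(1) by (intro risk_tendsto_0_single)
    qed
  next
    case False
    then have \<beta>: "1/2 < \<beta>" "\<beta> < 1" using assms by auto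
    have n2: "\<forall>\<^sub>F p in at_top. 2 \<le> n p"
    using n[OF assms(1)] unfolding eventually_conj_iff by (blast intro: eventually_ge_2_if_ln_ge_powr)
    show ?thesis
    proof (intro conjI allI impI)
      fix r :: real assume r: "0 < r" "r < r2star a \<beta>"
      obtain c where "r < 1" "1 - \<beta> < (1 - sqrt r)\<^sup>2" "0 \<le> c"
          "1 - 2 * \<beta> + ((2 * sqrt r - c)\<^sup>2 - 2 * r + 2 * c) \<le> 0"
        using below_boundary_parameters[OF \<beta> r] by blast
      then show "\<not> (\<lambda>p. risk_1side p (n p) (sqrt (2 * r * ln (real p))) (s p)) \<longlonglongrightarrow> 0"
        using \<beta> r n2 s by (intro risk_not_tendsto_0_sparse)
    next
      fix r :: real assume r: "0 < r" "r2star a \<beta> < r"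
      have "r2star a \<beta> < 1"
      proof (cases "\<beta> \<le> 3/4")
        case True then show ?thesis by (simp add: r2star_def)
      next
        case False
        have "(1 - sqrt (1 - \<beta>))\<^sup>2 < 1\<^sup>2" using \<beta> by (intro power_strict_mono) auto
        then show ?thesis using False \<beta> by (simp add: r2star_def)
      qed
      \<comment> \<open>\<open>r\<close> itself may exceed 1. The parameters are chosen for a
        smaller \<open>r'\<close> below 1, and the cell length \<open>ln (r / r')\<close> of the
        cover absorbs the difference.\<close>
      then obtain r' where r': "r2star a \<beta> < r'" "r' < min 1 r" using dense[of "r2star a \<beta>" "min 1 r"] r by auto
      obtain z \<eta> where "0 < r'" "sqrt r' \<le> z" "0 < \<eta>" "1 - z\<^sup>2 \<le> 2 * \<eta>" "\<eta> < 1 - \<beta> - (z - sqrt r')\<^sup>2"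
        using above_boundary_parameters[OF \<beta> r'(1)] r'(2) by auto
      then show "(\<lambda>p. risk_1side p (n p) (sqrt (2 * r * ln (real p))) (s p)) \<longlonglongrightarrow> 0"
        using assms(1) r' n s[unfolded eventually_conj_iff, THEN conjunct1]
        by (intro risk_tendsto_0_sparse[of a r' r z \<eta> \<beta>]) auto
    qed
  qed
qed

end
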